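(* Let $N\in\{1,2,3\}$, $p=2$, $\frac N4<s<1$, $\lambda_j,\mu_j>0$ ($j=1,2,3$), and $\beta_{ij}=\beta_{ji}\in\mathbb{R}$ ($i\neq j$) such that for every $i\in\{1,2,3\}$ there exists $j\neq i$ with $\beta_{ij}>\gamma_{ij}^2$. Then the system $(-\Delta)^s u_j+\lambda_ju_j=\mu_j|u_j|^{2p-2}u_j+\sum_{k\neq j}\beta_{jk}|u_k|^p|u_j|^{p-2}u_j$ in $\mathbb{R}^N$, $u_j\in W^{s,2}(\mathbb{R}^N)$, $j=1,2,3$, has a nonnegative radial ground state $\widetilde{\mathbf{u}}$, i.e. a radial critical point $\widetilde{\mathbf{u}}\neq\mathbf{0}$ of the associated energy $\Phi$ with all components nonnegative such that $\Phi(\widetilde{\mathbf{u}})=\min\{\Phi(\mathbf{v}):\mathbf{v}\neq\mathbf{0},\ \Phi'(\mathbf{v})=0\}$.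
   Context: $E=W^{s,2}(\mathbb{R}^N)$ with norms $\|u\|_j^2=\int_{\mathbb{R}^N}(|(-\Delta)^{s/2}u|^2+\lambda_ju^2)dx$. The energy on $E^3$ is $\Phi(\mathbf{u})=\frac12\sum_{j=1}^3\|u_j\|_j^2-\frac{1}{2p}\sum_{j=1}^3\mu_j\int|u_j|^{2p}-\frac1p\sum_{1\le i<j\le3}\beta_{ij}\int|u_i|^p|u_j|^p$, whose critical points are the weak solutions of the system. $U_i$ is the unique positive radial solution in $E$ of $(-\Delta)^s u+\lambda_i u=\mu_i|u|^{2p-2}u$, and $\gamma_{ij}^2=\inf_{\varphi\in E\setminus\{0\}}\|\varphi\|_j^2/\int_{\mathbb{R}^N}U_i^2\varphi^2dx$ for $i\neq j$. *)

theory Defs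
  imports "HOL-Analysis.Analysis"
begin

text \<open>Fractional setting on the Euclidean space 'a of dimension N = DIM('a).
  The quadratic form of the fractional Laplacian is written through the Gagliardo
  double integral: for u,v in W^{s,2},
  int ((-Delta)^{s/2} u) ((-Delta)^{s/2} v) = C(N,s)/2 * double integral of
  (u x - u y)(v x - v y) / |x-y|^(N+2s),  with
  C(N,s) = (int (1 - cos z_1) / |z|^(N+2s) dz)^(-1).\<close>

definition frac_const :: "'a::euclidean_space itself \<Rightarrow> real \<Rightarrow> real" where
  "frac_const _ s = 1 / (LINT z|(lborel :: 'a measure).
      (1 - cos (z \<bullet> (SOME b. b \<in> (Basis :: 'a set)))) / norm z powr (real DIM('a) + 2 * s))"

definition sform :: "real \<Rightarrow> ('a::euclidean_space \<Rightarrow> real) \<Rightarrow> ('a \<Rightarrow> real) \<Rightarrow> real" where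
  "sform s u v = frac_const TYPE('a) s / 2 *
     (LINT xy|(lborel \<Otimes>\<^sub>M lborel :: ('a \<times> 'a) measure).
        (u (fst xy) - u (snd xy)) * (v (fst xy) - v (snd xy))
          / norm (fst xy - snd xy) powr (real DIM('a) + 2 * s))"

definition Hs :: "real \<Rightarrow> ('a::euclidean_space \<Rightarrow> real) \<Rightarrow> bool" where
  "Hs s u \<longleftrightarrow> u \<in> borel_measurable lborel \<and> integrable lborel (\<lambda>x. (u x)\<^sup>2) \<and>
     integrable (lborel \<Otimes>\<^sub>M lborel :: ('a \<times> 'a) measure)
       (\<lambda>xy. (u (fst xy) - u (snd xy))\<^sup>2 / norm (fst xy - snd xy) powr (real DIM('a) + 2 * s))"

definition jnorm2 :: "real \<Rightarrow> real \<Rightarrow> ('a::euclidean_space \<Rightarrow> real) \<Rightarrow> real" where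
  "jnorm2 s lam u = sform s u u + lam * (LINT x|lborel. (u x)\<^sup>2)"

definition radial :: "('a::euclidean_space \<Rightarrow> real) \<Rightarrow> bool" where
  "radial u \<longleftrightarrow> (\<forall>x y. norm x = norm y \<longrightarrow> u x = u y)"

definition scalar_sol :: "real \<Rightarrow> real \<Rightarrow> real \<Rightarrow> ('a::euclidean_space \<Rightarrow> real) \<Rightarrow> bool" where
  "scalar_sol s lam mu u \<longleftrightarrow> Hs s u \<and>
     (\<forall>\<phi>. Hs s \<phi> \<longrightarrow>
        sform s u \<phi> + lam * (LINT x|lborel. u x * \<phi> x) = mu * (LINT x|lborel. (u x)^3 * \<phi> x))"

definition Ugs :: "real \<Rightarrow> real \<Rightarrow> real \<Rightarrow> ('a::euclidean_space \<Rightarrow> real)" where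
  "Ugs s lam mu = (THE u. scalar_sol s lam mu u \<and> (\<forall>x. u x > 0) \<and> radial u \<and> continuous_on UNIV u)"

definition gamma2 :: "real \<Rightarrow> real \<Rightarrow> ('a::euclidean_space \<Rightarrow> real) \<Rightarrow> real" where
  "gamma2 s lamj Ui = Inf {jnorm2 s lamj \<phi> / (LINT x|lborel. (Ui x)\<^sup>2 * (\<phi> x)\<^sup>2) | \<phi>.
                          Hs s \<phi> \<and> \<not> (AE x in lborel. \<phi> x = 0)}"

definition Phi :: "real \<Rightarrow> (nat \<Rightarrow> real) \<Rightarrow> (nat \<Rightarrow> real) \<Rightarrow> (nat \<Rightarrow> nat \<Rightarrow> real)
                   \<Rightarrow> (nat \<Rightarrow> 'a::euclidean_space \<Rightarrow> real) \<Rightarrow> real" where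
  "Phi s lam mu beta u =
     1/2 * (\<Sum>j\<in>{1..3}. jnorm2 s (lam j) (u j))
     - 1/4 * (\<Sum>j\<in>{1..3}. mu j * (LINT x|lborel. (u j x)^4))
     - 1/2 * (\<Sum>i\<in>{1..3}. \<Sum>j\<in>{1..3}. if i < j then beta i j * (LINT x|lborel. (u i x)\<^sup>2 * (u j x)\<^sup>2) else 0)"

text \<open>Critical points of Phi = weak solutions of the system (p = 2).\<close>
definition crit :: "real \<Rightarrow> (nat \<Rightarrow> real) \<Rightarrow> (nat \<Rightarrow> real) \<Rightarrow> (nat \<Rightarrow> nat \<Rightarrow> real)
                   \<Rightarrow> (nat \<Rightarrow> 'a::euclidean_space \<Rightarrow> real) \<Rightarrow> bool" where
  "crit s lam mu beta u \<longleftrightarrow> (\<forall>j\<in>{1..3}. Hs s (u j)) \<and>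
     (\<forall>j\<in>{1..3}. \<forall>\<phi>. Hs s \<phi> \<longrightarrow>
        sform s (u j) \<phi> + lam j * (LINT x|lborel. u j x * \<phi> x)
        = mu j * (LINT x|lborel. (u j x)^3 * \<phi> x)
          + (\<Sum>k\<in>{1..3} - {j}. beta j k * (LINT x|lborel. (u k x)\<^sup>2 * u j x * \<phi> x)))"

definition nontriv :: "(nat \<Rightarrow> 'a::euclidean_space \<Rightarrow> real) \<Rightarrow> bool" where
  "nontriv u \<longleftrightarrow> \<not> (\<forall>j\<in>{1..3}. AE x in lborel. u j x = 0)"

end

theory Submission
  imports Defs "HOL-Complex_Analysis.Great_Picard"
begin

text \<open>Write \<open>Q u\<close> for the sum of the squared norms and \<open>F u\<close> for the quartic part of the energy, so that
  \<open>Phi = Q / 2 - F / 4\<close>, and let \<open>S\<close> be the supremum of \<open>F\<close> on \<open>Q \<le> 1\<close>. Testing a critical point with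
  itself gives \<open>Q = F \<le> S * Q\<^sup>2\<close>, so every nontrivial critical point has energy \<open>Q / 4 \<ge> 1 / (4 * S)\<close>, and a
  maximiser of \<open>F\<close> on \<open>Q = 1\<close>, divided by the square root of \<open>S\<close>, is a critical point attaining this
  value. A maximiser exists because a maximising sequence does not vanish after translation and, by the
  Brezis--Lieb splitting, cannot dichotomise. Two components of a maximiser with nonpositive coupling
  cannot both be nonzero, since \<open>F\<close> is strictly convex along the exchange of energy between them. Hence
  all couplings that matter are positive and polarisation cannot decrease \<open>F\<close> nor increase \<open>Q\<close>;
  its equality case makes every component radial about a centre, and moving the
  centres together keeps the maximum.\<close>

section \<open>Square integrable functions and measure preserving maps\<close>

text \<open>Since \<open>s\<close> exceeds a quarter of the dimension,
  \<open>\<sigma> = 2 * s / DIM('a)\<close> exceeds 1/2 and the fourth power is subcritical: the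
  control of large values rests on \<open>2 - 4 * \<sigma> < 0\<close>. Existence is therefore
  settled in the whole space, where translations destroy compactness, and symmetry is recovered
  afterwards, for a maximiser whose active couplings are known to be positive. Limits are taken
  almost everywhere along a subsequence in place of weak limits; this is all that Brezis--Lieb
  needs. Splitting is excluded because the quartic part has twice the degree of the squared norm:
  portions \<open>q\<close> and \<open>1 - q\<close> would yield at most the fraction
  \<open>q\<^sup>2 + (1 - q)\<^sup>2\<close> of \<open>S\<close>, less than 1 for
  \<open>0 < q < 1\<close>. Polarisation serves in place of Schwarz symmetrisation because it
  reduces to an inequality between four pairs of points, whose equality case can be read off
  directly.\<close>

lemma integrable_dominated:
  fixes f g :: "'b \<Rightarrow> real"
  assumes "integrable M f" "g \<in> borel_measurable M" "\<And>x. \<bar>g x\<bar> \<le> f x"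
  shows "integrable M g"
proof (rule Bochner_Integration.integrable_bound[OF assms(1,2)])
  show "AE x in M. norm (g x) \<le> norm (f x)"
    using assms(3) by (intro AE_I2) (metis abs_ge_self order_trans real_norm_def)
qed

definition sq_integrable :: "'b measure \<Rightarrow> ('b \<Rightarrow> real) \<Rightarrow> bool" where
  "sq_integrable M f \<longleftrightarrow> f \<in> borel_measurable M \<and> integrable M (\<lambda>x. (f x)\<^sup>2)"

lemma sq_integrable_measurable [measurable_dest]: "sq_integrable M f \<Longrightarrow> f \<in> borel_measurable M"
  by (simp add: sq_integrable_def)

lemma sq_integrable_square: "sq_integrable M f \<Longrightarrow> integrable M (\<lambda>x. (f x)\<^sup>2)"
  by (simp add: sq_integrable_def)

lemma sq_integrable_mult:
  assumes f: "sq_integrable M f" and g: "sq_integrable M g"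
  shows "integrable M (\<lambda>x. f x * g x)"
proof (rule Bochner_Integration.integrable_bound)
  show "integrable M (\<lambda>x. (f x)\<^sup>2 + (g x)\<^sup>2)"
    using f g by (simp add: sq_integrable_def)
  show "(\<lambda>x. f x * g x) \<in> borel_measurable M"
    using sq_integrable_measurable[OF f] sq_integrable_measurable[OF g] by measurable
  have "\<bar>a * b\<bar> \<le> a\<^sup>2 + b\<^sup>2" for a b :: real
  proof -
    have "0 \<le> (\<bar>a\<bar> - \<bar>b\<bar>)\<^sup>2" by simp
    then have "2 * (\<bar>a\<bar> * \<bar>b\<bar>) \<le> a\<^sup>2 + b\<^sup>2" by (simp add: power2_diff)
    moreover have "0 \<le> \<bar>a\<bar> * \<bar>b\<bar>" by simp
    ultimately show ?thesis unfolding abs_mult by linarith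
  qed
  then show "AE x in M. norm (f x * g x) \<le> norm ((f x)\<^sup>2 + (g x)\<^sup>2)"
    by simp
qed

lemma sq_integrable_add:
  assumes f: "sq_integrable M f" and g: "sq_integrable M g"
  shows "sq_integrable M (\<lambda>x. f x + g x)"
proof -
  have "integrable M (\<lambda>x. (f x)\<^sup>2 + (g x)\<^sup>2 + 2 * (f x * g x))"
    using sq_integrable_mult[OF f g] f g by (auto simp: sq_integrable_def)
  moreover have "(\<lambda>x. f x + g x) \<in> borel_measurable M"
    using sq_integrable_measurable[OF f] sq_integrable_measurable[OF g] by measurable
  ultimately show ?thesis
    by (simp add: sq_integrable_def power2_sum mult.assoc)
qed

lemma sq_integrable_cmult: "sq_integrable M f \<Longrightarrow> sq_integrable M (\<lambda>x. c * f x)"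
  by (auto simp: sq_integrable_def power_mult_distrib)

lemma sq_integrable_diff:
  assumes "sq_integrable M f" "sq_integrable M g"
  shows "sq_integrable M (\<lambda>x. f x - g x)"
  using sq_integrable_add[OF assms(1) sq_integrable_cmult[OF assms(2), of "-1"]] by simp

lemma sq_integrable_bound:
  assumes "sq_integrable M f" "g \<in> borel_measurable M" "\<And>x. \<bar>g x\<bar> \<le> \<bar>f x\<bar>"
  shows "sq_integrable M g"
  unfolding sq_integrable_def
  by (rule conjI, fact, rule Bochner_Integration.integrable_bound[OF sq_integrable_square[OF assms(1)]])
     (use assms in \<open>auto simp: abs_le_square_iff\<close>)

lemma young_ineq: "(e::real) > 0 \<Longrightarrow> \<bar>a * b\<bar> \<le> e * a\<^sup>2 + (1 / e) * b\<^sup>2"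
proof -
  assume e: "e > 0"
  have "0 \<le> (e * \<bar>a\<bar> - \<bar>b\<bar>)\<^sup>2" by simp
  then have "2 * e * (\<bar>a\<bar> * \<bar>b\<bar>) \<le> e\<^sup>2 * a\<^sup>2 + b\<^sup>2"
    by (simp add: power2_diff power_mult_distrib)
  moreover have "0 \<le> e * (\<bar>a\<bar> * \<bar>b\<bar>)" using e by simp
  ultimately have "e * (\<bar>a\<bar> * \<bar>b\<bar>) \<le> e\<^sup>2 * a\<^sup>2 + b\<^sup>2" by linarith
  then have "e * (\<bar>a\<bar> * \<bar>b\<bar>) / e \<le> (e\<^sup>2 * a\<^sup>2 + b\<^sup>2) / e"
    using e by (intro divide_right_mono) auto
  then show ?thesis
    using e by (simp add: abs_mult add_divide_distrib power2_eq_square)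
qed

text \<open>The analytic core of the Brezis--Lieb lemma: subtracting \<open>e * h n\<close> leaves a sequence
  dominated by a multiple of \<open>k\<close>.\<close>
lemma brezis_lieb_core:
  fixes g h :: "nat \<Rightarrow> 'b \<Rightarrow> real" and k :: "'b \<Rightarrow> real"
  assumes gm [measurable]: "\<And>n. g n \<in> borel_measurable M"
    and lim: "AE x in M. (\<lambda>n. g n x) \<longlonglongrightarrow> 0"
    and k: "integrable M k" and h: "\<And>n. integrable M (h n)"
    and h0: "\<And>n x. 0 \<le> h n x" and k0: "\<And>x. 0 \<le> k x"
    and B: "\<And>n. (\<integral>x. h n x \<partial>M) \<le> B"
    and bd: "\<And>e. e > 0 \<Longrightarrow> \<exists>C. \<forall>n x. \<bar>g n x\<bar> \<le> e * h n x + C * k x"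
  shows "(\<lambda>n. \<integral>x. \<bar>g n x\<bar> \<partial>M) \<longlonglongrightarrow> 0"
proof -
  have [measurable]: "k \<in> borel_measurable M" "\<And>n. h n \<in> borel_measurable M"
    using k h by auto
  have gi: "integrable M (g n)" for n
  proof -
    obtain C where C: "\<And>n x. \<bar>g n x\<bar> \<le> 1 * h n x + C * k x" using bd[of 1] by auto
    show ?thesis
      by (rule integrable_dominated[where f="\<lambda>x. 1 * h n x + C * k x"]) (use k h C in auto)
  qed
  have B0: "0 \<le> B" using B[of 0] h0 by (metis Bochner_Integration.integral_nonneg order_trans)
  show "(\<lambda>n. \<integral>x. \<bar>g n x\<bar> \<partial>M) \<longlonglongrightarrow> 0"
  proof (rule LIMSEQ_I)
    fix r :: real assume r: "r > 0"
    \<comment> \<open>This makes \<open>e * (B + 1)\<close> equal to \<open>r / 2\<close>; the added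
      1 keeps the denominator positive when \<open>B = 0\<close>.\<close>
    define e where "e = r / 2 / (B + 1)"
    have e: "e > 0" using r B0 by (simp add: e_def)
    obtain C where C: "\<And>n x. \<bar>g n x\<bar> \<le> e * h n x + C * k x" using bd[OF e] by blast
    define w where "w n x = max 0 (\<bar>g n x\<bar> - e * h n x)" for n x
    have wm [measurable]: "w n \<in> borel_measurable M" for n unfolding w_def by measurable
    have wb: "\<bar>w n x\<bar> \<le> \<bar>C\<bar> * k x" for n x
    proof -
      have "C * k x \<le> \<bar>C\<bar> * k x" using k0[of x] by (intro mult_right_mono) auto
      then show ?thesis using C[of n x] k0[of x] by (auto simp: w_def)
    qed
    have wlim: "(\<lambda>n. \<integral>x. w n x \<partial>M) \<longlonglongrightarrow> (\<integral>x. 0 \<partial>M)"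
    proof (rule integral_dominated_convergence[where w="\<lambda>x. \<bar>C\<bar> * k x"])
      show "AE x in M. (\<lambda>n. w n x) \<longlonglongrightarrow> 0"
        using lim
      proof eventually_elim
        case (elim x)
        have "(\<lambda>n. \<bar>g n x\<bar>) \<longlonglongrightarrow> 0" using elim by (simp add: tendsto_rabs_zero_iff)
        then show ?case
          by (rule tendsto_sandwich[OF _ _ tendsto_const, rotated 2])
             (use e h0 in \<open>auto simp: w_def intro!: always_eventually\<close>)
      qed
    qed (use k wb in auto)
    have wi: "integrable M (w n)" for n
      by (rule integrable_dominated[where f="\<lambda>x. \<bar>C\<bar> * k x"]) (use k wb in auto)
    obtain n0 where n0: "\<And>n. n \<ge> n0 \<Longrightarrow> \<bar>\<integral>x. w n x \<partial>M\<bar> < r / 2"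
      using LIMSEQ_D[OF wlim, of "r/2"] r by auto
    show "\<exists>no. \<forall>n\<ge>no. norm ((\<integral>x. \<bar>g n x\<bar> \<partial>M) - 0) < r"
    proof (intro exI allI impI)
      fix n assume n: "n \<ge> n0"
      have "(\<integral>x. \<bar>g n x\<bar> \<partial>M) \<le> (\<integral>x. w n x + e * h n x \<partial>M)"
        using gi wi h by (intro integral_mono) (auto simp: w_def)
      also have "\<dots> = (\<integral>x. w n x \<partial>M) + e * (\<integral>x. h n x \<partial>M)"
        using wi h by simp
      also have "\<dots> < r / 2 + e * B + e"
        using n0[OF n] mult_left_mono[OF B[of n], of e] e by linarith
      also have "\<dots> = r"
      proof -
        have "e * (B + 1) = r / 2" using B0 nonzero_eq_divide_eq[of "B + 1" e "r / 2"] e_def by auto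
        then show ?thesis by (simp add: distrib_left)
      qed
      finally show "norm ((\<integral>x. \<bar>g n x\<bar> \<partial>M) - 0) < r" by simp
    qed
  qed
qed

section \<open>Measure preserving maps and change of variables\<close>

definition measure_preserving :: "('a::euclidean_space \<Rightarrow> 'a) \<Rightarrow> bool" where
  "measure_preserving T \<longleftrightarrow> T \<in> borel_measurable borel \<and> distr lborel lborel T = lborel"

lemma measure_preserving_measurable [measurable_dest]: "measure_preserving T \<Longrightarrow> T \<in> borel_measurable borel"
  by (simp add: measure_preserving_def)

lemma
  fixes f :: "'a::euclidean_space \<Rightarrow> real"
  assumes T: "measure_preserving T" and f [measurable]: "f \<in> borel_measurable borel"
  shows measure_preserving_integral: "(LINT x|lborel. f (T x)) = (LINT x|lborel. f x)"
    and measure_preserving_integrable: "integrable lborel (\<lambda>x. f (T x)) \<longleftrightarrow> integrable lborel f"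
proof -
  have [measurable]: "T \<in> borel_measurable borel" and d: "distr lborel lborel T = lborel"
    using T by (auto simp: measure_preserving_def)
  show "(LINT x|lborel. f (T x)) = (LINT x|lborel. f x)"
    by (subst (2) d[symmetric], subst integral_distr) auto
  show "integrable lborel (\<lambda>x. f (T x)) \<longleftrightarrow> integrable lborel f"
    by (subst (2) d[symmetric], subst integrable_distr_eq) auto
qed

lemma measure_preserving_AE:
  assumes T: "measure_preserving T" and P: "AE x in lborel. P x"
  shows "AE x in lborel. P (T x)"
proof -
  have [measurable]: "T \<in> borel_measurable borel" and d: "distr lborel lborel T = lborel"
    using T by (auto simp: measure_preserving_def)
  have "AE x in distr lborel lborel T. P x" by (subst d) (rule P)
  then show ?thesis by (rule AE_distrD[rotated]) simp
qed

lemma distr_pair_measure_preserving: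
  assumes T: "measure_preserving T" and T': "measure_preserving T'"
  shows "distr (lborel \<Otimes>\<^sub>M lborel) (lborel \<Otimes>\<^sub>M lborel) (\<lambda>(x, y). (T x, T' y)) = lborel \<Otimes>\<^sub>M lborel"
proof -
  have m: "T \<in> borel_measurable borel" "T' \<in> borel_measurable borel"
    and d: "distr lborel lborel T = lborel" "distr lborel lborel T' = lborel"
    using T T' by (auto simp: measure_preserving_def)
  have "distr lborel lborel T \<Otimes>\<^sub>M distr lborel lborel T' =
     distr (lborel \<Otimes>\<^sub>M lborel) (lborel \<Otimes>\<^sub>M lborel) (\<lambda>(x, y). (T x, T' y))"
    by (rule pair_measure_distr) (use m in \<open>auto simp: d intro: lborel.sigma_finite_measure_axioms\<close>)
  then show ?thesis by (simp add: d)
qed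

lemma
  fixes f :: "'a::euclidean_space \<times> 'a \<Rightarrow> real"
  assumes T: "measure_preserving T" and T': "measure_preserving T'"
    and f [measurable]: "f \<in> borel_measurable (lborel \<Otimes>\<^sub>M lborel)"
  shows measure_preserving_integral2:
      "(LINT z|(lborel \<Otimes>\<^sub>M lborel). f (T (fst z), T' (snd z))) = (LINT z|(lborel \<Otimes>\<^sub>M lborel). f z)"
    and measure_preserving_integrable2:
      "integrable (lborel \<Otimes>\<^sub>M lborel) (\<lambda>z. f (T (fst z), T' (snd z))) \<longleftrightarrow> integrable (lborel \<Otimes>\<^sub>M lborel) f"
proof -
  have [measurable]: "T \<in> borel_measurable borel" "T' \<in> borel_measurable borel"
    using T T' by (auto simp: measure_preserving_def)
  have [measurable]: "(\<lambda>(x, y). (T x, T' y)) \<in> (lborel \<Otimes>\<^sub>M lborel) \<rightarrow>\<^sub>M (lborel \<Otimes>\<^sub>M lborel)"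
    by measurable
  note d = distr_pair_measure_preserving[OF T T']
  show "(LINT z|(lborel \<Otimes>\<^sub>M lborel). f (T (fst z), T' (snd z))) = (LINT z|(lborel \<Otimes>\<^sub>M lborel). f z)"
    using integral_distr[of "\<lambda>(x, y). (T x, T' y)" "lborel \<Otimes>\<^sub>M lborel" "lborel \<Otimes>\<^sub>M lborel" f]
    by (simp add: d case_prod_beta)
  show "integrable (lborel \<Otimes>\<^sub>M lborel) (\<lambda>z. f (T (fst z), T' (snd z))) \<longleftrightarrow> integrable (lborel \<Otimes>\<^sub>M lborel) f"
    using integrable_distr_eq[of "\<lambda>(x, y). (T x, T' y)" "lborel \<Otimes>\<^sub>M lborel" "lborel \<Otimes>\<^sub>M lborel" f]
    by (simp add: d case_prod_beta)
qed

lemma measure_preserving_translation: "measure_preserving (\<lambda>x. a + x)"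
proof -
  have "distr lborel lborel ((+) a) = distr lborel borel ((+) a)" by (rule distr_cong) auto
  then show ?thesis by (simp add: measure_preserving_def lborel_distr_plus)
qed

lemma measure_preserving_uminus: "measure_preserving (uminus :: 'a::euclidean_space \<Rightarrow> 'a)"
proof -
  have "(\<lambda>x::'a. 0 + (-1) *\<^sub>R x) = uminus" by auto
  then have "distr lborel borel (uminus :: 'a \<Rightarrow> 'a) = lborel"
    using lborel_affine[of "-1" "0::'a"] by (simp add: density_1)
  moreover have "distr lborel lborel (uminus :: 'a \<Rightarrow> 'a) = distr lborel borel uminus" by (rule distr_cong) auto
  ultimately show ?thesis by (simp add: measure_preserving_def)
qed

lemma measure_preserving_comp:
  assumes "measure_preserving S" "measure_preserving T"
  shows "measure_preserving (\<lambda>x. S (T x))"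
proof -
  have [measurable]: "S \<in> borel_measurable borel" "T \<in> borel_measurable borel"
    using assms by auto
  have "distr lborel lborel (S \<circ> T) = distr (distr lborel lborel T) lborel S"
    by (rule distr_distr[symmetric]) auto
  then show ?thesis using assms by (simp add: measure_preserving_def comp_def)
qed


text \<open>A translation-invariant measure is determined by its value on the unit ball.\<close>
lemma measure_preserving_linear_isometry:
  fixes T :: "'a::euclidean_space \<Rightarrow> 'a"
  assumes lin: "linear T" and iso: "\<And>x. norm (T x) = norm x"
  shows "measure_preserving T"
proof -
  have Tc [measurable]: "T \<in> borel_measurable borel"
    using lin by (intro borel_measurable_continuous_onI linear_continuous_on linear_conv_bounded_linear[THEN iffD1])
  have inj: "inj T" using lin iso by (metis linear_injective_0 norm_eq_zero)
  then have surj: "surj T" using lin linear_injective_imp_surjective by blast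
  define \<mu> where "\<mu> = distr (lborel :: 'a measure) lborel T"
  have smu [measurable_cong, simp]: "sets \<mu> = sets borel" and spmu [simp]: "space \<mu> = UNIV"
    by (auto simp: \<mu>_def)
  have mu: "emeasure \<mu> A = emeasure lborel (T -` A)" if "A \<in> sets borel" for A
    using that unfolding \<mu>_def by (subst emeasure_distr) auto
  have muball: "emeasure \<mu> (ball 0 r) = emeasure lborel (ball (0::'a) r)" for r
  proof -
    have "T -` ball 0 r = ball 0 r" using iso by (auto simp: dist_norm)
    then show ?thesis by (simp add: mu)
  qed
  interpret mu: sigma_finite_measure \<mu>
  proof
    show "\<exists>A. countable A \<and> A \<subseteq> sets \<mu> \<and> \<Union>A = space \<mu> \<and> (\<forall>a\<in>A. emeasure \<mu> a \<noteq> \<infinity>)"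
    proof (intro exI[of _ "range (\<lambda>n. ball 0 (real n))"] conjI ballI)
      show "\<Union> (range (\<lambda>n. ball (0::'a) (real n))) = space \<mu>"
        using reals_Archimedean2 by (auto simp: dist_norm)
      show "emeasure \<mu> a \<noteq> \<infinity>" if "a \<in> range (\<lambda>n. ball 0 (real n))" for a
      proof -
        obtain n where a: "a = ball 0 (real n)" using \<open>a \<in> _\<close> by blast
        show ?thesis unfolding a muball using emeasure_lborel_ball_finite[of "0::'a" "real n"] by simp
      qed
    qed auto
  qed
  interpret pmu: pair_sigma_finite "lborel :: 'a measure" \<mu> ..
  have muinv: "emeasure \<mu> {y. y - x \<in> B} = emeasure \<mu> B" if B [measurable]: "B \<in> sets borel" for x B
  proof -
    \<comment> \<open>Writing the shift as \<open>T x'\<close> pulls it back to a shift by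
      \<open>x'\<close> for Lebesgue measure, so the image measure inherits translation
      invariance.\<close>
    obtain x' where x': "x = T x'" using surj by blast
    have "emeasure \<mu> {y. y - x \<in> B} = emeasure lborel (T -` {y. y - x \<in> B})" by (rule mu) measurable
    also have "T -` {y. y - x \<in> B} = (\<lambda>w. (- x') + w) -` (T -` B)"
      using x' lin by (auto simp: linear_diff linear_add linear_neg)
    also have "emeasure lborel \<dots> = emeasure (distr lborel lborel (\<lambda>w. (- x') + w)) (T -` B)"
      using measurable_sets_borel[OF Tc B] by (subst emeasure_distr) auto
    also have "\<dots> = emeasure \<mu> B"
      using measure_preserving_translation[of "-x'"] mu[OF B] by (simp add: measure_preserving_def)
    finally show ?thesis .
  qed
  \<comment> \<open>Both sides compute the double integral of
    \<open>indicator A x * indicator B (y - x)\<close>: integrating over \<open>y\<close> gives the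
    left side, and substituting \<open>z = y - x\<close> before integrating over \<open>y\<close>
    gives the right side. With \<open>B\<close> the unit ball, on which the two measures agree, they
    agree on every \<open>A\<close>.\<close>
  have key: "emeasure lborel A * emeasure \<mu> B = emeasure lborel B * emeasure \<mu> A"
    if A [measurable]: "A \<in> sets borel" and B [measurable]: "B \<in> sets borel" for A B :: "'a set"
  proof -
    have "emeasure lborel A * emeasure \<mu> B = (\<integral>\<^sup>+x. indicator A x * emeasure \<mu> {y. y - x \<in> B} \<partial>lborel)"
      by (simp add: muinv nn_integral_multc)
    also have "\<dots> = (\<integral>\<^sup>+x. (\<integral>\<^sup>+y. indicator A x * indicator B (y - x) \<partial>\<mu>) \<partial>lborel)"
    proof (rule nn_integral_cong)
      fix x
      have "(\<integral>\<^sup>+y. indicator A x * indicator B (y - x) \<partial>\<mu>) =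
        (\<integral>\<^sup>+y. indicator A x * indicator {y. y - x \<in> B} y \<partial>\<mu>)"
        by (intro nn_integral_cong) (auto simp: indicator_def)
      then show "indicator A x * emeasure \<mu> {y. y - x \<in> B} = (\<integral>\<^sup>+y. indicator A x * indicator B (y - x) \<partial>\<mu>)"
        by (simp add: nn_integral_cmult)
    qed
    also have "\<dots> = (\<integral>\<^sup>+y. (\<integral>\<^sup>+x. indicator A x * indicator B (y - x) \<partial>lborel) \<partial>\<mu>)"
      by (rule pmu.Fubini'[symmetric]) measurable
    also have "\<dots> = (\<integral>\<^sup>+y. (\<integral>\<^sup>+z. indicator A (y - z) * indicator B z \<partial>lborel) \<partial>\<mu>)"
    proof (rule nn_integral_cong)
      fix y :: 'a
      have "measure_preserving (\<lambda>z. y + - z)"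
        by (rule measure_preserving_comp[OF measure_preserving_translation measure_preserving_uminus])
      then have d: "distr lborel lborel (\<lambda>z. y - z) = lborel" by (simp add: measure_preserving_def)
      show "(\<integral>\<^sup>+x. indicator A x * indicator B (y - x) \<partial>lborel) =
            (\<integral>\<^sup>+z. indicator A (y - z) * indicator B z \<partial>lborel)"
        by (subst d[symmetric], subst nn_integral_distr) auto
    qed
    also have "\<dots> = (\<integral>\<^sup>+z. (\<integral>\<^sup>+y. indicator A (y - z) * indicator B z \<partial>\<mu>) \<partial>lborel)"
      by (rule pmu.Fubini') measurable
    also have "\<dots> = (\<integral>\<^sup>+z. indicator B z * emeasure \<mu> A \<partial>lborel)"
    proof (rule nn_integral_cong)
      fix z
      have "(\<integral>\<^sup>+y. indicator A (y - z) * indicator B z \<partial>\<mu>) =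
        (\<integral>\<^sup>+y. indicator B z * indicator {y. y - z \<in> A} y \<partial>\<mu>)"
        by (intro nn_integral_cong) (auto simp: indicator_def)
      then show "(\<integral>\<^sup>+y. indicator A (y - z) * indicator B z \<partial>\<mu>) = indicator B z * emeasure \<mu> A"
        by (simp add: nn_integral_cmult muinv)
    qed
    also have "\<dots> = emeasure lborel B * emeasure \<mu> A"
      by (simp add: nn_integral_multc)
    finally show ?thesis .
  qed
  have "\<mu> = lborel"
  proof (rule measure_eqI)
    show "sets \<mu> = sets lborel" by simp
    fix A assume "A \<in> sets \<mu>"
    then have A: "A \<in> sets borel" by simp
    have "emeasure lborel A * emeasure lborel (ball (0::'a) 1) = emeasure \<mu> A * emeasure lborel (ball (0::'a) 1)"
      using key[OF A, of "ball 0 1"] muball by (simp add: mult.commute)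
    moreover have "emeasure lborel (ball (0::'a) 1) \<noteq> 0"
      using content_ball_gt_0_iff[of "0::'a" 1] by (auto simp: measure_def)
    ultimately show "emeasure \<mu> A = emeasure lborel A"
      using emeasure_lborel_ball_finite[of "0::'a" 1]
      by (metis ennreal_mult_cancel_left infinity_ennreal_def less_irrefl mult.commute)
  qed
  then show ?thesis using Tc by (simp add: measure_preserving_def \<mu>_def)
qed

section \<open>The Gagliardo seminorm\<close>

text \<open>Where \<open>f\<close> does not vanish, a single term of the series of
  \<open>c k * indicator (A k)\<close> already dominates, so the sets may overlap. Hence dyadic
  balls can stand in for annuli, and volumes of balls are all that the kernel estimates
  require.\<close>

lemma integrable_of_cover:
  fixes f :: "'b \<Rightarrow> real" and A :: "nat \<Rightarrow> 'b set"
  assumes f: "f \<in> borel_measurable M" and A: "\<And>k. A k \<in> sets M" "\<And>k. emeasure M (A k) < \<infinity>"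
    and c: "\<And>k. 0 \<le> c k" and s: "summable (\<lambda>k. c k * measure M (A k))"
    and bd: "\<And>x. f x \<noteq> 0 \<Longrightarrow> \<exists>k. x \<in> A k \<and> \<bar>f x\<bar> \<le> c k"
  shows "integrable M f"
proof (rule integrableI_bounded[OF f])
  have "(\<integral>\<^sup>+x. ennreal (norm (f x)) \<partial>M) \<le> (\<integral>\<^sup>+x. (\<Sum>k. ennreal (c k) * indicator (A k) x) \<partial>M)"
  proof (rule nn_integral_mono)
    fix x
    show "ennreal (norm (f x)) \<le> (\<Sum>k. ennreal (c k) * indicator (A k) x)"
    proof (cases "f x = 0")
      case False
      then obtain k where k: "x \<in> A k" "\<bar>f x\<bar> \<le> c k" using bd by blast
      have "ennreal (norm (f x)) \<le> ennreal (c k) * indicator (A k) x"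
        using k by (simp add: ennreal_leI)
      also have "\<dots> = (\<Sum>i\<in>{k}. ennreal (c i) * indicator (A i) x)" by (simp only: sum.insert[OF finite.emptyI] sum.empty empty_iff not_False_eq_True add_0_right)
      also have "\<dots> \<le> (\<Sum>i. ennreal (c i) * indicator (A i) x)"
        by (rule sum_le_suminf) auto
      finally show ?thesis .
    qed simp
  qed
  also have "\<dots> = (\<Sum>k. ennreal (c k) * emeasure M (A k))"
    using A by (subst nn_integral_suminf) (auto simp: nn_integral_cmult_indicator)
  also have "\<dots> = (\<Sum>k. ennreal (c k * measure M (A k)))"
    using A(2) c by (simp add: ennreal_mult emeasure_eq_ennreal_measure less_top[symmetric])
  also have "\<dots> = ennreal (\<Sum>k. c k * measure M (A k))"
    by (rule suminf_ennreal2) (use c s in auto)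
  finally show "(\<integral>\<^sup>+x. ennreal (norm (f x)) \<partial>M) < \<infinity>"
    by (rule le_less_trans) simp
qed

lemma measure_ball_scale:
  "r \<ge> 0 \<Longrightarrow> measure lborel (ball (x::'a::euclidean_space) r) = r ^ DIM('a) * measure lborel (ball (0::'a) 1)"
  using content_ball_conv_unit_ball[of r x] by (simp add: measure_def)

lemma not_AE_notin_ball: "r > 0 \<Longrightarrow> \<not> (AE z in lborel. z \<notin> ball (x::'a::euclidean_space) r)"
  using measure_eq_0_null_sets[of "ball x r" lborel] AE_iff_null_sets[of "ball x r" lborel] content_ball_gt_0_iff[of x r]
  by auto

lemma half_power: "(1 / 2 :: real) ^ n = 2 powr (- real n)"
  by (simp add: powr_minus_divide powr_realpow power_one_over)

lemma two_powr_power: "(2 powr a :: real) ^ k = 2 powr (a * real k)"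
  by (subst powr_realpow[symmetric]) (simp, simp only: powr_powr)

text \<open>Dyadic shells, with \<open>N\<close> the dimension: near the origin the kernel is
  \<open>norm z powr (2 - N - 2 * s)\<close> and the series is geometric of ratio
  \<open>2 powr (2 * s - 2)\<close>, which uses \<open>s < 1\<close>; far away it is
  \<open>norm z powr (- N - 2 * s)\<close> and the ratio is \<open>2 powr (- 2 * s)\<close>, which
  uses \<open>0 < s\<close>.\<close>

lemma integrable_truncated_kernel:
  assumes s: "0 < s" "s < 1"
  shows "integrable lborel (\<lambda>z::'a::euclidean_space. min 1 ((norm z)\<^sup>2) / norm z powr (real DIM('a) + 2 * s))"
    (is "integrable lborel ?f")
proof -
  define N where "N = real DIM('a)"
  have N: "N > 0" by (simp add: N_def)
  define \<omega> where "\<omega> = measure lborel (ball (0::'a) 1)"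
  have [measurable]: "?f \<in> borel_measurable lborel" by measurable
  have inner: "integrable lborel (\<lambda>z. ?f z * indicator (ball 0 1) z)"
  proof (rule integrable_of_cover[where A="\<lambda>k. ball 0 ((1/2)^k)"
        and c="\<lambda>k. 2 powr (N + 2 * s) * (2 powr (N + 2 * s - 2)) ^ k"])
    show "(\<lambda>z. ?f z * indicator (ball 0 1) z) \<in> borel_measurable lborel"
      by (intro borel_measurable_times borel_measurable_indicator \<open>?f \<in> borel_measurable lborel\<close>) auto
    have eq: "2 powr (N + 2 * s) * (2 powr (N + 2 * s - 2)) ^ k * measure lborel (ball (0::'a) ((1/2)^k)) =
        (2 powr (N + 2 * s) * \<omega>) * (2 powr (2 * s - 2)) ^ k" for k
    proof -
      have "((1/2)^k)^DIM('a) = (2 powr (-N)) ^ k"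
        by (simp only: half_power two_powr_power N_def) (simp add: mult.commute)
      then have m: "measure lborel (ball (0::'a) ((1/2)^k)) = (2 powr (-N)) ^ k * \<omega>"
        by (subst measure_ball_scale) (auto simp: \<omega>_def)
      have "(2 powr (N + 2 * s - 2)) ^ k * (2 powr (-N)) ^ k = (2 powr (2 * s - 2)) ^ k"
        by (simp only: two_powr_power powr_add[symmetric]) (simp add: algebra_simps)
      note t = this[symmetric]
      show ?thesis unfolding m t by (simp only: mult.assoc mult.left_commute mult.commute)
    qed
    have "2 powr (2 * s - 2) < 1" using s by (simp add: powr_less_one)
    then show "summable (\<lambda>k. 2 powr (N + 2 * s) * (2 powr (N + 2 * s - 2)) ^ k * measure lborel (ball (0::'a) ((1/2)^k)))"
      unfolding eq by (intro summable_mult summable_geometric) simp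
    fix z :: 'a assume "?f z * indicator (ball 0 1) z \<noteq> 0"
    then have z: "0 < norm z" "norm z < 1" by (auto simp: indicator_def split: if_splits)
    obtain n0 where "(1/2::real) ^ n0 < norm z" using real_arch_pow_inv[of "norm z" "1/2"] z by auto
    then have ex: "\<exists>n. (1/2::real) ^ n \<le> norm z" by (metis less_imp_le)
    \<comment> \<open>The least such \<open>n\<close> is positive because \<open>norm z < 1\<close>;
      with \<open>n = Suc k\<close> the point lies in the shell between \<open>(1/2) ^ Suc k\<close>
      and \<open>(1/2) ^ k\<close>.\<close>
    define n where "n = (LEAST n. (1/2::real) ^ n \<le> norm z)"
    have n: "(1/2) ^ n \<le> norm z" unfolding n_def by (rule LeastI_ex[OF ex])
    have "n \<noteq> 0" using n z by (intro notI) auto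
    then obtain k where k: "n = Suc k" by (cases n) auto
    have zk: "norm z < (1/2) ^ k" using not_less_Least[of k "\<lambda>n. (1/2::real) ^ n \<le> norm z"] k by (auto simp: n_def)
    have "(2 powr (- (real k + 1))) powr (N + 2 * s) \<le> norm z powr (N + 2 * s)"
    proof (rule powr_mono2)
      have "2 powr (- (real k + 1)) = (1/2) ^ n"
        by (simp only: half_power k) (simp add: algebra_simps)
      then show "2 powr (- (real k + 1)) \<le> norm z" using n by simp
    qed (use N s in auto)
    moreover have "(2 powr (- (real k + 1))) powr (N + 2 * s) > 0" by simp
    moreover have "(norm z)\<^sup>2 \<le> (2 powr (- real k))\<^sup>2"
    proof (rule power_mono)
      have "2 powr (- real k) = (1/2) ^ k"
        by (simp only: half_power)
      then show "norm z \<le> 2 powr (- real k)" using zk by simp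
    qed simp
    ultimately have "(norm z)\<^sup>2 / norm z powr (N + 2 * s) \<le> (2 powr (- real k))\<^sup>2 / (2 powr (- (real k + 1))) powr (N + 2 * s)"
      by (intro frac_le) auto
    also have "\<dots> = 2 powr (- 2 * real k + (real k + 1) * (N + 2 * s))"
    proof -
      have sq: "(2 powr (- real k))\<^sup>2 = 2 powr (- 2 * real k)"
        by (simp add: power2_eq_square powr_add[symmetric])
      show ?thesis unfolding sq powr_powr powr_diff[symmetric] by (simp add: algebra_simps)
    qed
    also have "\<dots> = 2 powr (N + 2 * s) * (2 powr (N + 2 * s - 2)) ^ k"
      by (simp only: two_powr_power powr_add[symmetric]) (simp add: algebra_simps)
    finally have "(norm z)\<^sup>2 / norm z powr (N + 2 * s) \<le> 2 powr (N + 2 * s) * (2 powr (N + 2 * s - 2)) ^ k" .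
    moreover have "min 1 ((norm z)\<^sup>2) = (norm z)\<^sup>2" using z by (simp add: power_le_one min_absorb2)
    ultimately show "\<exists>k. z \<in> ball 0 ((1/2)^k) \<and> \<bar>?f z * indicator (ball 0 1) z\<bar> \<le> 2 powr (N + 2 * s) * (2 powr (N + 2 * s - 2)) ^ k"
      using zk z by (intro exI[of _ k]) (auto simp: N_def)
  qed (use emeasure_lborel_ball_finite in auto)
  have outer: "integrable lborel (\<lambda>z. ?f z * indicator (- ball 0 1) z)"
  proof (rule integrable_of_cover[where A="\<lambda>k. ball 0 (2^Suc k)" and c="\<lambda>k. (2 powr - (N + 2 * s)) ^ k"])
    show "(\<lambda>z. ?f z * indicator (- ball 0 1) z) \<in> borel_measurable lborel"
      by (intro borel_measurable_times borel_measurable_indicator \<open>?f \<in> borel_measurable lborel\<close>) auto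
    have eq: "(2 powr - (N + 2 * s)) ^ k * measure lborel (ball (0::'a) (2^Suc k)) =
        (2 powr N * \<omega>) * (2 powr (- (2 * s))) ^ k" for k
    proof -
      have "(2^Suc k)^DIM('a) = (2^DIM('a) :: real) ^ Suc k"
        by (simp only: power_mult[symmetric] mult.commute)
      also have "(2::real)^DIM('a) = 2 powr N"
        by (simp add: N_def powr_realpow)
      finally have "(2^Suc k)^DIM('a) = 2 powr N * (2 powr N) ^ k"
        by simp
      then have m: "measure lborel (ball (0::'a) (2^Suc k)) = 2 powr N * (2 powr N) ^ k * \<omega>"
        by (subst measure_ball_scale) (auto simp: \<omega>_def)
      have "(2 powr - (N + 2 * s)) ^ k * (2 powr N) ^ k = (2 powr - (2 * s)) ^ k"
        by (simp only: two_powr_power powr_add[symmetric]) (simp add: algebra_simps)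
      note t = this[symmetric]
      show ?thesis unfolding m t by (simp only: mult.assoc mult.left_commute mult.commute)
    qed
    have "2 powr (- (2 * s)) < 1" using s by (simp add: powr_less_one)
    then show "summable (\<lambda>k. (2 powr - (N + 2 * s)) ^ k * measure lborel (ball (0::'a) (2^Suc k)))"
      unfolding eq by (intro summable_mult summable_geometric) simp
    fix z :: 'a assume "?f z * indicator (- ball 0 1) z \<noteq> 0"
    then have z: "1 \<le> norm z" by (auto simp: indicator_def split: if_splits)
    obtain n0 where "norm z < (2::real) ^ n0" using real_arch_pow[of 2 "norm z"] by auto
    then have ex: "\<exists>n. norm z < (2::real) ^ n" by blast
    define n where "n = (LEAST n. norm z < (2::real) ^ n)"
    have n: "norm z < 2 ^ n" unfolding n_def by (rule LeastI_ex[OF ex])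
    have "n \<noteq> 0" using n z by (intro notI) auto
    then obtain k where k: "n = Suc k" by (cases n) auto
    have zk: "2 ^ k \<le> norm z" using not_less_Least[of k "\<lambda>n. norm z < (2::real) ^ n"] k by (auto simp: n_def)
    have "(2 ^ k) powr (N + 2 * s) \<le> norm z powr (N + 2 * s)"
      by (rule powr_mono2) (use zk N s in auto)
    then have "min 1 ((norm z)\<^sup>2) / norm z powr (N + 2 * s) \<le> 1 / (2 ^ k) powr (N + 2 * s)"
      using z by (intro frac_le) auto
    also have "\<dots> = (2 powr - (N + 2 * s)) ^ k"
    proof -
      have "(2 powr - (N + 2 * s)) ^ k = 2 powr ((- (N + 2 * s)) * real k)"
        by (subst powr_realpow[symmetric]) (simp, simp only: powr_powr)
      moreover have "(2 ^ k) powr (N + 2 * s) = 2 powr (real k * (N + 2 * s))"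
        by (subst powr_realpow[symmetric]) (simp, simp only: powr_powr)
      moreover have "1 / (2::real) powr (real k * (N + 2 * s)) = 2 powr ((- (N + 2 * s)) * real k)"
        by (simp only: powr_minus_divide[symmetric] mult_minus_left mult_minus_right mult.commute)
      ultimately show ?thesis by simp
    qed
    finally show "\<exists>k. z \<in> ball 0 (2^Suc k) \<and> \<bar>?f z * indicator (- ball 0 1) z\<bar> \<le> (2 powr - (N + 2 * s)) ^ k"
      using n z by (intro exI[of _ k]) (auto simp: N_def k)
  qed (use emeasure_lborel_ball_finite in auto)
  have "?f z * indicator (ball 0 1) z + ?f z * indicator (- ball 0 1) z = ?f z" for z
    by (auto simp: indicator_def)
  with Bochner_Integration.integrable_add[OF inner outer] show ?thesis by simp
qed

text \<open>The integral converges because \<open>1 - cos t\<close> is at most both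
  \<open>t\<^sup>2 / 2\<close> and 2. It is not 0, since \<open>cos (z \<bullet> b) = 1\<close> with
  \<open>\<bar>z \<bullet> b\<bar> < 1\<close> forces \<open>z \<bullet> b = 0\<close>, a null set.
  Both facts matter: a divergent or a zero integral would make the constant 0, by the conventions
  for undefined integrals and for division.\<close>

lemma frac_const_pos:
  assumes s: "0 < s" "s < 1"
  shows "frac_const TYPE('a::euclidean_space) s > 0"
proof -
  define b where "b = (SOME b. b \<in> (Basis :: 'a set))"
  have b: "b \<in> Basis" unfolding b_def by (rule SOME_Basis)
  let ?f = "\<lambda>z::'a. (1 - cos (z \<bullet> b)) / norm z powr (real DIM('a) + 2 * s)"
  have bound: "\<bar>?f z\<bar> \<le> 2 * (min 1 ((norm z)\<^sup>2) / norm z powr (real DIM('a) + 2 * s))" for z :: 'a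
  proof -
    have "1 - cos (z \<bullet> b) \<le> (z \<bullet> b)\<^sup>2 / 2"
    proof -
      have "1 - cos (z \<bullet> b) = 2 * (sin (z \<bullet> b / 2))\<^sup>2"
        using cos_double_sin[of "z \<bullet> b / 2"] by simp
      moreover have "(sin (z \<bullet> b / 2))\<^sup>2 \<le> (z \<bullet> b / 2)\<^sup>2"
        using abs_sin_x_le_abs_x[of "z \<bullet> b / 2"] by (simp only: abs_le_square_iff)
      ultimately show ?thesis by (simp add: power2_eq_square)
    qed
    also have "\<dots> \<le> 2 * (norm z)\<^sup>2"
    proof -
      have "(z \<bullet> b)\<^sup>2 \<le> (norm z)\<^sup>2"
        using power_mono[OF Basis_le_norm[OF b, of z] abs_ge_zero, of 2] by simp
      then show ?thesis using zero_le_power2[of "norm z"] by linarith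
    qed
    finally have "1 - cos (z \<bullet> b) \<le> 2 * min 1 ((norm z)\<^sup>2)"
      using cos_ge_minus_one[of "z \<bullet> b"] by (auto simp: min_def)
    then show ?thesis
      using cos_le_one[of "z \<bullet> b"] by (auto simp: abs_mult intro: divide_right_mono)
  qed
  have int: "integrable lborel ?f"
    by (rule integrable_dominated[OF Bochner_Integration.integrable_mult_right[OF integrable_truncated_kernel[OF s], of 2] _ bound])
       measurable
  have "(LINT z|lborel. ?f z) \<noteq> 0"
  proof
    assume "(LINT z|lborel. ?f z) = 0"
    then have "AE z in lborel. ?f z = 0"
      by (subst (asm) integral_nonneg_eq_0_iff_AE[OF int]) auto
    moreover have "AE z in lborel. z \<notin> {z::'a. b \<bullet> z = 0}"
    proof (rule AE_not_in)
      have "negligible {z::'a. b \<bullet> z = 0}" using b by (intro negligible_hyperplane) auto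
      then show "{z::'a. b \<bullet> z = 0} \<in> null_sets lborel"
        by (subst null_sets_completion_iff[symmetric]) (auto simp: negligible_iff_null_sets)
    qed
    ultimately have "AE z in lborel. z \<notin> ball (0::'a) 1"
    proof eventually_elim
      case (elim z)
      show ?case
      proof
        assume z: "z \<in> ball 0 1"
        from elim have nz: "z \<bullet> b \<noteq> 0" by (auto simp: inner_commute)
        then have "z \<noteq> 0" by auto
        with elim have c: "cos (z \<bullet> b) = 1" by auto
        have "\<bar>z \<bullet> b\<bar> < 1" using Basis_le_norm[OF b, of z] z by auto
        then have "cos \<bar>z \<bullet> b\<bar> < cos 0"
          using nz pi_gt3 by (intro cos_monotone_0_pi) auto
        with c show False by simp
      qed
    qed
    then show False using not_AE_notin_ball[of 1 "0::'a"] by simp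
  qed
  moreover have "(LINT z|lborel. ?f z) \<ge> 0" by (intro Bochner_Integration.integral_nonneg) auto
  ultimately have "(LINT z|lborel. ?f z) > 0" by linarith
  then show ?thesis unfolding frac_const_def b_def by simp
qed

text \<open>The kernel is split into two square roots so that \<open>sform\<close> becomes an L2
  inner product on the product space, and membership in \<open>Hs\<close> becomes square
  integrability of \<open>u\<close> and of this quotient. On the diagonal the value is
  \<open>0 / 0 = 0\<close>.\<close>

definition dquot :: "real \<Rightarrow> ('a::euclidean_space \<Rightarrow> real) \<Rightarrow> 'a \<times> 'a \<Rightarrow> real" where
  "dquot s u z = (u (fst z) - u (snd z)) / sqrt (norm (fst z - snd z) powr (real DIM('a) + 2 * s))"

definition gagliardo :: "real \<Rightarrow> ('a::euclidean_space \<Rightarrow> real) \<Rightarrow> real" where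
  "gagliardo s u = (LINT z|(lborel \<Otimes>\<^sub>M lborel). (dquot s u z)\<^sup>2)"

lemma dquot_mult:
  fixes u :: "'a::euclidean_space \<Rightarrow> real"
  shows "dquot s u z * dquot s v z = (u (fst z) - u (snd z)) * (v (fst z) - v (snd z))
          / norm (fst z - snd z) powr (real DIM('a) + 2 * s)"
  by (simp add: dquot_def)

lemma dquot_power2:
  fixes u :: "'a::euclidean_space \<Rightarrow> real"
  shows "(dquot s u z)\<^sup>2 = (u (fst z) - u (snd z))\<^sup>2 / norm (fst z - snd z) powr (real DIM('a) + 2 * s)"
  using dquot_mult[of s u z u] by (simp add: power2_eq_square)

lemma dquot_measurable [measurable]:
  fixes u :: "'a::euclidean_space \<Rightarrow> real"
  assumes [measurable]: "u \<in> borel_measurable borel"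
  shows "dquot s u \<in> borel_measurable (lborel \<Otimes>\<^sub>M lborel)"
  unfolding dquot_def by measurable

lemma Hs_measurable [measurable_dest]: "Hs s u \<Longrightarrow> u \<in> borel_measurable borel"
  by (simp add: Hs_def)

lemma Hs_iff:
  "Hs s u \<longleftrightarrow> sq_integrable lborel u \<and> sq_integrable (lborel \<Otimes>\<^sub>M lborel) (dquot s u)"
  by (auto simp: Hs_def sq_integrable_def dquot_power2)

lemma sform_eq:
  fixes u :: "'a::euclidean_space \<Rightarrow> real"
  shows "sform s u v = frac_const TYPE('a) s / 2 * (LINT z|(lborel \<Otimes>\<^sub>M lborel). dquot s u z * dquot s v z)"
  unfolding sform_def dquot_mult ..

lemma sform_self:
  fixes u :: "'a::euclidean_space \<Rightarrow> real"
  shows "sform s u u = frac_const TYPE('a) s / 2 * gagliardo s u"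
  by (simp add: sform_eq gagliardo_def power2_eq_square)

lemma dquot_add: "dquot s (\<lambda>x. u x + v x) = (\<lambda>z. dquot s u z + dquot s v z)"
  by (auto simp: dquot_def fun_eq_iff add_divide_distrib[symmetric])

lemma dquot_diff: "dquot s (\<lambda>x. u x - v x) = (\<lambda>z. dquot s u z - dquot s v z)"
  by (auto simp: dquot_def fun_eq_iff diff_divide_distrib[symmetric])

lemma dquot_cmult: "dquot s (\<lambda>x. c * u x) = (\<lambda>z. c * dquot s u z)"
  by (auto simp: dquot_def fun_eq_iff algebra_simps diff_divide_distrib)

lemma Hs_add: "Hs s u \<Longrightarrow> Hs s v \<Longrightarrow> Hs s (\<lambda>x. u x + v x)"
  by (simp add: Hs_iff dquot_add sq_integrable_add)

lemma Hs_diff: "Hs s u \<Longrightarrow> Hs s v \<Longrightarrow> Hs s (\<lambda>x. u x - v x)"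
  by (simp add: Hs_iff dquot_diff sq_integrable_diff)

lemma Hs_cmult: "Hs s u \<Longrightarrow> Hs s (\<lambda>x. c * u x)"
  by (simp add: Hs_iff dquot_cmult sq_integrable_cmult)

lemma Hs_zero: "Hs s (\<lambda>x. 0)"
  by (simp add: Hs_def)

lemma gagliardo_nonneg: "0 \<le> gagliardo s u"
  unfolding gagliardo_def by (intro Bochner_Integration.integral_nonneg) simp

lemma gagliardo_cmult: "gagliardo s (\<lambda>x. c * u x) = c\<^sup>2 * gagliardo s u"
  by (simp add: gagliardo_def dquot_cmult power_mult_distrib)

lemma abs_dquot_mono:
  assumes "\<And>x y. \<bar>v x - v y\<bar> \<le> \<bar>u x - u y\<bar>"
  shows "\<bar>dquot s v z\<bar> \<le> \<bar>dquot s u z\<bar>"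
  using assms[of "fst z" "snd z"] by (auto simp: dquot_def abs_divide intro: divide_right_mono)

text \<open>Normal contractions: absolute values and truncations satisfy both pointwise
  hypotheses.\<close>

lemma
  fixes u v :: "'a::euclidean_space \<Rightarrow> real"
  assumes u: "Hs s u" and v [measurable]: "v \<in> borel_measurable borel"
    and le: "\<And>x. \<bar>v x\<bar> \<le> \<bar>u x\<bar>" and lip: "\<And>x y. \<bar>v x - v y\<bar> \<le> \<bar>u x - u y\<bar>"
  shows Hs_contraction: "Hs s v"
    and gagliardo_contraction: "gagliardo s v \<le> gagliardo s u"
    and L2_contraction: "(LINT x|lborel. (v x)\<^sup>2) \<le> (LINT x|lborel. (u x)\<^sup>2)"
proof -
  note d = abs_dquot_mono[OF lip]
  show H: "Hs s v"
    unfolding Hs_iff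
  proof
    show "sq_integrable lborel v"
      by (rule sq_integrable_bound[of _ u]) (use u le in \<open>auto simp: Hs_iff\<close>)
    show "sq_integrable (lborel \<Otimes>\<^sub>M lborel) (dquot s v)"
      by (rule sq_integrable_bound[of _ "dquot s u"]) (use u d in \<open>auto simp: Hs_iff\<close>)
  qed
  show "gagliardo s v \<le> gagliardo s u"
    unfolding gagliardo_def using H u d
    by (intro integral_mono) (auto simp: Hs_iff sq_integrable_def abs_le_square_iff)
  show "(LINT x|lborel. (v x)\<^sup>2) \<le> (LINT x|lborel. (u x)\<^sup>2)"
    using H u le by (intro integral_mono) (auto simp: Hs_iff sq_integrable_def abs_le_square_iff)
qed

lemma Hs_abs: "Hs s u \<Longrightarrow> Hs s (\<lambda>x. \<bar>u x\<bar>)"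
  by (rule Hs_contraction) auto

lemma dquot_comp:
  fixes T :: "'a::euclidean_space \<Rightarrow> 'a"
  assumes "\<And>x y. norm (T x - T y) = norm (x - y)"
  shows "dquot s (\<lambda>x. u (T x)) z = dquot s u (T (fst z), T (snd z))"
  by (simp add: dquot_def assms)

lemma
  fixes u :: "'a::euclidean_space \<Rightarrow> real"
  assumes T: "measure_preserving T" and iso: "\<And>x y. norm (T x - T y) = norm (x - y)" and u: "Hs s u"
  shows Hs_comp: "Hs s (\<lambda>x. u (T x))" and gagliardo_comp: "gagliardo s (\<lambda>x. u (T x)) = gagliardo s u"
    and L2_comp: "(LINT x|lborel. (u (T x))\<^sup>2) = (LINT x|lborel. (u x)\<^sup>2)"
proof -
  have [measurable]: "u \<in> borel_measurable borel" "T \<in> borel_measurable borel" using u T by auto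
  have m: "(\<lambda>z. (dquot s u z)\<^sup>2) \<in> borel_measurable (lborel \<Otimes>\<^sub>M lborel)" by measurable
  show "gagliardo s (\<lambda>x. u (T x)) = gagliardo s u"
    unfolding gagliardo_def dquot_comp[where T=T, OF iso]
    by (rule measure_preserving_integral2[OF T T m])
  show "(LINT x|lborel. (u (T x))\<^sup>2) = (LINT x|lborel. (u x)\<^sup>2)"
    by (rule measure_preserving_integral[OF T]) measurable
  have "integrable lborel (\<lambda>x. (u (T x))\<^sup>2)"
    using u by (subst measure_preserving_integrable[OF T, of "\<lambda>x. (u x)\<^sup>2"]) (auto simp: Hs_def)
  moreover have "integrable (lborel \<Otimes>\<^sub>M lborel) (\<lambda>z. (dquot s (\<lambda>x. u (T x)) z)\<^sup>2)"
    unfolding dquot_comp[where T=T, OF iso]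
    using u by (subst measure_preserving_integrable2[OF T T m]) (auto simp: Hs_iff sq_integrable_def)
  ultimately show "Hs s (\<lambda>x. u (T x))"
    by (simp add: Hs_iff sq_integrable_def)
qed

lemma Hs_cong_AE:
  fixes u v :: "'a::euclidean_space \<Rightarrow> real"
  assumes u: "Hs s u" and v [measurable]: "v \<in> borel_measurable borel" and eq: "AE x in lborel. v x = u x"
  shows "Hs s v" and "AE z in lborel \<Otimes>\<^sub>M lborel. dquot s v z = dquot s u z" and "gagliardo s v = gagliardo s u"
proof -
  have [measurable]: "u \<in> borel_measurable borel" using u by auto
  have "AE x in lborel. AE y in lborel. v x = u x \<and> v y = u y"
    using eq
  proof eventually_elim
    case (elim x)
    then show ?case by (intro eventually_mono[OF eq]) simp
  qed
  then have "AE z in lborel \<Otimes>\<^sub>M lborel. v (fst z) = u (fst z) \<and> v (snd z) = u (snd z)"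
  proof (rule lborel_pair.AE_pair_iff[THEN iffD1, rotated])
    show "{z \<in> space (lborel \<Otimes>\<^sub>M lborel). v (fst z) = u (fst z) \<and> v (snd z) = u (snd z)} \<in> sets (lborel \<Otimes>\<^sub>M lborel)"
      by measurable
  qed
  then show d: "AE z in lborel \<Otimes>\<^sub>M lborel. dquot s v z = dquot s u z"
    by eventually_elim (simp add: dquot_def)
  show "gagliardo s v = gagliardo s u"
    unfolding gagliardo_def by (rule integral_cong_AE) (use d in \<open>auto elim: eventually_mono\<close>)
  have "integrable lborel (\<lambda>x. (v x)\<^sup>2) \<longleftrightarrow> integrable lborel (\<lambda>x. (u x)\<^sup>2)"
    by (rule integrable_cong_AE) (use eq in \<open>auto elim: eventually_mono\<close>)
  moreover have "integrable (lborel \<Otimes>\<^sub>M lborel) (\<lambda>z. (dquot s v z)\<^sup>2)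
      \<longleftrightarrow> integrable (lborel \<Otimes>\<^sub>M lborel) (\<lambda>z. (dquot s u z)\<^sup>2)"
    by (rule integrable_cong_AE) (use d in \<open>auto elim: eventually_mono\<close>)
  ultimately show "Hs s v"
    using u by (simp add: Hs_iff sq_integrable_def)
qed

text \<open>Without a nonzero element of \<open>Hs\<close> there would be no ground state at all.\<close>
lemma Hs_bump:
  assumes s: "0 < s" "s < 1"
  defines "\<phi> \<equiv> \<lambda>x::'a::euclidean_space. max 0 (1 - norm x)"
  shows "Hs s \<phi>" and "\<not> (AE x in lborel. \<phi> x = 0)"
proof -
  have [measurable]: "\<phi> \<in> borel_measurable borel" unfolding \<phi>_def by measurable
  have lip: "\<bar>\<phi> x - \<phi> y\<bar> \<le> norm (x - y)" for x y
    using norm_triangle_ineq3[of x y] unfolding \<phi>_def by linarith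
  have b: "0 \<le> \<phi> x" "\<phi> x \<le> 1" and out: "x \<notin> ball 0 1 \<Longrightarrow> \<phi> x = 0" for x
    unfolding \<phi>_def by auto
  have fin: "emeasure lborel (ball (0::'a) 1) < \<infinity>" by (rule emeasure_lborel_ball_finite)
  have "integrable lborel (\<lambda>x. (\<phi> x)\<^sup>2)"
  proof (rule integrable_dominated[of _ "indicator (ball 0 1)"])
    show "\<bar>(\<phi> x)\<^sup>2\<bar> \<le> indicator (ball 0 1) x" for x
      using b[of x] out[of x] by (auto simp: indicator_def power_le_one)
  qed (use fin in auto)
  moreover have "sq_integrable (lborel \<Otimes>\<^sub>M lborel) (dquot s \<phi>)"
  proof -
    define k where "k z = min 1 ((norm z)\<^sup>2) / norm z powr (real DIM('a) + 2 * s)" for z :: 'a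
    have k: "integrable lborel k" unfolding k_def by (rule integrable_truncated_kernel[OF s])
    have [measurable]: "k \<in> borel_measurable borel" using k by auto
    have k0: "k z \<ge> 0" and ksym: "k (- z) = k z" for z by (auto simp: k_def)
    have [measurable]: "ball (0::'a) 1 \<in> sets borel" by simp
    \<comment> \<open>Pairs with at least one point in the unit ball are covered by \<open>h\<close>
      and its swap; for all other pairs the difference quotient vanishes.\<close>
    define h where "h = (\<lambda>(x, y). indicator (ball 0 1) x * k (x - y))"
    have mp: "measure_preserving (\<lambda>y. x + - y)" for x :: 'a
      by (rule measure_preserving_comp[OF measure_preserving_translation measure_preserving_uminus])
    have ki: "integrable lborel (\<lambda>y. k (x - y))" "(LINT y|lborel. k (x - y)) = (LINT y|lborel. k y)" for x
      using measure_preserving_integrable[OF mp, of k x] measure_preserving_integral[OF mp, of k x] k by auto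
    have hi: "integrable (lborel \<Otimes>\<^sub>M lborel) h"
    proof (rule lborel_pair.Fubini_integrable)
      show "h \<in> borel_measurable (lborel \<Otimes>\<^sub>M lborel)" 
        unfolding h_def case_prod_beta by measurable
      have "(LINT y|lborel. norm (h (x, y))) = indicator (ball 0 1) x * (LINT y|lborel. k y)" for x
        using k0 by (simp add: h_def abs_mult ki)
      then show "integrable lborel (\<lambda>x. LINT y|lborel. norm (h (x, y)))"
        using fin by simp
      show "AE x in lborel. integrable lborel (\<lambda>y. h (x, y))"
        using ki by (auto simp: h_def)
    qed
    have "integrable (lborel \<Otimes>\<^sub>M lborel) (\<lambda>z. h z + h (snd z, fst z))"
      using Bochner_Integration.integrable_add[OF hi lborel_pair.integrable_product_swap[OF hi]]
      by (simp only: case_prod_beta)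
    then have "integrable (lborel \<Otimes>\<^sub>M lborel) (\<lambda>z. (dquot s \<phi> z)\<^sup>2)"
    proof (rule integrable_dominated)
      fix z :: "'a \<times> 'a"
      obtain x y where z: "z = (x, y)" by (cases z)
      \<comment> \<open>The Lipschitz bound and the bound by 1 together produce the truncation
        \<open>min 1\<close> in the kernel \<open>k\<close>.\<close>
      have "(\<phi> x - \<phi> y)\<^sup>2 \<le> (norm (x - y))\<^sup>2"
        using lip[of x y] abs_le_square_iff[of "\<phi> x - \<phi> y" "norm (x - y)"] by simp
      moreover have "(\<phi> x - \<phi> y)\<^sup>2 \<le> 1"
        using b[of x] b[of y] abs_square_le_1[of "\<phi> x - \<phi> y"] by auto
      ultimately have 1: "(dquot s \<phi> z)\<^sup>2 \<le> k (x - y)"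
        by (auto simp: dquot_power2 k_def z intro!: divide_right_mono)
      have ks: "k (y - x) = k (x - y)" using ksym[of "x - y"] by simp
      show "\<bar>(dquot s \<phi> z)\<^sup>2\<bar> \<le> h z + h (snd z, fst z)"
      proof (cases "x \<in> ball 0 1 \<or> y \<in> ball 0 1")
        case True
        then show ?thesis using 1 k0[of "x - y"] by (auto simp: h_def z ks indicator_def)
      next
        case False
        then have "dquot s \<phi> z = 0" using out by (simp add: dquot_def z)
        then show ?thesis using k0 by (simp add: h_def z)
      qed
    qed measurable
    then show ?thesis by (simp add: sq_integrable_def)
  qed
  ultimately show "Hs s \<phi>" by (simp add: Hs_iff sq_integrable_def)
  show "\<not> (AE x in lborel. \<phi> x = 0)"
  proof
    assume "AE x in lborel. \<phi> x = 0"
    then have "AE x in lborel. x \<notin> ball (0::'a) 1"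
      by eventually_elim (auto simp: \<phi>_def)
    then show False using not_AE_notin_ball[of 1 "0::'a"] by simp
  qed
qed

section \<open>Fractional Sobolev embedding\<close>

definition average :: "'a::euclidean_space set \<Rightarrow> ('a \<Rightarrow> real) \<Rightarrow> real" where
  "average S u = (LINT y|lborel. indicator S y * u y) / measure lborel S"

text \<open>The inner integral of the Gagliardo energy, regarded as a density. At points where the
  quotient is not square integrable the value 0 is a convention, so the pointwise estimates assume
  integrability on the fibre.\<close>

definition gag_density :: "real \<Rightarrow> ('a::euclidean_space \<Rightarrow> real) \<Rightarrow> 'a \<Rightarrow> real" where
  "gag_density s u x = (LINT y|lborel. (dquot s u (x, y))\<^sup>2)"

lemma gag_density_nonneg: "0 \<le> gag_density s u x"
  unfolding gag_density_def by (intro Bochner_Integration.integral_nonneg) simp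

lemma
  assumes u: "Hs s u"
  shows AE_integrable_dquot: "AE x in lborel. integrable lborel (\<lambda>y. (dquot s u (x, y))\<^sup>2)"
    and integrable_gag_density: "integrable lborel (gag_density s u)"
    and integral_gag_density: "(LINT x|lborel. gag_density s u x) = gagliardo s u"
proof -
  have i: "integrable (lborel \<Otimes>\<^sub>M lborel) (\<lambda>z. (dquot s u z)\<^sup>2)"
    using u by (simp add: Hs_iff sq_integrable_def)
  show "AE x in lborel. integrable lborel (\<lambda>y. (dquot s u (x, y))\<^sup>2)"
    using lborel_pair.AE_integrable_fst'[OF i] .
  show "integrable lborel (gag_density s u)"
    using lborel_pair.integrable_fst'[OF i] by (simp add: gag_density_def[abs_def])
  show "(LINT x|lborel. gag_density s u x) = gagliardo s u"
    using lborel_pair.integral_fst'[OF i] by (simp add: gag_density_def[abs_def] gagliardo_def)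
qed

text \<open>Shared by balls, which serve the embedding, nonvanishing and the radial representative,
  and by lattice cells, which serve compactness.\<close>

locale finite_set_average =
  fixes S :: "'a::euclidean_space set"
  assumes S [measurable]: "S \<in> sets borel" and fin: "emeasure lborel S < \<infinity>" and pos: "0 < measure lborel S"
begin

lemma integral_indicator_S: "(LINT y|lborel. indicator S y) = measure lborel S"
  and integrable_indicator_S: "integrable lborel (\<lambda>y. indicator S y :: real)"
  using fin by (auto simp: integrable_indicator_iff)

lemma sq_integrable_indicator: "sq_integrable lborel (indicator S)"
proof -
  have "(\<lambda>y. (indicator S y :: real)\<^sup>2) = indicator S" by (auto simp: indicator_def)
  then show ?thesis using integrable_indicator_S by (simp add: sq_integrable_def)
qed

lemma integrable_indicator_mult:
  assumes "integrable lborel f" shows "integrable lborel (\<lambda>y. indicator S y * f y :: real)"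
  using integrable_real_mult_indicator[of S lborel f] assms by (simp add: mult.commute)

lemma average_expand:
  assumes u: "sq_integrable lborel u"
  shows "integrable lborel (\<lambda>y. indicator S y * (c - u y)\<^sup>2)"
    and "(LINT y|lborel. indicator S y * (c - u y)\<^sup>2)
       = measure lborel S * (c\<^sup>2 - 2 * c * average S u + average S (\<lambda>y. (u y)\<^sup>2))"
proof -
  have 1: "integrable lborel (\<lambda>y. indicator S y * u y)"
    by (rule sq_integrable_mult[OF sq_integrable_indicator u])
  have 2: "integrable lborel (\<lambda>y. indicator S y * (u y)\<^sup>2)"
    by (rule integrable_indicator_mult[OF sq_integrable_square[OF u]])
  have eq: "indicator S y * (c - u y)\<^sup>2 =
      c\<^sup>2 * indicator S y - 2 * c * (indicator S y * u y) + indicator S y * (u y)\<^sup>2" for y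
    by (simp add: power2_diff algebra_simps)
  show "integrable lborel (\<lambda>y. indicator S y * (c - u y)\<^sup>2)"
    unfolding eq using 1 2 integrable_indicator_S by simp
  have "(LINT y|lborel. indicator S y * (c - u y)\<^sup>2) = c\<^sup>2 * measure lborel S
      - 2 * c * (LINT y|lborel. indicator S y * u y) + (LINT y|lborel. indicator S y * (u y)\<^sup>2)"
    unfolding eq using 1 2 integrable_indicator_S integral_indicator_S by simp
  then show "(LINT y|lborel. indicator S y * (c - u y)\<^sup>2)
       = measure lborel S * (c\<^sup>2 - 2 * c * average S u + average S (\<lambda>y. (u y)\<^sup>2))"
    using pos by (simp add: average_def algebra_simps)
qed

text \<open>Jensen's inequality, in the form that the variance over \<open>S\<close> is
  nonnegative.\<close>

lemma average_power2_le:
  assumes u: "sq_integrable lborel u"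
  shows "(average S u)\<^sup>2 \<le> average S (\<lambda>y. (u y)\<^sup>2)"
proof -
  have "0 \<le> (LINT y|lborel. indicator S y * (average S u - u y)\<^sup>2)"
    by (intro Bochner_Integration.integral_nonneg) simp
  then have "0 \<le> measure lborel S * (average S (\<lambda>y. (u y)\<^sup>2) - (average S u)\<^sup>2)"
    unfolding average_expand(2)[OF u] by (simp add: power2_eq_square algebra_simps)
  then show ?thesis using pos by (simp add: zero_le_mult_iff)
qed

lemma average_le_integral:
  assumes v: "integrable lborel v" "\<And>x. 0 \<le> v x"
  shows "average S v \<le> (LINT x|lborel. v x) / measure lborel S"
  unfolding average_def using v pos
  by (intro divide_right_mono integral_mono integrable_indicator_mult) (auto simp: indicator_def)

lemma average_power4_le:
  assumes u: "sq_integrable lborel u" and u4: "integrable lborel (\<lambda>x. (u x)^4)"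
  shows "(average S u)^4 \<le> (LINT x|lborel. (u x)^4) / measure lborel S"
proof -
  have "u \<in> borel_measurable lborel" using u by (rule sq_integrable_measurable)
  then have u2: "sq_integrable lborel (\<lambda>x. (u x)\<^sup>2)"
    using u4 by (simp add: sq_integrable_def)
  have "(average S u)^4 = ((average S u)\<^sup>2)\<^sup>2" by simp
  also have "\<dots> \<le> (average S (\<lambda>y. (u y)\<^sup>2))\<^sup>2"
    by (intro power_mono average_power2_le[OF u]) simp
  also have "\<dots> \<le> average S (\<lambda>y. ((u y)\<^sup>2)\<^sup>2)"
    by (rule average_power2_le[OF u2])
  also have "\<dots> \<le> (LINT x|lborel. ((u x)\<^sup>2)\<^sup>2) / measure lborel S"
    using u2 by (intro average_le_integral) (auto simp: sq_integrable_def)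
  finally show ?thesis by simp
qed

text \<open>By Jensen the left side is at most the mean over \<open>S\<close> of
  \<open>(u x - u y)\<^sup>2\<close>; as \<open>S\<close> lies within distance \<open>r\<close> of
  \<open>x\<close>, the kernel there is at least the reciprocal of
  \<open>r powr (real DIM('a) + 2 * s)\<close>.\<close>

lemma average_deviation:
  assumes u: "sq_integrable lborel u" and sub: "S \<subseteq> cball x r" and s: "0 < s"
    and i: "integrable lborel (\<lambda>y. (dquot s u (x, y))\<^sup>2)"
  shows "(u x - average S u)\<^sup>2 \<le> r powr (real DIM('a) + 2 * s) / measure lborel S * gag_density s u x"
proof -
  have "measure lborel S * (u x - average S u)\<^sup>2
      \<le> measure lborel S * ((u x)\<^sup>2 - 2 * u x * average S u + average S (\<lambda>y. (u y)\<^sup>2))"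
    using average_power2_le[OF u] pos by (intro mult_left_mono) (auto simp: power2_diff)
  also have "\<dots> = (LINT y|lborel. indicator S y * (u x - u y)\<^sup>2)"
    by (rule average_expand(2)[OF u, symmetric])
  also have "\<dots> \<le> (LINT y|lborel. r powr (real DIM('a) + 2 * s) * (dquot s u (x, y))\<^sup>2)"
  proof (rule integral_mono[OF average_expand(1)[OF u]])
    show "integrable lborel (\<lambda>y. r powr (real DIM('a) + 2 * s) * (dquot s u (x, y))\<^sup>2)"
      using i by simp
    fix y
    show "indicator S y * (u x - u y)\<^sup>2 \<le> r powr (real DIM('a) + 2 * s) * (dquot s u (x, y))\<^sup>2"
    proof (cases "y \<in> S \<and> y \<noteq> x")
      case True
      then have d: "norm (x - y) \<le> r" "0 < norm (x - y)" using sub by (auto simp: dist_norm)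
      have "(u x - u y)\<^sup>2 = norm (x - y) powr (real DIM('a) + 2 * s) * (dquot s u (x, y))\<^sup>2"
        using d by (simp add: dquot_power2)
      also have "\<dots> \<le> r powr (real DIM('a) + 2 * s) * (dquot s u (x, y))\<^sup>2"
        using d s by (intro mult_right_mono powr_mono2) auto
      finally show ?thesis using True by simp
    next
      case False
      then have "indicator S y * (u x - u y)\<^sup>2 = 0" by (auto simp: indicator_def)
      then show ?thesis by (metis mult_nonneg_nonneg powr_ge_zero zero_le_power2)
    qed
  qed
  also have "\<dots> = r powr (real DIM('a) + 2 * s) * gag_density s u x"
    by (simp add: gag_density_def)
  finally show ?thesis using pos by (simp add: field_simps)
qed

end

lemma finite_set_average_ball: "r > 0 \<Longrightarrow> finite_set_average (ball x r)"
  by unfold_locales (use emeasure_lborel_ball_finite content_ball_gt_0_iff[of x r] in auto)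

lemma ball_average_deviation:
  fixes u :: "'a::euclidean_space \<Rightarrow> real"
  assumes u: "sq_integrable lborel u" and r: "r > 0" and s: "0 < s"
    and i: "integrable lborel (\<lambda>y. (dquot s u (x, y))\<^sup>2)"
  shows "(u x - average (ball x r) u)\<^sup>2
    \<le> r powr (2 * s) / measure lborel (ball (0::'a) 1) * gag_density s u x"
proof -
  interpret finite_set_average "ball x r" by (rule finite_set_average_ball[OF r])
  have "r powr (real DIM('a) + 2 * s) = r ^ DIM('a) * r powr (2 * s)"
    using r by (simp add: powr_add powr_realpow)
  then have "r powr (real DIM('a) + 2 * s) / measure lborel (ball x r)
      = r powr (2 * s) / measure lborel (ball (0::'a) 1)"
    using r by (simp add: measure_ball_scale[of r x])
  then show ?thesis using average_deviation[OF u _ s i, of r] ball_subset_cball by simp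
qed

text \<open>Averaging over a ball whose radius is so large that the average is at most \<open>\<bar>u x\<bar> / 2\<close>
  turns the deviation estimate into a pointwise bound of \<open>u x\<close>.\<close>
lemma sobolev_pointwise:
  fixes u :: "'a::euclidean_space \<Rightarrow> real"
  assumes u: "sq_integrable lborel u" and u4: "integrable lborel (\<lambda>x. (u x)^4)" and s: "0 < s"
    and i: "integrable lborel (\<lambda>y. (dquot s u (x, y))\<^sup>2)"
    and M: "(LINT x|lborel. (u x)^4) \<le> M" "M > 0" and ux: "u x \<noteq> 0"
  defines "\<omega> \<equiv> measure lborel (ball (0::'a) 1)" and "\<sigma> \<equiv> 2 * s / real DIM('a)"
  shows "(u x)\<^sup>2 \<le> 4 / \<omega> * (16 / \<omega> * M / (u x)^4) powr \<sigma> * gag_density s u x"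
proof -
  have \<omega>: "\<omega> > 0" unfolding \<omega>_def using content_ball_gt_0_iff[of "0::'a" 1] by simp
  define A where "A = 16 / \<omega> * M / (u x)^4"
  have A: "A > 0" using \<omega> M ux by (simp add: A_def)
  \<comment> \<open>The ball of radius \<open>r\<close> has volume \<open>16 * M / (u x)^4\<close>,
    exactly what makes the fourth power of the average at most \<open>(u x / 2)^4\<close>.\<close>
  define r where "r = A powr (1 / real DIM('a))"
  have r: "r > 0" using A by (simp add: r_def)
  have rN: "r ^ DIM('a) = A"
    using A by (simp add: r_def powr_realpow[symmetric] powr_powr)
  interpret finite_set_average "ball x r" by (rule finite_set_average_ball[OF r])
  have m: "measure lborel (ball x r) = A * \<omega>"
    using r by (simp add: measure_ball_scale[of r x] rN \<omega>_def)
  have "(average (ball x r) u)^4 \<le> M / (A * \<omega>)"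
    using order_trans[OF average_power4_le[OF u u4] divide_right_mono[OF M(1)]] A \<omega> by (simp add: m)
  also have "\<dots> = (u x / 2)^4"
    using \<omega> M ux by (simp add: A_def power_divide)
  finally have "\<bar>average (ball x r) u\<bar> ^ 4 \<le> \<bar>u x / 2\<bar> ^ 4"
    by (metis even_numeral power_even_abs)
  then have "\<bar>average (ball x r) u\<bar> \<le> \<bar>u x / 2\<bar>"
    by (simp only: power_mono_iff[OF abs_ge_zero abs_ge_zero])
  then have "\<bar>u x / 2\<bar> \<le> \<bar>u x - average (ball x r) u\<bar>" by linarith
  then have "(u x / 2)\<^sup>2 \<le> (u x - average (ball x r) u)\<^sup>2" by (simp only: abs_le_square_iff)
  also have "\<dots> \<le> r powr (2 * s) / \<omega> * gag_density s u x"
    unfolding \<omega>_def by (rule ball_average_deviation[OF u r s i])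
  also have "r powr (2 * s) = A powr \<sigma>"
    by (simp add: r_def powr_powr \<sigma>_def)
  finally show ?thesis by (simp add: A_def power_divide mult_ac)
qed

text \<open>Multiplying the pointwise bound by \<open>(u x)\<^sup>2\<close> leaves the factor
  \<open>\<bar>u x\<bar> powr (2 - 4 * \<sigma>)\<close>. Since \<open>s\<close> exceeds a quarter
  of the dimension the exponent is negative, so the factor is largest at the lower end
  \<open>l\<close> of the range.\<close>

lemma sobolev_tail:
  fixes u :: "'a::euclidean_space \<Rightarrow> real"
  assumes u: "sq_integrable lborel u" and u4: "integrable lborel (\<lambda>x. (u x)^4)" and s: "0 < s" "real DIM('a) / 4 < s"
    and i: "integrable lborel (\<lambda>y. (dquot s u (x, y))\<^sup>2)"
    and M: "(LINT x|lborel. (u x)^4) \<le> M" "M > 0" and l: "l > 0" "l \<le> \<bar>u x\<bar>"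
  defines "\<omega> \<equiv> measure lborel (ball (0::'a) 1)" and "\<sigma> \<equiv> 2 * s / real DIM('a)"
  shows "(u x)^4 \<le> 4 / \<omega> * (16 / \<omega>) powr \<sigma> * M powr \<sigma> * l powr (2 - 4 * \<sigma>) * gag_density s u x"
proof -
  have \<omega>: "\<omega> > 0" unfolding \<omega>_def using content_ball_gt_0_iff[of "0::'a" 1] by simp
  have \<sigma>: "\<sigma> > 1/2" using s by (simp add: \<sigma>_def field_simps)
  define a where "a = \<bar>u x\<bar>"
  have a: "a > 0" "l \<le> a" using l by (auto simp: a_def)
  have ux: "u x \<noteq> 0" using a by (auto simp: a_def)
  have e: "(16 / \<omega> * M / (u x)^4) powr \<sigma> = (16 / \<omega>) powr \<sigma> * M powr \<sigma> * a powr (- 4 * \<sigma>)"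
  proof -
    have "(u x)^4 = a powr 4" using a by (simp add: a_def)
    then have "((u x)^4) powr \<sigma> = a powr (4 * \<sigma>)" by (simp only: powr_powr)
    then show ?thesis using \<omega> M a
      by (simp add: powr_divide powr_mult powr_minus_divide)
  qed
  have "(u x)^4 = a powr 2 * (u x)\<^sup>2"
    using a by (simp add: a_def power2_eq_square power4_eq_xxxx)
  also have "\<dots> \<le> a powr 2 * (4 / \<omega> * ((16 / \<omega>) powr \<sigma> * M powr \<sigma> * a powr (- 4 * \<sigma>)) * gag_density s u x)"
    using sobolev_pointwise[OF u u4 s(1) i M ux] unfolding \<omega>_def[symmetric] \<sigma>_def[symmetric] e
    by (intro mult_left_mono) auto
  also have "\<dots> = (4 / \<omega> * (16 / \<omega>) powr \<sigma> * M powr \<sigma> * gag_density s u x) * a powr (2 - 4 * \<sigma>)"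
  proof -
    have p: "a powr (2 - 4 * \<sigma>) = a powr 2 * a powr (- 4 * \<sigma>)"
      unfolding powr_add[symmetric] by simp
    show ?thesis unfolding p by (simp only: mult.assoc mult.left_commute mult.commute)
  qed
  also have "\<dots> \<le> (4 / \<omega> * (16 / \<omega>) powr \<sigma> * M powr \<sigma> * gag_density s u x) * l powr (2 - 4 * \<sigma>)"
    using a l \<sigma> \<omega> gag_density_nonneg[of s u x] by (intro mult_left_mono powr_mono2') auto
  finally show ?thesis by (simp only: mult.assoc mult.left_commute mult.commute)
qed

text \<open>An a priori bound: the fourth moment is assumed finite and its size is estimated. Values
  below \<open>sqrt m\<close> contribute at most \<open>m\<close>, half of the moment, so the tail
  must carry the rest; this gives
  \<open>m \<le> K * 2 powr \<sigma> * m powr (1 - \<sigma>)\<close>, in which a power of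
  \<open>m\<close> cancels.\<close>

lemma sobolev_bounded:
  fixes u :: "'a::euclidean_space \<Rightarrow> real"
  assumes u: "Hs s u" and u4: "integrable lborel (\<lambda>x. (u x)^4)" and s: "0 < s" "real DIM('a) / 4 < s"
    and n2: "(LINT x|lborel. (u x)\<^sup>2) \<le> 1" and g: "gagliardo s u \<le> 1"
  defines "\<omega> \<equiv> measure lborel (ball (0::'a) 1)" and "\<sigma> \<equiv> 2 * s / real DIM('a)"
  shows "(LINT x|lborel. (u x)^4) \<le> 2 * (4 / \<omega> * (16 / \<omega>) powr \<sigma> * 2 powr \<sigma>) powr (1 / \<sigma>)"
proof (cases "(LINT x|lborel. (u x)^4) \<le> 0")
  case True
  moreover have "0 \<le> 2 * (4 / \<omega> * (16 / \<omega>) powr \<sigma> * 2 powr \<sigma>) powr (1 / \<sigma>)" by simp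
  ultimately show ?thesis by linarith
next
  case False
  define m where "m = (LINT x|lborel. (u x)^4) / 2"
  define K where "K = 4 / \<omega> * (16 / \<omega>) powr \<sigma>"
  have m: "m > 0" using False by (simp add: m_def)
  have \<omega>: "\<omega> > 0" unfolding \<omega>_def using content_ball_gt_0_iff[of "0::'a" 1] by simp
  have \<sigma>: "\<sigma> > 1/2" using s by (simp add: \<sigma>_def field_simps)
  have K: "K > 0" using \<omega> by (simp add: K_def)
  have sq: "sq_integrable lborel u" using u by (simp add: Hs_iff)
  define c where "c = K * (2 * m) powr \<sigma> * sqrt m powr (2 - 4 * \<sigma>)"
  have main: "(LINT x|lborel. (u x)^4) \<le> (LINT x|lborel. m * (u x)\<^sup>2 + c * gag_density s u x)"
    proof (rule integral_mono_AE[OF u4])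
      show "integrable lborel (\<lambda>x. m * (u x)\<^sup>2 + c * gag_density s u x)"
        using sq_integrable_square[OF sq] integrable_gag_density[OF u] by simp
      show "AE x in lborel. (u x)^4 \<le> m * (u x)\<^sup>2 + c * gag_density s u x"
        using AE_integrable_dquot[OF u]
      proof eventually_elim
        case (elim x)
        have c0: "0 \<le> c * gag_density s u x" using K gag_density_nonneg[of s u x] by (simp add: c_def)
        show ?case
        proof (cases "sqrt m \<le> \<bar>u x\<bar>")
          case True
          have "(u x)^4 \<le> c * gag_density s u x"
            using sobolev_tail[OF sq u4 s elim, of "2 * m" "sqrt m"] True m
            unfolding \<omega>_def[symmetric] \<sigma>_def[symmetric] K_def[symmetric] c_def by (simp add: m_def)
          moreover have "0 \<le> m * (u x)\<^sup>2" using m by simp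
          ultimately show ?thesis by linarith
        next
          case False
          then have "(u x)\<^sup>2 \<le> m" 
            using m power_mono[of "\<bar>u x\<bar>" "sqrt m" 2] by simp
          then have "(u x)\<^sup>2 * (u x)\<^sup>2 \<le> m * (u x)\<^sup>2" by (intro mult_right_mono) auto
          moreover have "(u x)^4 = (u x)\<^sup>2 * (u x)\<^sup>2" by (simp flip: power_add)
          ultimately show ?thesis using c0 by linarith
        qed
      qed
    qed
  have "2 * m \<le> (LINT x|lborel. m * (u x)\<^sup>2 + c * gag_density s u x)"
    using main by (simp add: m_def)
  also have "\<dots> = m * (LINT x|lborel. (u x)\<^sup>2) + c * gagliardo s u"
    using sq_integrable_square[OF sq] integrable_gag_density[OF u] integral_gag_density[OF u] by simp
  also have "\<dots> \<le> m * 1 + c * 1"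
    using n2 g m K by (intro add_mono mult_left_mono) (auto simp: c_def)
  finally have "m \<le> c" by simp
  also have "c = K * 2 powr \<sigma> * m powr (1 - \<sigma>)"
  proof -
    have "sqrt m powr (2 - 4 * \<sigma>) = m powr (1 - 2 * \<sigma>)"
      using m by (simp add: powr_half_sqrt[symmetric] powr_powr diff_divide_distrib)
    moreover have "m powr \<sigma> * m powr (1 - 2 * \<sigma>) = m powr (1 - \<sigma>)"
      unfolding powr_add[symmetric] by simp
    ultimately show ?thesis using m unfolding c_def by (simp add: powr_mult)
  qed
  also have "m powr (1 - \<sigma>) = m / m powr \<sigma>"
    using m by (simp add: powr_diff)
  finally have "m powr \<sigma> \<le> K * 2 powr \<sigma>"
    using m by (simp add: field_simps)
  then have "(m powr \<sigma>) powr (1 / \<sigma>) \<le> (K * 2 powr \<sigma>) powr (1 / \<sigma>)"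
    using \<sigma> by (intro powr_mono2) auto
  then have "m \<le> (K * 2 powr \<sigma>) powr (1 / \<sigma>)"
    using m \<sigma> by (simp add: powr_powr)
  then show ?thesis by (simp add: m_def K_def)
qed

text \<open>The a priori bound is applied to the truncations at height \<open>n\<close>, which are
  contractions and have a finite fourth moment because they are bounded and square integrable;
  monotone convergence then removes the truncation.\<close>

lemma sobolev_embedding:
  assumes s: "0 < s" "real DIM('a::euclidean_space) / 4 < s"
  shows "\<exists>C>0. \<forall>u::'a \<Rightarrow> real. Hs s u \<longrightarrow> (LINT x|lborel. (u x)\<^sup>2) \<le> 1 \<longrightarrow> gagliardo s u \<le> 1 \<longrightarrow>
     integrable lborel (\<lambda>x. (u x)^4) \<and> (LINT x|lborel. (u x)^4) \<le> C"
proof -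
  define \<omega> where "\<omega> = measure lborel (ball (0::'a) 1)"
  define \<sigma> where "\<sigma> = 2 * s / real DIM('a)"
  define C where "C = 2 * (4 / \<omega> * (16 / \<omega>) powr \<sigma> * 2 powr \<sigma>) powr (1 / \<sigma>)"
  have \<omega>: "\<omega> > 0" unfolding \<omega>_def using content_ball_gt_0_iff[of "0::'a" 1] by simp
  have C: "C > 0" using \<omega> by (simp add: C_def)
  have "integrable lborel (\<lambda>x. (u x)^4) \<and> (LINT x|lborel. (u x)^4) \<le> C"
    if u: "Hs s u" and n2: "(LINT x|lborel. (u x)\<^sup>2) \<le> 1" and g: "gagliardo s u \<le> 1" for u :: "'a \<Rightarrow> real"
  proof -
    have [measurable]: "u \<in> borel_measurable borel" using u by auto
    define v where "v n x = max (- real n) (min (real n) (u x))" for n x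
    have [measurable]: "v n \<in> borel_measurable borel" for n unfolding v_def by measurable
    have vle: "\<bar>v n x\<bar> \<le> \<bar>u x\<bar>" and vlip: "\<bar>v n x - v n y\<bar> \<le> \<bar>u x - u y\<bar>" and vn: "\<bar>v n x\<bar> \<le> real n" for n x y
      unfolding v_def by linarith+
    have vH: "Hs s (v n)" for n by (rule Hs_contraction[OF u _ vle vlip]) measurable
    have v4: "integrable lborel (\<lambda>x. (v n x)^4)" for n
    proof (rule integrable_dominated[where f="\<lambda>x. (real n)\<^sup>2 * (v n x)\<^sup>2"])
      show "integrable lborel (\<lambda>x. (real n)\<^sup>2 * (v n x)\<^sup>2)"
        using vH[of n] by (simp add: Hs_def)
      fix x
      have "(v n x)\<^sup>2 \<le> (real n)\<^sup>2" using vn[of n x] by (metis abs_ge_zero power2_abs power_mono)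
      then have "(v n x)\<^sup>2 * (v n x)\<^sup>2 \<le> (real n)\<^sup>2 * (v n x)\<^sup>2" by (intro mult_right_mono) auto
      moreover have "\<bar>(v n x)^4\<bar> = (v n x)\<^sup>2 * (v n x)\<^sup>2"
        by (simp flip: power_add)
      ultimately show "\<bar>(v n x)^4\<bar> \<le> (real n)\<^sup>2 * (v n x)\<^sup>2" by simp
    qed measurable
    have bd: "(LINT x|lborel. (v n x)^4) \<le> C" for n
      unfolding C_def \<omega>_def \<sigma>_def
    proof (rule sobolev_bounded[OF vH v4 s])
      show "(LINT x|lborel. (v n x)\<^sup>2) \<le> 1"
        using L2_contraction[OF u _ vle vlip, of n] n2 by simp
      show "gagliardo s (v n) \<le> 1"
        using gagliardo_contraction[OF u _ vle vlip, of n] g by simp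
    qed
    have "mono (\<lambda>n. (v n x)^4)" for x
    proof (rule monoI)
      fix m n :: nat assume "m \<le> n"
      then have "\<bar>v m x\<bar> \<le> \<bar>v n x\<bar>" unfolding v_def by linarith
      then have "\<bar>v m x\<bar>^4 \<le> \<bar>v n x\<bar>^4" by (intro power_mono) auto
      then show "(v m x)^4 \<le> (v n x)^4" by simp
    qed
    then have mono: "AE x in lborel. mono (\<lambda>n. (v n x)^4)" by simp
    have lim: "AE x in lborel. (\<lambda>n. (v n x)^4) \<longlonglongrightarrow> (u x)^4"
    proof (rule AE_I2)
      fix x
      obtain n0 where n0: "\<bar>u x\<bar> \<le> real n0" using real_arch_simple by blast
      have "v n x = u x" if "n \<ge> n0" for n
        using n0 that of_nat_mono[OF that, where 'a=real] unfolding v_def by linarith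
      then have "\<forall>\<^sub>F n in sequentially. (v n x)^4 = (u x)^4"
        by (intro eventually_sequentiallyI[of n0]) auto
      then show "(\<lambda>n. (v n x)^4) \<longlonglongrightarrow> (u x)^4" by (rule tendsto_eventually)
    qed
    have "incseq (\<lambda>n. LINT x|lborel. (v n x)^4)"
      using v4 \<open>\<And>x. mono (\<lambda>n. (v n x)^4)\<close> by (intro incseq_SucI integral_mono) (auto simp: mono_iff_le_Suc)
    then obtain L where L: "(\<lambda>n. LINT x|lborel. (v n x)^4) \<longlonglongrightarrow> L" "\<forall>i. (LINT x|lborel. (v i x)^4) \<le> L"
      using bd by (rule incseq_convergent[OF _ allI]) blast
    have m: "(\<lambda>x. (u x)^4) \<in> borel_measurable lborel" by measurable
    have "L \<le> C" using L(1) bd by (intro LIMSEQ_le_const2) auto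
    then show ?thesis
      using integrable_monotone_convergence[OF v4 mono lim L(1) m]
        integral_monotone_convergence[OF v4 mono lim L(1) m] by simp
  qed
  then show ?thesis using C by blast
qed

section \<open>Nonvanishing and local compactness\<close>

text \<open>A quantitative form of Lions' vanishing lemma. If all averages at scale
  \<open>\<rho>\<close> were at most \<open>\<delta>\<close>, then \<open>(u x)^4 \<le> \<epsilon> /
  4 * (u x)\<^sup>2 + \<epsilon> / 2 * gag_density s u x\<close> almost everywhere, and the right
  side has integral at most \<open>3 * \<epsilon> / 4\<close>. Small, large and intermediate values
  of \<open>u\<close> are treated separately.\<close>

lemma nonvanishing:
  assumes s: "0 < s" "real DIM('a::euclidean_space) / 4 < s" and \<epsilon>: "\<epsilon> > 0"
  shows "\<exists>\<rho>>0. \<exists>\<delta>>0. \<forall>u::'a \<Rightarrow> real. Hs s u \<longrightarrow> (LINT x|lborel. (u x)\<^sup>2) \<le> 1 \<longrightarrow> gagliardo s u \<le> 1 \<longrightarrow>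
     \<epsilon> \<le> (LINT x|lborel. (u x)^4) \<longrightarrow> (\<exists>x. \<delta> < \<bar>average (ball x \<rho>) u\<bar>)"
proof -
  obtain C where C: "C > 0" and emb: "\<And>u::'a \<Rightarrow> real. Hs s u \<Longrightarrow> (LINT x|lborel. (u x)\<^sup>2) \<le> 1 \<Longrightarrow> gagliardo s u \<le> 1 \<Longrightarrow>
     integrable lborel (\<lambda>x. (u x)^4) \<and> (LINT x|lborel. (u x)^4) \<le> C"
    using sobolev_embedding[where 'a='a, OF s] by blast
  define \<omega> where "\<omega> = measure lborel (ball (0::'a) 1)"
  define \<sigma> where "\<sigma> = 2 * s / real DIM('a)"
  define K where "K = 4 / \<omega> * (16 / \<omega>) powr \<sigma> * C powr \<sigma>"
  have \<omega>: "\<omega> > 0" unfolding \<omega>_def using content_ball_gt_0_iff[of "0::'a" 1] by simp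
  have \<sigma>: "\<sigma> > 1/2" using s by (simp add: \<sigma>_def field_simps)
  have K: "K > 0" using \<omega> C by (simp add: K_def)
  \<comment> \<open>Above \<open>\<Lambda>\<close> the tail estimate has coefficient
    \<open>\<epsilon> / 4\<close>; the equation can be solved because
    \<open>2 - 4 * \<sigma>\<close> is nonzero.\<close>
  define \<Lambda> where "\<Lambda> = (\<epsilon> / (4 * K)) powr (1 / (2 - 4 * \<sigma>))"
  have \<Lambda>: "\<Lambda> > 0" using \<epsilon> K by (simp add: \<Lambda>_def)
  have \<Lambda>K: "K * \<Lambda> powr (2 - 4 * \<sigma>) = \<epsilon> / 4"
    using \<epsilon> K \<sigma> by (simp add: \<Lambda>_def powr_powr)
  \<comment> \<open>So small that a value between \<open>2 * \<delta>\<close> and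
    \<open>\<Lambda>\<close>, which differs from its average by at least half its size, satisfies
    \<open>\<Lambda>\<^sup>2 * (u x)\<^sup>2 \<le> \<epsilon> / 4 * gag_density s u
    x\<close>.\<close>
  define \<rho> where "\<rho> = (\<epsilon> * \<omega> / (16 * \<Lambda>\<^sup>2)) powr (1 / (2 * s))"
  have \<rho>: "\<rho> > 0" using \<epsilon> \<omega> \<Lambda> by (simp add: \<rho>_def)
  have \<rho>s: "\<rho> powr (2 * s) = \<epsilon> * \<omega> / (16 * \<Lambda>\<^sup>2)"
    using \<epsilon> \<omega> s \<Lambda> by (simp add: \<rho>_def powr_powr)
  \<comment> \<open>Values up to \<open>2 * \<delta>\<close> then satisfy
    \<open>(u x)\<^sup>2 \<le> \<epsilon> / 4\<close>.\<close>
  define \<delta> where "\<delta> = sqrt \<epsilon> / 4"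
  have \<delta>: "\<delta> > 0" using \<epsilon> by (simp add: \<delta>_def)
  have \<delta>2: "(2 * \<delta>)\<^sup>2 = \<epsilon> / 4" using \<epsilon> by (simp add: \<delta>_def power_divide)
  have "\<exists>x. \<delta> < \<bar>average (ball x \<rho>) u\<bar>"
    if u: "Hs s u" and n2: "(LINT x|lborel. (u x)\<^sup>2) \<le> 1" and g: "gagliardo s u \<le> 1"
      and e: "\<epsilon> \<le> (LINT x|lborel. (u x)^4)" for u :: "'a \<Rightarrow> real"
  proof (rule ccontr)
    assume "\<not> ?thesis"
    then have small: "\<bar>average (ball x \<rho>) u\<bar> \<le> \<delta>" for x by (simp add: not_less)
    have u4: "integrable lborel (\<lambda>x. (u x)^4)" "(LINT x|lborel. (u x)^4) \<le> C"
      using emb[OF u n2 g] by auto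
    have sq: "sq_integrable lborel u" using u by (simp add: Hs_iff)
    have "(LINT x|lborel. (u x)^4) \<le> (LINT x|lborel. \<epsilon> / 4 * (u x)\<^sup>2 + \<epsilon> / 2 * gag_density s u x)"
    proof (rule integral_mono_AE[OF u4(1)])
      show "integrable lborel (\<lambda>x. \<epsilon> / 4 * (u x)\<^sup>2 + \<epsilon> / 2 * gag_density s u x)"
        using sq_integrable_square[OF sq] integrable_gag_density[OF u] by simp
      show "AE x in lborel. (u x)^4 \<le> \<epsilon> / 4 * (u x)\<^sup>2 + \<epsilon> / 2 * gag_density s u x"
        using AE_integrable_dquot[OF u]
      proof eventually_elim
        case (elim x)
        define D where "D = gag_density s u x"
        have D: "0 \<le> \<epsilon> * D" using \<epsilon> gag_density_nonneg[of s u x] by (simp add: D_def)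
        have U: "0 \<le> \<epsilon> * (u x)\<^sup>2" using \<epsilon> by simp
        have u22: "(u x)^4 = (u x)\<^sup>2 * (u x)\<^sup>2" by (simp flip: power_add)
        consider "\<bar>u x\<bar> \<le> 2 * \<delta>" | "\<Lambda> \<le> \<bar>u x\<bar>" | "2 * \<delta> < \<bar>u x\<bar>" "\<bar>u x\<bar> < \<Lambda>" by linarith
        then have "(u x)^4 \<le> \<epsilon> / 4 * (u x)\<^sup>2 + \<epsilon> / 2 * D"
        proof cases
          case 1
          then have "(u x)\<^sup>2 \<le> (2 * \<delta>)\<^sup>2" using power_mono[of "\<bar>u x\<bar>" "2 * \<delta>" 2] by simp
          then have "(u x)\<^sup>2 * (u x)\<^sup>2 \<le> \<epsilon> / 4 * (u x)\<^sup>2" unfolding \<delta>2 by (intro mult_right_mono) auto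
          then show ?thesis using u22 D by linarith
        next
          case 2
          have "(u x)^4 \<le> K * \<Lambda> powr (2 - 4 * \<sigma>) * D"
            using sobolev_tail[OF sq u4(1) s elim u4(2) C \<Lambda> 2]
            by (simp only: \<omega>_def[symmetric] \<sigma>_def[symmetric] K_def D_def)
          then have "(u x)^4 \<le> \<epsilon> / 4 * D" unfolding \<Lambda>K .
          then show ?thesis using U D by linarith
        next
          case 3
          have "\<bar>u x / 2\<bar> \<le> \<bar>u x - average (ball x \<rho>) u\<bar>" using 3(1) small[of x] by linarith
          then have "(u x / 2)\<^sup>2 \<le> (u x - average (ball x \<rho>) u)\<^sup>2" by (simp only: abs_le_square_iff)
          also have "\<dots> \<le> \<rho> powr (2 * s) / \<omega> * D"
            unfolding \<omega>_def D_def by (rule ball_average_deviation[OF sq \<rho> s(1) elim])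
          also have "\<dots> = \<epsilon> * D / (16 * \<Lambda>\<^sup>2)" using \<omega> by (simp add: \<rho>s)
          finally have "(u x)\<^sup>2 \<le> \<epsilon> * D / (4 * \<Lambda>\<^sup>2)" by (simp add: power_divide mult.commute)
          then have "\<Lambda>\<^sup>2 * (u x)\<^sup>2 \<le> \<Lambda>\<^sup>2 * (\<epsilon> * D / (4 * \<Lambda>\<^sup>2))" by (intro mult_left_mono) auto
          also have "\<dots> = \<epsilon> / 4 * D" using \<Lambda> by simp
          finally have "\<Lambda>\<^sup>2 * (u x)\<^sup>2 \<le> \<epsilon> / 4 * D" .
          moreover have "(u x)\<^sup>2 \<le> \<Lambda>\<^sup>2" using 3 power_mono[of "\<bar>u x\<bar>" "\<Lambda>" 2] by simp
          then have "(u x)\<^sup>2 * (u x)\<^sup>2 \<le> \<Lambda>\<^sup>2 * (u x)\<^sup>2" by (intro mult_right_mono) auto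
          ultimately show ?thesis using u22 U D by linarith
        qed
        then show ?case by (simp add: D_def)
      qed
    qed
    also have "\<dots> = \<epsilon> / 4 * (LINT x|lborel. (u x)\<^sup>2) + \<epsilon> / 2 * gagliardo s u"
      using sq_integrable_square[OF sq] integrable_gag_density[OF u] integral_gag_density[OF u] by simp
    also have "\<dots> \<le> \<epsilon> / 4 * 1 + \<epsilon> / 2 * 1"
      using n2 g \<epsilon> by (intro add_mono mult_left_mono) auto
    finally show False using e \<epsilon> by simp
  qed
  then show ?thesis using \<rho> \<delta> by blast
qed

section \<open>Lattice cells and convergence almost everywhere\<close>

definition cell :: "real \<Rightarrow> 'a::euclidean_space \<Rightarrow> 'a set" where
  "cell k x = {y. \<forall>b\<in>Basis. \<lfloor>k * (y \<bullet> b)\<rfloor> = \<lfloor>k * (x \<bullet> b)\<rfloor>}"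

lemma cell_measurable [measurable]: "cell k x \<in> sets borel"
  unfolding cell_def by measurable

lemma cell_pair_measurable [measurable]: "Measurable.pred (borel \<Otimes>\<^sub>M borel) (\<lambda>z. snd z \<in> cell k (fst z))"
  unfolding cell_def mem_Collect_eq by measurable

lemma cell_eq: "y \<in> cell k x \<Longrightarrow> cell k y = cell k x"
  by (auto simp: cell_def)

text \<open>Cells are half-open cubes of side \<open>1 / k\<close> that partition the space, so an
  average over cells takes only countably many values as \<open>x\<close> varies. The volume is
  squeezed between the open and the closed box; the open box lets a countable dense set meet every
  cell.\<close>

lemma
  fixes x :: "'a::euclidean_space"
  assumes k: "k > 0"
  shows measure_cell: "measure lborel (cell k x) = (1 / k) ^ DIM('a)"
    and emeasure_cell_finite: "emeasure lborel (cell k x) < \<infinity>"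
    and cell_subset_cball: "cell k x \<subseteq> cball x (real DIM('a) / k)"
    and cell_interior: "\<exists>l h. box l h \<noteq> {} \<and> box l h \<subseteq> cell k x"
proof -
  define l :: 'a where "l = (\<Sum>b\<in>Basis. (real_of_int \<lfloor>k * (x \<bullet> b)\<rfloor> / k) *\<^sub>R b)"
  define h :: 'a where "h = (\<Sum>b\<in>Basis. ((real_of_int \<lfloor>k * (x \<bullet> b)\<rfloor> + 1) / k) *\<^sub>R b)"
  have lb: "l \<bullet> b = real_of_int \<lfloor>k * (x \<bullet> b)\<rfloor> / k" and hb: "h \<bullet> b = (real_of_int \<lfloor>k * (x \<bullet> b)\<rfloor> + 1) / k"
    if "b \<in> Basis" for b using that by (auto simp: l_def h_def)
  have lh: "l \<bullet> b \<le> h \<bullet> b" "(h - l) \<bullet> b = 1 / k" "l \<bullet> b < h \<bullet> b" if "b \<in> Basis" for b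
    using that k by (auto simp: lb hb inner_diff_left divide_simps)
  have fl: "\<lfloor>k * (y \<bullet> b)\<rfloor> = \<lfloor>k * (x \<bullet> b)\<rfloor> \<longleftrightarrow> l \<bullet> b \<le> y \<bullet> b \<and> y \<bullet> b < h \<bullet> b" if "b \<in> Basis" for y b
    using k that by (auto simp: lb hb floor_eq_iff divide_simps mult.commute)
  have sub1: "box l h \<subseteq> cell k x" unfolding cell_def box_def using fl by auto
  have sub2: "cell k x \<subseteq> cbox l h" unfolding cell_def cbox_def using fl by force
  show fin: "emeasure lborel (cell k x) < \<infinity>"
    using emeasure_mono[OF sub2, of lborel] emeasure_lborel_cbox_finite[of l h] by (auto intro: le_less_trans)
  have "measure lborel (box l h) = (1 / k) ^ DIM('a)" "measure lborel (cbox l h) = (1 / k) ^ DIM('a)"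
    using lh by (auto simp: measure_lborel_box_eq measure_lborel_cbox_eq)
  moreover have "measure lborel (box l h) \<le> measure lborel (cell k x)"
    using sub1 fin by (intro measure_mono_fmeasurable) (auto simp: fmeasurable_def)
  moreover have "measure lborel (cell k x) \<le> measure lborel (cbox l h)"
    using sub2 emeasure_lborel_cbox_finite[of l h] by (intro measure_mono_fmeasurable) (auto simp: fmeasurable_def)
  ultimately show "measure lborel (cell k x) = (1 / k) ^ DIM('a)" by linarith
  show "cell k x \<subseteq> cball x (real DIM('a) / k)"
  proof
    fix y assume y: "y \<in> cell k x"
    have "norm (x - y) \<le> (\<Sum>b\<in>Basis. \<bar>(x - y) \<bullet> b\<bar>)" by (rule norm_le_l1)
    also have "\<dots> \<le> (\<Sum>b\<in>(Basis::'a set). 1 / k)"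
    proof (rule sum_mono)
      fix b :: 'a assume b: "b \<in> Basis"
      have "l \<bullet> b \<le> y \<bullet> b \<and> y \<bullet> b < h \<bullet> b" using y b fl[OF b, of y] by (auto simp: cell_def)
      moreover have "l \<bullet> b \<le> x \<bullet> b \<and> x \<bullet> b < h \<bullet> b" using fl[OF b, of x] by simp
      ultimately show "\<bar>(x - y) \<bullet> b\<bar> \<le> 1 / k" using lh(2)[OF b] unfolding inner_diff_left by linarith
    qed
    finally show "y \<in> cball x (real DIM('a) / k)" by (simp add: dist_norm)
  qed
  show "\<exists>l h. box l h \<noteq> {} \<and> box l h \<subseteq> cell k x"
    using sub1 lh(3) by (intro exI[of _ l] exI[of _ h]) (auto simp: box_ne_empty)
qed

lemma finite_set_average_cell: "k > 0 \<Longrightarrow> finite_set_average (cell k x)"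
  by unfold_locales (use emeasure_cell_finite[of k x] measure_cell[of k x] in auto)

text \<open>The factor \<open>k powr (- 2 * s)\<close> tends to 0: fine averages approximate all
  functions of bounded Gagliardo energy at once, and this is the source of compactness.\<close>

lemma cell_average_deviation:
  fixes u :: "'a::euclidean_space \<Rightarrow> real"
  assumes u: "sq_integrable lborel u" and k: "k > 0" and s: "0 < s"
    and i: "integrable lborel (\<lambda>y. (dquot s u (x, y))\<^sup>2)"
  shows "(u x - average (cell k x) u)\<^sup>2
    \<le> real DIM('a) powr (real DIM('a) + 2 * s) * k powr (- 2 * s) * gag_density s u x"
proof -
  interpret finite_set_average "cell k x" by (rule finite_set_average_cell[OF k])
  have "(real DIM('a) / k) powr (real DIM('a) + 2 * s) / measure lborel (cell k x)
      = real DIM('a) powr (real DIM('a) + 2 * s) * k powr (- 2 * s)"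
  proof -
    have a: "(1 / k) ^ DIM('a) = k powr (- real DIM('a))"
      using k by (simp add: powr_minus_divide powr_realpow power_one_over)
    have b: "(real DIM('a) / k) powr (real DIM('a) + 2 * s)
       = real DIM('a) powr (real DIM('a) + 2 * s) * k powr (- (real DIM('a) + 2 * s))"
      unfolding powr_minus_divide times_divide_eq_right mult_1_right by (rule powr_divide)
    have c: "k powr (- (real DIM('a) + 2 * s)) / k powr (- real DIM('a)) = k powr (- 2 * s)"
      unfolding powr_diff[symmetric] by simp
    show ?thesis unfolding measure_cell[OF k] a b times_divide_eq_right[symmetric] c by (rule refl)
  qed
  then show ?thesis using average_deviation[OF u cell_subset_cball[OF k] s i] by simp
qed

lemma cell_average_bound:
  fixes u :: "'a::euclidean_space \<Rightarrow> real"
  assumes u: "sq_integrable lborel u" and k: "k \<ge> 1" and n: "(LINT x|lborel. (u x)\<^sup>2) \<le> 1"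
  shows "\<bar>average (cell k x) u\<bar> \<le> k ^ DIM('a)"
proof -
  have k0: "k > 0" using k by simp
  interpret finite_set_average "cell k x" by (rule finite_set_average_cell[OF k0])
  have "(average (cell k x) u)\<^sup>2 \<le> average (cell k x) (\<lambda>y. (u y)\<^sup>2)" by (rule average_power2_le[OF u])
  also have "\<dots> \<le> (LINT x|lborel. (u x)\<^sup>2) / measure lborel (cell k x)"
    using u by (intro average_le_integral) (auto simp: sq_integrable_def)
  also have "\<dots> \<le> 1 / measure lborel (cell k x)"
    using n by (intro divide_right_mono) auto
  also have "\<dots> = k ^ DIM('a)" using k by (simp add: measure_cell power_one_over)
  also have "\<dots> \<le> (k ^ DIM('a))\<^sup>2"
    using one_le_power[OF k, of "DIM('a)"] by (simp add: power2_eq_square)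
  finally have "\<bar>average (cell k x) u\<bar> \<le> \<bar>k ^ DIM('a)\<bar>" by (simp only: abs_le_square_iff)
  then show ?thesis using k by simp
qed

lemma cell_average_measurable:
  assumes [measurable]: "u \<in> borel_measurable borel"
  shows "(\<lambda>x. average (cell k x) u) \<in> borel_measurable (lborel :: 'a::euclidean_space measure)"
proof -
  have i: "integral\<^sup>L lborel (indicator (cell k x) :: 'a \<Rightarrow> real) = measure lborel (cell k x)" for x :: 'a
    by simp
  have 1: "(\<lambda>x. LINT y|lborel. indicator (cell k x) y * f y) \<in> borel_measurable (lborel :: 'a measure)"
    if [measurable]: "f \<in> borel_measurable borel" for f :: "'a \<Rightarrow> real"
  proof -
    have "(\<lambda>x. LINT y|lborel. (if snd (x, y) \<in> cell k (fst (x, y)) then f (snd (x, y)) else 0)) \<in> borel_measurable (lborel :: 'a measure)"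
    proof (rule lborel.borel_measurable_lebesgue_integral)
      show "(\<lambda>(x, y). if snd (x, y) \<in> cell k (fst (x, y)) then f (snd (x, y)) else 0) \<in> borel_measurable (lborel \<Otimes>\<^sub>M lborel)"
        unfolding case_prod_beta by measurable
    qed
    moreover have "(if snd (x, y) \<in> cell k (fst (x, y)) then f (snd (x, y)) else 0) = indicator (cell k x) y * f y" for x y
      by (simp add: indicator_def)
    ultimately show ?thesis by simp
  qed
  have "(\<lambda>x. measure lborel (cell k x)) \<in> borel_measurable (lborel :: 'a measure)"
    using 1[of "\<lambda>_. 1"] by simp
  then show ?thesis unfolding average_def using 1[OF assms] by (intro borel_measurable_divide)
qed

text \<open>A positive factor, integrable and at most 1, that turns L2 control on the whole space
  into L1 control and can be divided out again pointwise. Its decay is that of the kernel, so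
  \<open>integrable_truncated_kernel\<close> yields its integrability.\<close>

definition weight :: "real \<Rightarrow> 'a::euclidean_space \<Rightarrow> real" where
  "weight s x = 1 / (1 + norm x powr (real DIM('a) + 2 * s))"

lemma
  fixes x :: "'a::euclidean_space"
  shows weight_pos: "0 < weight s x" and weight_le_1: "weight s x \<le> 1"
proof -
  have "1 + norm x powr (real DIM('a) + 2 * s) \<ge> 1" by simp
  then have "1 + norm x powr (real DIM('a) + 2 * s) > 0" "1 + norm x powr (real DIM('a) + 2 * s) \<ge> 1"
    by linarith+
  then show "0 < weight s x" "weight s x \<le> 1"
    unfolding weight_def by (auto simp only: divide_le_eq_1_pos zero_less_divide_1_iff)
qed

lemma weight_measurable [measurable]: "weight s \<in> borel_measurable borel"
  unfolding weight_def by measurable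

lemma integrable_weight:
  assumes s: "0 < s" "s < 1"
  shows "integrable lborel (weight s :: 'a::euclidean_space \<Rightarrow> real)"
proof (rule integrable_dominated)
  show "integrable lborel (\<lambda>x::'a. indicator (ball 0 1) x + min 1 ((norm x)\<^sup>2) / norm x powr (real DIM('a) + 2 * s))"
    by (intro Bochner_Integration.integrable_add integrable_truncated_kernel[OF s])
       (use emeasure_lborel_ball_finite[of "0::'a" 1] in \<open>simp add: integrable_indicator_iff\<close>)
  fix x :: 'a
  show "\<bar>weight s x\<bar> \<le> indicator (ball 0 1) x + min 1 ((norm x)\<^sup>2) / norm x powr (real DIM('a) + 2 * s)"
  proof (cases "norm x < 1")
    case True
    have "\<bar>weight s x\<bar> \<le> 1" using weight_pos[of s x] weight_le_1[of s x] by simp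
    moreover have "0 \<le> min 1 ((norm x)\<^sup>2) / norm x powr (real DIM('a) + 2 * s)" by simp
    moreover have "indicator (ball 0 1) x = (1::real)" using True by simp
    ultimately show ?thesis by linarith
  next
    case False
    then have "min 1 ((norm x)\<^sup>2) = 1" by simp
    moreover have "norm x powr (real DIM('a) + 2 * s) > 0" using False by auto
    then have "weight s x \<le> 1 / norm x powr (real DIM('a) + 2 * s)"
      unfolding weight_def by (auto intro!: frac_le)
    ultimately show ?thesis using False weight_pos[of s x] by simp
  qed
qed measurable

lemma sq_integrable_weight:
  assumes s: "0 < s" "s < 1"
  shows "sq_integrable lborel (weight s :: 'a::euclidean_space \<Rightarrow> real)"
  unfolding sq_integrable_def
proof
  show "integrable lborel (\<lambda>x::'a. (weight s x)\<^sup>2)"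
  proof (rule integrable_dominated[OF integrable_weight[OF s]])
    fix x :: 'a
    show "\<bar>(weight s x)\<^sup>2\<bar> \<le> weight s x"
      using weight_pos[of s x] weight_le_1[of s x] mult_left_mono[of "weight s x" 1 "weight s x"]
      by (simp add: power2_eq_square)
  qed measurable
qed measurable

text \<open>The diagonal argument needs countably many bounded sequences; a countable dense set
  supplies a representative of every cell of every mesh.\<close>

lemma cell_averages_convergent_subseq:
  fixes u :: "nat \<Rightarrow> 'a::euclidean_space \<Rightarrow> real"
  assumes sq: "\<And>n. sq_integrable lborel (u n)" and n2: "\<And>n. (LINT x|lborel. (u n x)\<^sup>2) \<le> 1"
  shows "\<exists>r. strict_mono (r :: nat \<Rightarrow> nat) \<and> (\<forall>k x. convergent (\<lambda>n. average (cell (real (Suc k)) x) (u (r n))))"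
proof -
  obtain D :: "'a set" where D: "countable D" "\<And>X. open X \<Longrightarrow> X \<noteq> {} \<Longrightarrow> \<exists>d\<in>D. d \<in> X"
    by (erule countable_dense_setE)
  \<comment> \<open>Division by the bound of \<open>cell_average_bound\<close> makes the family
    bounded by 1 uniformly over all meshes.\<close>
  define f where "f n p = average (cell (real (Suc (fst p))) (snd p)) (u n) / real (Suc (fst p)) ^ DIM('a)"
    for n and p :: "nat \<times> 'a"
  have c: "countable (UNIV \<times> D :: (nat \<times> 'a) set)" using D(1) by auto
  have b: "norm (f n p) \<le> 1" for n p
    using cell_average_bound[OF sq[of n] _ n2[of n], of "real (Suc (fst p))" "snd p"]
    by (simp add: f_def abs_divide divide_le_eq_1)
  obtain r where r: "strict_mono (r :: nat \<Rightarrow> nat)" "\<And>p. p \<in> UNIV \<times> D \<Longrightarrow> \<exists>l. (\<lambda>n. f (r n) p) \<longlonglongrightarrow> l"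
    by (rule function_convergent_subsequence[OF c, of f 1, OF b]) (rule that)
  have "convergent (\<lambda>n. average (cell (real (Suc k)) x) (u (r n)))" for k x
  proof -
    have k: "real (Suc k) > 0" by simp
    obtain l h where "box l h \<noteq> {}" "box l h \<subseteq> cell (real (Suc k)) x" using cell_interior[OF k] by blast
    then obtain d where d: "d \<in> D" "d \<in> cell (real (Suc k)) x" using D(2)[of "box l h"] by (auto simp: open_box)
    obtain L where L: "(\<lambda>n. f (r n) (k, d)) \<longlonglongrightarrow> L" using r(2)[of "(k, d)"] d by auto
    have "(\<lambda>n. f (r n) (k, d) * real (Suc k) ^ DIM('a)) \<longlonglongrightarrow> L * real (Suc k) ^ DIM('a)"
      by (intro tendsto_mult_right L)
    moreover have "f (r n) (k, d) * real (Suc k) ^ DIM('a) = average (cell (real (Suc k)) x) (u (r n))" for n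
      unfolding f_def using cell_eq[OF d(2)] by simp
    ultimately have "(\<lambda>n. average (cell (real (Suc k)) x) (u (r n))) \<longlonglongrightarrow> L * real (Suc k) ^ DIM('a)"
      by (simp only:)
    then show ?thesis by (rule convergentI)
  qed
  then show ?thesis using r(1) by blast
qed

text \<open>The distance to the average over the cell of side \<open>1 / k\<close> is controlled by
  the Gagliardo seminorm, and the cell averages converge along a diagonal subsequence.\<close>
lemma compactness_AE:
  fixes u :: "nat \<Rightarrow> 'a::euclidean_space \<Rightarrow> real"
  assumes s: "0 < s" "s < 1" and u: "\<And>n. Hs s (u n)"
    and n2: "\<And>n. (LINT x|lborel. (u n x)\<^sup>2) \<le> 1" and g: "\<And>n. gagliardo s (u n) \<le> 1"
  shows "\<exists>r. strict_mono (r :: nat \<Rightarrow> nat) \<and> (AE x in lborel. convergent (\<lambda>n. u (r n) x))"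
proof -
  have sq: "sq_integrable lborel (u n)" for n using u by (simp add: Hs_iff)
  have um [measurable]: "u n \<in> borel_measurable borel" for n using u by auto
  obtain r where r: "strict_mono (r :: nat \<Rightarrow> nat)"
    and conv: "\<And>k x. convergent (\<lambda>n. average (cell (real (Suc k)) x) (u (r n)))"
    using cell_averages_convergent_subseq[of u, OF sq n2] by blast
  define v where "v n = u (r n)" for n
  have vH: "Hs s (v n)" and vsq: "sq_integrable lborel (v n)" and v2: "(LINT x|lborel. (v n x)\<^sup>2) \<le> 1"
    and vg: "gagliardo s (v n) \<le> 1" and vm [measurable]: "v n \<in> borel_measurable borel" for n
    using u sq n2 g um by (auto simp: v_def)
  define w :: "'a \<Rightarrow> real" where "w = weight s"
  have w [measurable]: "w \<in> borel_measurable borel" unfolding w_def by measurable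
  have w0: "0 < w x" for x unfolding w_def by (rule weight_pos)
  have wsq: "sq_integrable lborel w" and wi: "integrable lborel w"
    unfolding w_def by (rule sq_integrable_weight[OF s], rule integrable_weight[OF s])
  define P where "P k n x = average (cell (real (Suc k)) x) (v n)" for k n x
  have [measurable]: "P k n \<in> borel_measurable borel" for k n
    unfolding P_def using cell_average_measurable[OF vm] by simp
  have Pb: "\<bar>P k n x\<bar> \<le> real (Suc k) ^ DIM('a)" for k n x
    unfolding P_def by (rule cell_average_bound[OF vsq _ v2]) simp
  define p where "p k x = lim (\<lambda>n. P k n x)" for k x
  have Plim: "(\<lambda>n. P k n x) \<longlonglongrightarrow> p k x" for k x
    using conv[of k x] unfolding p_def P_def v_def by (simp add: convergent_LIMSEQ_iff)
  have [measurable]: "p k \<in> borel_measurable borel" for k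
    by (rule borel_measurable_LIMSEQ_real[OF Plim]) measurable
  have wP: "integrable lborel (\<lambda>x. w x * \<bar>P k n x - p k x\<bar>)"
    and aP: "(\<lambda>n. LINT x|lborel. w x * \<bar>P k n x - p k x\<bar>) \<longlonglongrightarrow> 0" for k n
  proof -
    have pb: "\<bar>p k x\<bar> \<le> real (Suc k) ^ DIM('a)" for x
      by (rule LIMSEQ_le_const2[OF tendsto_rabs[OF Plim]]) (use Pb in auto)
    have bd: "\<bar>w x * \<bar>P k n x - p k x\<bar>\<bar> \<le> 2 * real (Suc k) ^ DIM('a) * w x" for n x
    proof -
      have "\<bar>P k n x - p k x\<bar> \<le> 2 * real (Suc k) ^ DIM('a)" using Pb[of k n x] pb[of x] by linarith
      then show ?thesis using w0[of x] by (simp add: abs_mult mult.commute)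
    qed
    have bi: "integrable lborel (\<lambda>x. 2 * real (Suc k) ^ DIM('a) * w x)" using wi by simp
    show "integrable lborel (\<lambda>x. w x * \<bar>P k n x - p k x\<bar>)"
      by (rule integrable_dominated[OF bi _ bd]) measurable
    have "(\<lambda>n. LINT x|lborel. w x * \<bar>P k n x - p k x\<bar>) \<longlonglongrightarrow> (LINT x|(lborel :: 'a measure). 0)"
    proof (rule integral_dominated_convergence[OF _ _ bi])
      show "AE x in lborel. (\<lambda>n. w x * \<bar>P k n x - p k x\<bar>) \<longlonglongrightarrow> 0"
      proof (rule AE_I2)
        fix x
        have "(\<lambda>n. w x * \<bar>P k n x - p k x\<bar>) \<longlonglongrightarrow> w x * \<bar>p k x - p k x\<bar>"
          by (intro tendsto_intros Plim)
        then show "(\<lambda>n. w x * \<bar>P k n x - p k x\<bar>) \<longlonglongrightarrow> 0" by simp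
      qed
    qed (use bd in auto)
    then show "(\<lambda>n. LINT x|lborel. w x * \<bar>P k n x - p k x\<bar>) \<longlonglongrightarrow> 0" by simp
  qed
  define c where "c k = real DIM('a) powr (real DIM('a) + 2 * s) * real (Suc k) powr (- 2 * s)" for k :: nat
  have c0: "c k \<ge> 0" for k by (simp add: c_def)
  have clim: "c \<longlonglongrightarrow> 0"
  proof -
    have "(\<lambda>k. real (Suc k) powr (- 2 * s)) \<longlonglongrightarrow> 0"
      by (rule tendsto_neg_powr[OF _ filterlim_compose[OF filterlim_real_sequentially filterlim_Suc]]) (use s in simp)
    then show ?thesis unfolding c_def by (rule tendsto_mult_right_zero)
  qed
  \<comment> \<open>The energy density controls only the square of the deviation; Young's inequality
    trades the first power against the integrable \<open>(w x)\<^sup>2\<close>.\<close>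
  have dev: "AE x in lborel. w x * \<bar>v n x - P k n x\<bar> \<le> e * (w x)\<^sup>2 + (1 / e) * (c k * gag_density s (v n) x)"
    if e: "e > 0" for n k e
    using AE_integrable_dquot[OF vH[of n]]
  proof eventually_elim
    case (elim x)
    have "w x * \<bar>v n x - P k n x\<bar> \<le> e * (w x)\<^sup>2 + (1 / e) * (v n x - P k n x)\<^sup>2"
      using young_ineq[OF e, of "w x" "v n x - P k n x"] w0[of x] by (simp add: abs_mult)
    also have "\<dots> \<le> e * (w x)\<^sup>2 + (1 / e) * (c k * gag_density s (v n) x)"
      unfolding P_def c_def using e cell_average_deviation[OF vsq _ s(1) elim, of "real (Suc k)"]
      by (intro add_mono mult_left_mono) auto
    finally show ?case .
  qed
  define W where "W = (LINT x|lborel. (w x)\<^sup>2)"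
  have W0: "W \<ge> 0" unfolding W_def by simp
  \<comment> \<open>Triangle inequality through the cell averages \<open>P k n\<close> and their
    limit \<open>p k\<close>; the first two terms are uniform in \<open>n\<close> and
    \<open>m\<close>.\<close>
  have est: "(LINT x|lborel. norm (w x * v n x - w x * v m x)) \<le> 2 * e * W + 2 / e * c k
      + (LINT x|lborel. w x * \<bar>P k n x - p k x\<bar>) + (LINT x|lborel. w x * \<bar>P k m x - p k x\<bar>)"
    if e: "e > 0" for n m k e
  proof -
    define G where "G n x = e * (w x)\<^sup>2 + (1 / e) * (c k * gag_density s (v n) x)" for n x
    have Gi: "integrable lborel (G n)" for n
      unfolding G_def using sq_integrable_square[OF wsq] integrable_gag_density[OF vH] by simp
    have GI: "(LINT x|lborel. G n x) \<le> e * W + 1 / e * c k" for n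
    proof -
      have "(LINT x|lborel. G n x) = e * W + 1 / e * (c k * gagliardo s (v n))"
        unfolding G_def W_def using sq_integrable_square[OF wsq] integrable_gag_density[OF vH] integral_gag_density[OF vH] by simp
      also have "\<dots> \<le> e * W + 1 / e * (c k * 1)"
        using e c0 vg by (intro add_mono mult_left_mono) auto
      finally show ?thesis by simp
    qed
    have "(LINT x|lborel. norm (w x * v n x - w x * v m x))
      \<le> (LINT x|lborel. G n x + G m x + w x * \<bar>P k n x - p k x\<bar> + w x * \<bar>P k m x - p k x\<bar>)"
    proof (rule integral_mono_AE)
      show "integrable lborel (\<lambda>x. norm (w x * v n x - w x * v m x))"
        using sq_integrable_mult[OF wsq vsq[of n]] sq_integrable_mult[OF wsq vsq[of m]] by simp
      show "integrable lborel (\<lambda>x. G n x + G m x + w x * \<bar>P k n x - p k x\<bar> + w x * \<bar>P k m x - p k x\<bar>)"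
        using Gi wP by simp
      show "AE x in lborel. norm (w x * v n x - w x * v m x)
        \<le> G n x + G m x + w x * \<bar>P k n x - p k x\<bar> + w x * \<bar>P k m x - p k x\<bar>"
        using dev[OF e, of n k] dev[OF e, of m k]
      proof eventually_elim
        case (elim x)
        have "\<bar>v n x - v m x\<bar> \<le> \<bar>v n x - P k n x\<bar> + \<bar>v m x - P k m x\<bar> + \<bar>P k n x - p k x\<bar> + \<bar>P k m x - p k x\<bar>"
          by linarith
        then have "w x * \<bar>v n x - v m x\<bar> \<le>
          w x * (\<bar>v n x - P k n x\<bar> + \<bar>v m x - P k m x\<bar> + \<bar>P k n x - p k x\<bar> + \<bar>P k m x - p k x\<bar>)"
          using w0[of x] by (intro mult_left_mono) auto
        moreover have "norm (w x * v n x - w x * v m x) = w x * \<bar>v n x - v m x\<bar>"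
          using w0[of x] by (simp add: right_diff_distrib[symmetric] abs_mult)
        ultimately show ?case using elim unfolding G_def[symmetric] by (simp add: distrib_left)
      qed
    qed
    also have "\<dots> = (LINT x|lborel. G n x) + (LINT x|lborel. G m x) + (LINT x|lborel. w x * \<bar>P k n x - p k x\<bar>)
        + (LINT x|lborel. w x * \<bar>P k m x - p k x\<bar>)"
      using Gi wP by simp
    also have "\<dots> \<le> (e * W + 1 / e * c k) + (e * W + 1 / e * c k) + (LINT x|lborel. w x * \<bar>P k n x - p k x\<bar>)
        + (LINT x|lborel. w x * \<bar>P k m x - p k x\<bar>)"
      using GI by (intro add_mono) auto
    finally show ?thesis by (simp add: mult_ac)
  qed
  have cauchy: "\<exists>N. \<forall>i\<ge>N. \<forall>j\<ge>N. (LINT x|lborel. norm (w x * v i x - w x * v j x)) < \<epsilon>" if \<epsilon>: "\<epsilon> > 0" for \<epsilon> :: real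
  proof -
    \<comment> \<open>The order of choice matters: \<open>e\<close> controls the weight term, then
      \<open>k\<close> the energy term with its factor \<open>1 / e\<close>, and last
      \<open>N\<close> the convergence of the averages at mesh \<open>k\<close>.\<close>
    define e where "e = \<epsilon> / 8 / (W + 1)"
    have e: "e > 0" using \<epsilon> W0 by (simp add: e_def)
    have eW: "e * W + e = \<epsilon> / 8"
    proof -
      have "e * (W + 1) = \<epsilon> / 8" using W0 nonzero_eq_divide_eq[of "W + 1" e "\<epsilon> / 8"] e_def by auto
      then show ?thesis by (simp add: distrib_left)
    qed
    obtain k where k: "c k < \<epsilon> * e / 8"
      using LIMSEQ_D[OF clim, of "\<epsilon> * e / 8"] e \<epsilon> c0 by auto
    have ck: "2 / e * c k < \<epsilon> / 4"
      using k e by (simp add: field_simps)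
    obtain N where N: "\<And>n. n \<ge> N \<Longrightarrow> \<bar>LINT x|lborel. w x * \<bar>P k n x - p k x\<bar>\<bar> < \<epsilon> / 4"
      using LIMSEQ_D[OF aP[of k], of "\<epsilon> / 4"] \<epsilon> by auto
    show ?thesis
    proof (intro exI allI impI)
      fix i j assume ij: "i \<ge> N" "j \<ge> N"
      show "(LINT x|lborel. norm (w x * v i x - w x * v j x)) < \<epsilon>"
        using est[OF e, of i j k] N[OF ij(1)] N[OF ij(2)] ck eW e \<epsilon> by linarith
    qed
  qed
  \<comment> \<open>An L1 Cauchy sequence has a subsequence that is Cauchy almost everywhere; the
    positive weight is then divided out.\<close>
  obtain r' where r': "strict_mono r'" "AE x in lborel. Cauchy (\<lambda>i. w x * v (r' i) x)"
    using cauchy_L1_AE_cauchy_subseq[of lborel "\<lambda>n x. w x * v n x", OF sq_integrable_mult[OF wsq vsq] cauchy]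
    by blast
  have "AE x in lborel. convergent (\<lambda>n. u ((r \<circ> r') n) x)"
    using r'(2)
  proof eventually_elim
    case (elim x)
    then have "convergent (\<lambda>i. w x * v (r' i) x)" by (simp add: Cauchy_convergent_iff)
    then obtain L where "(\<lambda>i. w x * v (r' i) x) \<longlonglongrightarrow> L" by (auto simp: convergent_def)
    then have "(\<lambda>i. w x * v (r' i) x / w x) \<longlonglongrightarrow> L / w x" using w0[of x] by (intro tendsto_divide) auto
    then have "(\<lambda>i. v (r' i) x) \<longlonglongrightarrow> L / w x" using w0[of x] by simp
    then show ?case by (auto simp: convergent_def v_def)
  qed
  then show ?thesis using strict_mono_o[OF r r'(1)] by blast
qed

section \<open>Brezis--Lieb splitting\<close>

text \<open>The exceptional set need not be measurable, so it is first enlarged to a null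
  set.\<close>

lemma AE_fst_snd:
  assumes P: "AE x in lborel. P (x::'a::euclidean_space)"
  shows "AE z in lborel \<Otimes>\<^sub>M lborel. P (fst z) \<and> P (snd z)"
proof -
  obtain N where N: "{x. \<not> P x} \<subseteq> N" "N \<in> null_sets lborel"
    using P by (auto elim!: AE_E simp: null_sets_def)
  have [measurable]: "N \<in> sets borel" using N(2) by auto
  have n: "AE x in lborel. x \<notin> N" using N(2) by (rule AE_not_in)
  have "AE x in lborel. AE y in lborel. x \<notin> N \<and> y \<notin> N"
    using n
  proof eventually_elim
    case (elim x)
    then show ?case by (intro eventually_mono[OF n]) simp
  qed
  then have "AE z in lborel \<Otimes>\<^sub>M lborel. fst z \<notin> N \<and> snd z \<notin> N"
  proof (rule lborel_pair.AE_pair_iff[THEN iffD1, rotated])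
    show "{z \<in> space (lborel \<Otimes>\<^sub>M lborel). fst z \<notin> N \<and> snd z \<notin> N} \<in> sets (lborel \<Otimes>\<^sub>M lborel)"
      by measurable
  qed
  then show ?thesis by eventually_elim (use N(1) in auto)
qed

text \<open>Fatou's lemma for the squares.\<close>

lemma sq_integrable_limit:
  fixes f :: "nat \<Rightarrow> 'b \<Rightarrow> real"
  assumes f: "\<And>n. sq_integrable M (f n)" and g [measurable]: "g \<in> borel_measurable M"
    and lim: "AE x in M. (\<lambda>n. f n x) \<longlonglongrightarrow> g x" and K: "\<And>n. (\<integral>x. (f n x)\<^sup>2 \<partial>M) \<le> K"
  shows "sq_integrable M g"
proof -
  have [measurable]: "f n \<in> borel_measurable M" for n using f by (rule sq_integrable_measurable)
  have "(\<integral>\<^sup>+x. ennreal ((g x)\<^sup>2) \<partial>M) = (\<integral>\<^sup>+x. liminf (\<lambda>n. ennreal ((f n x)\<^sup>2)) \<partial>M)"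
  proof (rule nn_integral_cong_AE)
    show "AE x in M. ennreal ((g x)\<^sup>2) = liminf (\<lambda>n. ennreal ((f n x)\<^sup>2))"
      using lim
    proof eventually_elim
      case (elim x)
      have "(\<lambda>n. ennreal ((f n x)\<^sup>2)) \<longlonglongrightarrow> ennreal ((g x)\<^sup>2)"
        by (intro tendsto_ennrealI tendsto_power elim)
      from lim_imp_Liminf[OF sequentially_bot this] show ?case by simp
    qed
  qed
  also have "\<dots> \<le> liminf (\<lambda>n. \<integral>\<^sup>+x. ennreal ((f n x)\<^sup>2) \<partial>M)"
    by (rule nn_integral_liminf) measurable
  also have "\<dots> \<le> ennreal K"
  proof (rule Liminf_le)
    show "\<forall>\<^sub>F n in sequentially. (\<integral>\<^sup>+x. ennreal ((f n x)\<^sup>2) \<partial>M) \<le> ennreal K"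
    proof (rule always_eventually, rule allI)
      fix n
      have "(\<integral>\<^sup>+x. ennreal ((f n x)\<^sup>2) \<partial>M) = ennreal (\<integral>x. (f n x)\<^sup>2 \<partial>M)"
        using f[of n] by (intro nn_integral_eq_integral) (auto simp: sq_integrable_def)
      then show "(\<integral>\<^sup>+x. ennreal ((f n x)\<^sup>2) \<partial>M) \<le> ennreal K" using K[of n] by (simp add: ennreal_leI)
    qed
  qed simp
  finally have "(\<integral>\<^sup>+x. ennreal ((g x)\<^sup>2) \<partial>M) < \<infinity>" by (rule le_less_trans) simp
  then have "integrable M (\<lambda>x. (g x)\<^sup>2)" by (intro integrableI_bounded) auto
  then show ?thesis by (simp add: sq_integrable_def)
qed

lemma power2_diff_le: "((a::real) - b)\<^sup>2 \<le> 2 * (a\<^sup>2 + b\<^sup>2)"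
proof -
  have "2 * (a\<^sup>2 + b\<^sup>2) - (a - b)\<^sup>2 = (a + b)\<^sup>2" by (simp add: power2_eq_square algebra_simps)
  then show ?thesis using zero_le_power2[of "a + b"] by linarith
qed

text \<open>The difference of the two squares is
  \<open>2 * ((f n x - g x) * g x) + (g x)\<^sup>2\<close>. The cross term is a product with the
  fixed function \<open>g\<close>, so Young's inequality provides the domination that
  \<open>brezis_lieb_core\<close> asks for.\<close>

lemma brezis_lieb_square:
  fixes f :: "nat \<Rightarrow> 'b \<Rightarrow> real"
  assumes f: "\<And>n. sq_integrable M (f n)" and g: "sq_integrable M g"
    and lim: "AE x in M. (\<lambda>n. f n x) \<longlonglongrightarrow> g x" and K: "\<And>n. (\<integral>x. (f n x)\<^sup>2 \<partial>M) \<le> K"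
  shows "(\<lambda>n. (\<integral>x. (f n x)\<^sup>2 \<partial>M) - (\<integral>x. (f n x - g x)\<^sup>2 \<partial>M)) \<longlonglongrightarrow> (\<integral>x. (g x)\<^sup>2 \<partial>M)"
proof -
  have d: "sq_integrable M (\<lambda>x. f n x - g x)" for n by (rule sq_integrable_diff[OF f g])
  have dK: "(\<integral>x. (f n x - g x)\<^sup>2 \<partial>M) \<le> 2 * K + 2 * (\<integral>x. (g x)\<^sup>2 \<partial>M)" for n
  proof -
    have "(\<integral>x. (f n x - g x)\<^sup>2 \<partial>M) \<le> (\<integral>x. 2 * (f n x)\<^sup>2 + 2 * (g x)\<^sup>2 \<partial>M)"
    proof (rule integral_mono)
      show "(f n x - g x)\<^sup>2 \<le> 2 * (f n x)\<^sup>2 + 2 * (g x)\<^sup>2" for x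
        using power2_diff_le[of "f n x" "g x"] by simp
    qed (use d f g in \<open>auto simp: sq_integrable_def\<close>)
    also have "\<dots> = 2 * (\<integral>x. (f n x)\<^sup>2 \<partial>M) + 2 * (\<integral>x. (g x)\<^sup>2 \<partial>M)"
      using f g by (simp add: sq_integrable_def)
    finally show ?thesis using K[of n] by linarith
  qed
  have int: "integrable M (\<lambda>x. (f n x - g x) * g x)" for n by (rule sq_integrable_mult[OF d g])
  have "(\<lambda>n. \<integral>x. \<bar>(f n x - g x) * g x\<bar> \<partial>M) \<longlonglongrightarrow> 0"
  proof (rule brezis_lieb_core)
    show "(\<lambda>x. (f n x - g x) * g x) \<in> borel_measurable M" for n using int by auto
    show "AE x in M. (\<lambda>n. (f n x - g x) * g x) \<longlonglongrightarrow> 0"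
      using lim by eventually_elim (intro tendsto_mult_left_zero LIM_zero)
    show "\<exists>C. \<forall>n x. \<bar>(f n x - g x) * g x\<bar> \<le> e * (f n x - g x)\<^sup>2 + C * (g x)\<^sup>2" if "e > 0" for e
      using young_ineq[OF that] by blast
  qed (use d g dK in \<open>auto simp: sq_integrable_def\<close>)
  then have "(\<lambda>n. \<integral>x. (f n x - g x) * g x \<partial>M) \<longlonglongrightarrow> 0"
    by (rule Lim_null_comparison[rotated]) (auto intro!: always_eventually integral_abs_bound)
  then have "(\<lambda>n. 2 * (\<integral>x. (f n x - g x) * g x \<partial>M) + (\<integral>x. (g x)\<^sup>2 \<partial>M)) \<longlonglongrightarrow> 2 * 0 + (\<integral>x. (g x)\<^sup>2 \<partial>M)"
    by (intro tendsto_intros)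
  moreover have "(\<integral>x. (f n x)\<^sup>2 \<partial>M) - (\<integral>x. (f n x - g x)\<^sup>2 \<partial>M) = 2 * (\<integral>x. (f n x - g x) * g x \<partial>M) + (\<integral>x. (g x)\<^sup>2 \<partial>M)" for n
  proof -
    have "(\<integral>x. (f n x)\<^sup>2 \<partial>M) = (\<integral>x. (f n x - g x)\<^sup>2 + 2 * ((f n x - g x) * g x) + (g x)\<^sup>2 \<partial>M)"
      by (intro Bochner_Integration.integral_cong) (auto simp: power2_eq_square algebra_simps)
    also have "\<dots> = (\<integral>x. (f n x - g x)\<^sup>2 \<partial>M) + 2 * (\<integral>x. (f n x - g x) * g x \<partial>M) + (\<integral>x. (g x)\<^sup>2 \<partial>M)"
      using d[of n] g int[of n] by (simp add: sq_integrable_def)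
    finally show ?thesis by simp
  qed
  ultimately show ?thesis by simp
qed

text \<open>Every monomial left after cancellation contains a factor from \<open>p\<close>,
  \<open>r\<close> and one from \<open>q\<close>, \<open>t\<close>. By homogeneity, with
  \<open>A\<close> and \<open>B\<close> the larger absolute value in each group, such monomials are
  at most \<open>e * A^4\<close> if \<open>B \<le> e * A\<close>, and at most a multiple of
  \<open>B^4\<close> otherwise.\<close>

lemma quartic_difference_bound:
  fixes \<epsilon> :: real
  assumes \<epsilon>: "\<epsilon> > 0"
  shows "\<exists>C. \<forall>p q r t :: real. \<bar>(p + q)\<^sup>2 * (r + t)\<^sup>2 - p\<^sup>2 * r\<^sup>2 - q\<^sup>2 * t\<^sup>2\<bar> \<le> \<epsilon> * (p^4 + r^4) + C * (q^4 + t^4)"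
proof -
  \<comment> \<open>After bounding by \<open>A\<close> and \<open>B\<close> the mixed monomials have
    coefficients 4, 6 and 4, with sum 14. The cap 1 ensures \<open>B \<le> A\<close> in the first
    case and \<open>B \<le> B / e\<close> in the second.\<close>
  define e where "e = min 1 (\<epsilon> / 14)"
  have e: "0 < e" "e \<le> 1" "14 * e \<le> \<epsilon>" using \<epsilon> by (auto simp: e_def)
  have "\<bar>(p + q)\<^sup>2 * (r + t)\<^sup>2 - p\<^sup>2 * r\<^sup>2 - q\<^sup>2 * t\<^sup>2\<bar> \<le> \<epsilon> * (p^4 + r^4) + (14 / e^3) * (q^4 + t^4)" for p q r t :: real
  proof -
    define A where "A = max \<bar>p\<bar> \<bar>r\<bar>"
    define B where "B = max \<bar>q\<bar> \<bar>t\<bar>"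
    have AB: "0 \<le> A" "0 \<le> B" "\<bar>p\<bar> \<le> A" "\<bar>r\<bar> \<le> A" "\<bar>q\<bar> \<le> B" "\<bar>t\<bar> \<le> B" by (auto simp: A_def B_def)
    have A4: "A^4 \<le> p^4 + r^4" by (auto simp: A_def max_def)
    have B4: "B^4 \<le> q^4 + t^4" by (auto simp: B_def max_def)
    have m: "\<bar>a * b * c * d\<bar> \<le> a' * b' * c' * d'"
      if "\<bar>a\<bar> \<le> a'" "\<bar>b\<bar> \<le> b'" "\<bar>c\<bar> \<le> c'" "\<bar>d\<bar> \<le> d'" for a b c d a' b' c' d' :: real
      unfolding abs_mult using that by (intro mult_mono) auto
    have eq: "(p + q)\<^sup>2 * (r + t)\<^sup>2 - p\<^sup>2 * r\<^sup>2 - q\<^sup>2 * t\<^sup>2 =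
      2 * (p * p * r * t) + p * p * t * t + 2 * (p * q * r * r) + 4 * (p * q * r * t) + 2 * (p * q * t * t) + q * q * r * r + 2 * (q * q * r * t)"
      by (simp add: power2_eq_square algebra_simps)
    have "\<bar>(p + q)\<^sup>2 * (r + t)\<^sup>2 - p\<^sup>2 * r\<^sup>2 - q\<^sup>2 * t\<^sup>2\<bar> \<le>
      2 * (A * A * A * B) + A * A * B * B + 2 * (A * B * A * A) + 4 * (A * B * A * B) + 2 * (A * B * B * B) + B * B * A * A + 2 * (B * B * A * B)"
      unfolding eq
    proof (rule abs_leI)
      note bounds = m[OF AB(3,3,4,6), unfolded abs_le_iff] m[OF AB(3,3,6,6), unfolded abs_le_iff]
        m[OF AB(3,5,4,4), unfolded abs_le_iff] m[OF AB(3,5,4,6), unfolded abs_le_iff]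
        m[OF AB(3,5,6,6), unfolded abs_le_iff] m[OF AB(5,5,4,4), unfolded abs_le_iff]
        m[OF AB(5,5,4,6), unfolded abs_le_iff]
      show "2 * (p * p * r * t) + p * p * t * t + 2 * (p * q * r * r) + 4 * (p * q * r * t) + 2 * (p * q * t * t) + q * q * r * r + 2 * (q * q * r * t)
        \<le> 2 * (A * A * A * B) + A * A * B * B + 2 * (A * B * A * A) + 4 * (A * B * A * B) + 2 * (A * B * B * B) + B * B * A * A + 2 * (B * B * A * B)"
        using bounds by linarith
      show "- (2 * (p * p * r * t) + p * p * t * t + 2 * (p * q * r * r) + 4 * (p * q * r * t) + 2 * (p * q * t * t) + q * q * r * r + 2 * (q * q * r * t))
        \<le> 2 * (A * A * A * B) + A * A * B * B + 2 * (A * B * A * A) + 4 * (A * B * A * B) + 2 * (A * B * B * B) + B * B * A * A + 2 * (B * B * A * B)"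
        using bounds by linarith
    qed
    also have "\<dots> = 4 * (A^3 * B) + 6 * (A\<^sup>2 * B\<^sup>2) + 4 * (A * B^3)"
      by (simp add: power2_eq_square power3_eq_cube)
    also have "\<dots> \<le> \<epsilon> * A^4 + (14 / e^3) * B^4"
    proof (cases "B \<le> e * A")
      case True
      have BA: "B \<le> A" using True mult_right_mono[OF e(2) AB(1)] by simp
      have "A^3 * B \<le> A^3 * (e * A)" using True AB by (intro mult_left_mono) auto
      moreover have "A\<^sup>2 * B\<^sup>2 \<le> A^3 * (e * A)"
      proof -
        have "A\<^sup>2 * (B * B) \<le> A\<^sup>2 * (A * (e * A))" using True BA AB by (intro mult_left_mono mult_mono) auto
        then show ?thesis by (simp add: power2_eq_square power3_eq_cube mult_ac)
      qed
      moreover have "A * B^3 \<le> A^3 * (e * A)"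
      proof -
        have "A * (B * B * B) \<le> A * (A * A * (e * A))" using True BA AB by (intro mult_left_mono mult_mono) auto
        then show ?thesis by (simp add: power3_eq_cube mult_ac)
      qed
      ultimately have "4 * (A^3 * B) + 6 * (A\<^sup>2 * B\<^sup>2) + 4 * (A * B^3) \<le> 14 * (A^3 * (e * A))" by linarith
      also have "\<dots> = 14 * e * A^4" by (simp add: power3_eq_cube power4_eq_xxxx)
      also have "\<dots> \<le> \<epsilon> * A^4" using e by (intro mult_right_mono) auto
      finally show ?thesis using e AB by (simp add: add_increasing2)
    next
      case False
      define D where "D = B / e"
      have D: "A \<le> D" "B \<le> D" "0 \<le> D"
        using False e AB mult_left_mono[OF e(2) AB(2)] by (auto simp: D_def field_simps)
      have "A^3 * B \<le> D^3 * B" using D AB by (intro mult_right_mono power_mono) auto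
      moreover have "A\<^sup>2 * B\<^sup>2 \<le> D^3 * B"
      proof -
        have "(A * A) * (B * B) \<le> (D * D) * (D * B)" using D AB by (intro mult_mono) auto
        then show ?thesis by (simp add: power2_eq_square power3_eq_cube mult_ac)
      qed
      moreover have "A * B^3 \<le> D^3 * B"
      proof -
        have "A * (B * B * B) \<le> D * (D * D * B)" using D AB by (intro mult_mono) auto
        then show ?thesis by (simp add: power3_eq_cube mult_ac)
      qed
      ultimately have "4 * (A^3 * B) + 6 * (A\<^sup>2 * B\<^sup>2) + 4 * (A * B^3) \<le> 14 * (D^3 * B)" by linarith
      also have "\<dots> = (14 / e^3) * B^4"
        by (simp add: D_def power_divide power3_eq_cube power4_eq_xxxx)
      finally show ?thesis using \<epsilon> by (simp add: add_increasing)
    qed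
    also have "\<dots> \<le> \<epsilon> * (p^4 + r^4) + (14 / e^3) * (q^4 + t^4)"
      using A4 B4 \<epsilon> e by (intro add_mono mult_left_mono) auto
    finally show ?thesis .
  qed
  then show ?thesis by blast
qed

lemma power4_diff_le: "((a::real) - b)^4 \<le> 8 * (a^4 + b^4)"
proof -
  have "(a - b)\<^sup>2 \<le> 2 * (a\<^sup>2 + b\<^sup>2)" by (rule power2_diff_le)
  then have "((a - b)\<^sup>2)\<^sup>2 \<le> (2 * (a\<^sup>2 + b\<^sup>2))\<^sup>2" by (intro power_mono) auto
  also have "\<dots> = 8 * ((a\<^sup>2)\<^sup>2 + (b\<^sup>2)\<^sup>2) - 4 * (a\<^sup>2 - b\<^sup>2)\<^sup>2"
    by (simp only: power2_eq_square) (simp add: algebra_simps)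
  also have "\<dots> \<le> 8 * ((a\<^sup>2)\<^sup>2 + (b\<^sup>2)\<^sup>2)" by simp
  finally show ?thesis by simp
qed

section \<open>Functions with integrable fourth power\<close>

definition int4 :: "('a::euclidean_space \<Rightarrow> real) \<Rightarrow> bool" where
  "int4 u \<longleftrightarrow> u \<in> borel_measurable borel \<and> integrable lborel (\<lambda>x. (u x)^4)"

lemma int4_measurable [measurable_dest]: "int4 u \<Longrightarrow> u \<in> borel_measurable borel"
  by (simp add: int4_def)

lemma int4_sq_integrable_mult:
  assumes u: "int4 u" and v: "int4 v"
  shows "sq_integrable lborel (\<lambda>x. u x * v x)"
proof -
  have [measurable]: "u \<in> borel_measurable borel" "v \<in> borel_measurable borel" using u v by auto
  have "sq_integrable lborel (\<lambda>x. (u x)\<^sup>2)" "sq_integrable lborel (\<lambda>x. (v x)\<^sup>2)"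
    using u v by (auto simp: sq_integrable_def int4_def)
  from sq_integrable_mult[OF this] show ?thesis by (simp add: sq_integrable_def power_mult_distrib)
qed

lemma int4_integrable_mult:
  assumes "int4 a" "int4 b" "int4 c" "int4 d"
  shows "integrable lborel (\<lambda>x. a x * b x * (c x * d x))"
  by (rule sq_integrable_mult[OF int4_sq_integrable_mult[OF assms(1,2)] int4_sq_integrable_mult[OF assms(3,4)]])

lemma int4_integrable_square_mult:
  assumes "int4 u" "int4 v"
  shows "integrable lborel (\<lambda>x. (u x)\<^sup>2 * (v x)\<^sup>2)"
  using int4_integrable_mult[OF assms(1,1,2,2)] by (simp add: power2_eq_square)

lemma int4_diff:
  assumes u: "int4 u" and v: "int4 v"
  shows "int4 (\<lambda>x. u x - v x)"
  unfolding int4_def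
proof
  have [measurable]: "u \<in> borel_measurable borel" "v \<in> borel_measurable borel" using u v by auto
  show "(\<lambda>x. u x - v x) \<in> borel_measurable borel" by measurable
  show "integrable lborel (\<lambda>x. (u x - v x)^4)"
  proof (rule integrable_dominated[where f="\<lambda>x. 8 * ((u x)^4 + (v x)^4)"])
    show "\<bar>(u x - v x)^4\<bar> \<le> 8 * ((u x)^4 + (v x)^4)" for x
      using power4_diff_le[of "u x" "v x"] by simp
  qed (use u v in \<open>auto simp: int4_def\<close>)
qed

text \<open>Applying \<open>brezis_lieb_square\<close> to the products would subtract
  \<open>f n x * g n x - u x * v x\<close>, whereas the remainder needed here is the product of the
  two differences; hence the separate algebraic bound.\<close>

lemma brezis_lieb_quartic:
  fixes f g :: "nat \<Rightarrow> 'a::euclidean_space \<Rightarrow> real"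
  assumes f: "\<And>n. int4 (f n)" and g: "\<And>n. int4 (g n)" and u: "int4 u" and v: "int4 v"
    and flim: "AE x in lborel. (\<lambda>n. f n x) \<longlonglongrightarrow> u x" and glim: "AE x in lborel. (\<lambda>n. g n x) \<longlonglongrightarrow> v x"
    and fK: "\<And>n. (LINT x|lborel. (f n x)^4) \<le> K" and gK: "\<And>n. (LINT x|lborel. (g n x)^4) \<le> K"
  shows "(\<lambda>n. (LINT x|lborel. (f n x)\<^sup>2 * (g n x)\<^sup>2) - (LINT x|lborel. (f n x - u x)\<^sup>2 * (g n x - v x)\<^sup>2))
     \<longlonglongrightarrow> (LINT x|lborel. (u x)\<^sup>2 * (v x)\<^sup>2)"
proof -
  have df: "int4 (\<lambda>x. f n x - u x)" and dg: "int4 (\<lambda>x. g n x - v x)" for n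
    by (rule int4_diff[OF f u], rule int4_diff[OF g v])
  define G where "G n x = (f n x)\<^sup>2 * (g n x)\<^sup>2 - (f n x - u x)\<^sup>2 * (g n x - v x)\<^sup>2 - (u x)\<^sup>2 * (v x)\<^sup>2" for n x
  have Gi: "integrable lborel (G n)" for n
    unfolding G_def
    using int4_integrable_square_mult[OF f g] int4_integrable_square_mult[OF df dg] int4_integrable_square_mult[OF u v] by simp
  have dK: "(LINT x|lborel. (a x - b x)^4) \<le> 8 * (K + (LINT x|lborel. (b x)^4))"
    if a: "int4 a" and b: "int4 b" and aK: "(LINT x|lborel. (a x)^4) \<le> K" for a b :: "'a \<Rightarrow> real"
  proof -
    have "(LINT x|lborel. (a x - b x)^4) \<le> (LINT x|lborel. 8 * ((a x)^4 + (b x)^4))"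
      using int4_diff[OF a b] a b power4_diff_le by (intro integral_mono) (auto simp: int4_def)
    also have "\<dots> = 8 * ((LINT x|lborel. (a x)^4) + (LINT x|lborel. (b x)^4))"
      using a b by (simp add: int4_def)
    finally show ?thesis using aK by simp
  qed
  have "(\<lambda>n. LINT x|lborel. \<bar>G n x\<bar>) \<longlonglongrightarrow> 0"
  proof (rule brezis_lieb_core[where h="\<lambda>n x. (f n x - u x)^4 + (g n x - v x)^4" and k="\<lambda>x. (u x)^4 + (v x)^4"])
    show "G n \<in> borel_measurable lborel" for n using Gi by auto
    show "AE x in lborel. (\<lambda>n. G n x) \<longlonglongrightarrow> 0"
      using flim glim
    proof eventually_elim
      case (elim x)
      have "(\<lambda>n. G n x) \<longlonglongrightarrow> (u x)\<^sup>2 * (v x)\<^sup>2 - (u x - u x)\<^sup>2 * (v x - v x)\<^sup>2 - (u x)\<^sup>2 * (v x)\<^sup>2"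
        unfolding G_def by (intro tendsto_intros elim)
      then show ?case by simp
    qed
    show "integrable lborel (\<lambda>x. (u x)^4 + (v x)^4)" using u v by (simp add: int4_def)
    show "integrable lborel (\<lambda>x. (f n x - u x)^4 + (g n x - v x)^4)" for n using df dg by (simp add: int4_def)
    show "(LINT x|lborel. (f n x - u x)^4 + (g n x - v x)^4) \<le>
       8 * (K + (LINT x|lborel. (u x)^4)) + 8 * (K + (LINT x|lborel. (v x)^4))" for n
      using dK[OF f u fK, of n] dK[OF g v gK, of n] df dg by (simp add: int4_def)
    fix e :: real assume "e > 0"
    from quartic_difference_bound[OF this] obtain C where C: "\<And>p q r t :: real.
      \<bar>(p + q)\<^sup>2 * (r + t)\<^sup>2 - p\<^sup>2 * r\<^sup>2 - q\<^sup>2 * t\<^sup>2\<bar> \<le> e * (p^4 + r^4) + C * (q^4 + t^4)" by blast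
    show "\<exists>C. \<forall>n x. \<bar>G n x\<bar> \<le> e * ((f n x - u x)^4 + (g n x - v x)^4) + C * ((u x)^4 + (v x)^4)"
    proof (intro exI allI)
      fix n x
      show "\<bar>G n x\<bar> \<le> e * ((f n x - u x)^4 + (g n x - v x)^4) + C * ((u x)^4 + (v x)^4)"
        using C[of "f n x - u x" "u x" "g n x - v x" "v x"] unfolding G_def diff_add_cancel .
    qed
  qed auto
  then have "(\<lambda>n. LINT x|lborel. G n x) \<longlonglongrightarrow> 0"
    by (rule Lim_null_comparison[rotated]) (auto intro!: always_eventually integral_abs_bound)
  then have "(\<lambda>n. (LINT x|lborel. G n x) + (LINT x|lborel. (u x)\<^sup>2 * (v x)\<^sup>2)) \<longlonglongrightarrow> 0 + (LINT x|lborel. (u x)\<^sup>2 * (v x)\<^sup>2)"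
    by (intro tendsto_intros)
  moreover have "(LINT x|lborel. G n x) = (LINT x|lborel. (f n x)\<^sup>2 * (g n x)\<^sup>2) - (LINT x|lborel. (f n x - u x)\<^sup>2 * (g n x - v x)\<^sup>2)
     - (LINT x|lborel. (u x)\<^sup>2 * (v x)\<^sup>2)" for n
    unfolding G_def
    using int4_integrable_square_mult[OF f[of n] g[of n]] int4_integrable_square_mult[OF df[of n] dg[of n]] int4_integrable_square_mult[OF u v] by simp
  ultimately show ?thesis by simp
qed

text \<open>Homogeneity: \<open>u\<close> is divided by \<open>sqrt t\<close>. The common bound
  \<open>t\<close> stands in for a norm, and the degenerate case of norm 0 is left to
  \<open>L4_bound\<close>.\<close>

lemma sobolev_scaled:
  assumes s: "0 < s" "real DIM('a::euclidean_space) / 4 < s"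
  shows "\<exists>C>0. \<forall>(u::'a \<Rightarrow> real) t. Hs s u \<longrightarrow> t > 0 \<longrightarrow> (LINT x|lborel. (u x)\<^sup>2) \<le> t \<longrightarrow> gagliardo s u \<le> t \<longrightarrow>
     int4 u \<and> (LINT x|lborel. (u x)^4) \<le> C * t\<^sup>2"
proof -
  obtain C where C: "C > 0" and emb: "\<And>u::'a \<Rightarrow> real. Hs s u \<Longrightarrow> (LINT x|lborel. (u x)\<^sup>2) \<le> 1 \<Longrightarrow> gagliardo s u \<le> 1 \<Longrightarrow>
     integrable lborel (\<lambda>x. (u x)^4) \<and> (LINT x|lborel. (u x)^4) \<le> C"
    using sobolev_embedding[where 'a='a, OF s] by blast
  have "int4 u \<and> (LINT x|lborel. (u x)^4) \<le> C * t\<^sup>2"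
    if u: "Hs s u" and t: "t > 0" and n2: "(LINT x|lborel. (u x)\<^sup>2) \<le> t" and g: "gagliardo s u \<le> t"
    for u :: "'a \<Rightarrow> real" and t
  proof -
    define c where "c = 1 / sqrt t"
    have c2: "c\<^sup>2 = 1 / t" using t by (simp add: c_def power_divide)
    have "c^4 = (c\<^sup>2)\<^sup>2" by simp
    then have c4: "c^4 = 1 / t\<^sup>2" by (simp only: c2 power_divide power_one)
    have "integrable lborel (\<lambda>x. (c * u x)^4) \<and> (LINT x|lborel. (c * u x)^4) \<le> C"
      using n2 g t by (intro emb Hs_cmult u) (auto simp: power_mult_distrib c2 gagliardo_cmult)
    then have "integrable lborel (\<lambda>x. 1 / t\<^sup>2 * (u x)^4)" "1 / t\<^sup>2 * (LINT x|lborel. (u x)^4) \<le> C"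
      by (auto simp only: power_mult_distrib c4 integral_mult_right_zero)
    moreover have "(\<lambda>x. t\<^sup>2 * (1 / t\<^sup>2 * (u x)^4)) = (\<lambda>x. (u x)^4)" using t by auto
    ultimately have "integrable lborel (\<lambda>x. (u x)^4)"
      using Bochner_Integration.integrable_mult_right[of "t\<^sup>2" lborel "\<lambda>x. 1 / t\<^sup>2 * (u x)^4"] by simp
    moreover have "(LINT x|lborel. (u x)^4) \<le> C * t\<^sup>2"
      using \<open>1 / t\<^sup>2 * (LINT x|lborel. (u x)^4) \<le> C\<close> t by (simp add: field_simps)
    ultimately show ?thesis using u by (simp add: int4_def Hs_measurable)
  qed
  then show ?thesis using C by blast
qed

section \<open>The constrained maximum\<close>

text \<open>The parameter \<open>E\<close> carries the type of the domain into the locale, since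
  none of the other parameters mentions it.\<close>

locale coupled_system =
  fixes E :: "'a::euclidean_space itself" and s :: real and lam mu :: "nat \<Rightarrow> real"
    and beta :: "nat \<Rightarrow> nat \<Rightarrow> real"
  assumes dim_s: "real DIM('a) / 4 < s" and s_less_1: "s < 1"
    and lam_pos: "\<And>j. j \<in> {1..3} \<Longrightarrow> 0 < lam j" and mu_pos: "\<And>j. j \<in> {1..3} \<Longrightarrow> 0 < mu j"
    and beta_sym: "\<And>i j. i \<in> {1..3} \<Longrightarrow> j \<in> {1..3} \<Longrightarrow> i \<noteq> j \<Longrightarrow> beta i j = beta j i"
begin

lemma s_pos: "0 < s"
  using dim_s by (rule le_less_trans[rotated]) simp

definition coef :: "nat \<Rightarrow> nat \<Rightarrow> real" where
  "coef i j = (if i = j then mu i else beta i j)"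

definition Hs3 :: "(nat \<Rightarrow> 'a \<Rightarrow> real) \<Rightarrow> bool" where
  "Hs3 u \<longleftrightarrow> (\<forall>j\<in>{1..3}. Hs s (u j))"

definition nrm :: "(nat \<Rightarrow> 'a \<Rightarrow> real) \<Rightarrow> real" where
  "nrm u = (\<Sum>j\<in>{1..3}. jnorm2 s (lam j) (u j))"

text \<open>All ordered pairs are summed, so each coupling appears twice and each
  \<open>mu j\<close> once; with the factor 1/4 this matches both quartic terms of
  \<open>Phi\<close>.\<close>

definition quart :: "(nat \<Rightarrow> 'a \<Rightarrow> real) \<Rightarrow> real" where
  "quart u = (\<Sum>i\<in>{1..3}. \<Sum>j\<in>{1..3}. coef i j * (LINT x|lborel. (u i x)\<^sup>2 * (u j x)\<^sup>2))"

definition gconst :: real where "gconst = frac_const TYPE('a) s / 2"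

lemma gconst_pos: "0 < gconst"
  using frac_const_pos[where 'a='a, OF s_pos s_less_1] by (simp add: gconst_def)

lemma jnorm2_eq: "jnorm2 s l u = gconst * gagliardo s u + l * (LINT x|lborel. (u x)\<^sup>2)" for u :: "'a \<Rightarrow> real"
  by (simp add: jnorm2_def sform_self gconst_def)

lemma jnorm2_nonneg: "j \<in> {1..3} \<Longrightarrow> 0 \<le> jnorm2 s (lam j) u" for u :: "'a \<Rightarrow> real"
  unfolding jnorm2_eq using gconst_pos lam_pos[of j] gagliardo_nonneg[of s u]
  by (intro add_nonneg_nonneg mult_nonneg_nonneg) auto

lemma nrm_nonneg: "0 \<le> nrm u"
  unfolding nrm_def by (intro sum_nonneg jnorm2_nonneg)

lemma jnorm2_le_nrm: "j \<in> {1..3} \<Longrightarrow> jnorm2 s (lam j) (u j) \<le> nrm u"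
  unfolding nrm_def by (intro member_le_sum jnorm2_nonneg) auto

lemma jnorm2_cmult: "jnorm2 s l (\<lambda>x. c * u x) = c\<^sup>2 * jnorm2 s l u" for u :: "'a \<Rightarrow> real"
  by (simp add: jnorm2_eq gagliardo_cmult power_mult_distrib algebra_simps)

lemma nrm_cmult: "nrm (\<lambda>j x. c * u j x) = c\<^sup>2 * nrm u"
  by (simp add: nrm_def jnorm2_cmult sum_distrib_left)

lemma quart_cmult: "quart (\<lambda>j x. c * u j x) = c^4 * quart u"
proof -
  have "(c * a)\<^sup>2 * (c * b)\<^sup>2 = c^4 * (a\<^sup>2 * b\<^sup>2)" for a b :: real
    by (simp add: power_mult_distrib power2_eq_square power4_eq_xxxx)
  then show ?thesis
    by (simp only: quart_def integral_mult_right_zero sum_distrib_left mult.left_commute)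
qed

lemma Hs3_cmult: "Hs3 u \<Longrightarrow> Hs3 (\<lambda>j x. c * u j x)"
  by (simp add: Hs3_def Hs_cmult)

lemma Hs3_diff: "Hs3 u \<Longrightarrow> Hs3 v \<Longrightarrow> Hs3 (\<lambda>j x. u j x - v j x)"
  by (simp add: Hs3_def Hs_diff)

lemma Hs3D: "Hs3 u \<Longrightarrow> j \<in> {1..3} \<Longrightarrow> Hs s (u j)"
  by (simp add: Hs3_def)

text \<open>A crude common constant: the sum dominates each of its terms, so one factor bounds both
  the L2 part and the Gagliardo energy by \<open>jnorm2\<close>, for every component.\<close>

definition nconst :: real where "nconst = 1 / gconst + (\<Sum>j\<in>{1..3}. 1 / lam j)"

lemma nconst_pos: "0 < nconst"
  unfolding nconst_def using gconst_pos lam_pos by (intro add_pos_nonneg sum_nonneg) (auto simp: less_imp_le)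

lemma
  fixes u :: "'a \<Rightarrow> real"
  assumes j: "j \<in> {1..3}"
  shows L2_le_jnorm2: "(LINT x|lborel. (u x)\<^sup>2) \<le> nconst * jnorm2 s (lam j) u"
    and gagliardo_le_jnorm2: "gagliardo s u \<le> nconst * jnorm2 s (lam j) u"
proof -
  have l: "0 < lam j" by (rule lam_pos[OF j])
  have "1 / lam j \<le> (\<Sum>j\<in>{1..3}. 1 / lam j)"
    using j lam_pos by (intro member_le_sum) (auto simp: less_imp_le)
  moreover have "0 \<le> 1 / lam j" "0 \<le> 1 / gconst" using l gconst_pos by auto
  ultimately have K: "1 / lam j \<le> nconst" "1 / gconst \<le> nconst"
    unfolding nconst_def by linarith+
  have n0: "0 \<le> jnorm2 s (lam j) u" by (rule jnorm2_nonneg[OF j])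
  have a: "lam j * (LINT x|lborel. (u x)\<^sup>2) \<le> jnorm2 s (lam j) u"
    unfolding jnorm2_eq using gconst_pos gagliardo_nonneg[of s u] by simp
  have b: "gconst * gagliardo s u \<le> jnorm2 s (lam j) u"
    unfolding jnorm2_eq using l by simp
  have "(LINT x|lborel. (u x)\<^sup>2) \<le> 1 / lam j * jnorm2 s (lam j) u" using a l by (simp add: field_simps)
  also have "\<dots> \<le> nconst * jnorm2 s (lam j) u" by (rule mult_right_mono[OF K(1) n0])
  finally show "(LINT x|lborel. (u x)\<^sup>2) \<le> nconst * jnorm2 s (lam j) u" .
  have "gagliardo s u \<le> 1 / gconst * jnorm2 s (lam j) u" using b gconst_pos by (simp add: field_simps)
  also have "\<dots> \<le> nconst * jnorm2 s (lam j) u" by (rule mult_right_mono[OF K(2) n0])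
  finally show "gagliardo s u \<le> nconst * jnorm2 s (lam j) u" .
qed

lemma Hs_int4: "Hs s u \<Longrightarrow> int4 u" for u :: "'a \<Rightarrow> real"
proof -
  assume u: "Hs s u"
  obtain C where C: "\<And>(u::'a \<Rightarrow> real) t. Hs s u \<Longrightarrow> t > 0 \<Longrightarrow> (LINT x|lborel. (u x)\<^sup>2) \<le> t \<Longrightarrow> gagliardo s u \<le> t \<Longrightarrow>
     int4 u \<and> (LINT x|lborel. (u x)^4) \<le> C * t\<^sup>2"
    using sobolev_scaled[where 'a='a, OF s_pos dim_s] by blast
  \<comment> \<open>The added 1 provides the strict positivity that \<open>sobolev_scaled\<close>
    requires.\<close>
  define t where "t = (LINT x|lborel. (u x)\<^sup>2) + gagliardo s u + 1"
  have "0 \<le> (LINT x|lborel. (u x)\<^sup>2)" by (intro Bochner_Integration.integral_nonneg) simp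
  then have "t > 0" "(LINT x|lborel. (u x)\<^sup>2) \<le> t" "gagliardo s u \<le> t"
    using gagliardo_nonneg[of s u] unfolding t_def by linarith+
  then show ?thesis using C[OF u] by blast
qed

lemma Hs3_int4: "Hs3 u \<Longrightarrow> j \<in> {1..3} \<Longrightarrow> int4 (u j)"
  by (simp add: Hs3_def Hs_int4)

lemma jnorm2_eq_0_imp: "Hs s u \<Longrightarrow> j \<in> {1..3} \<Longrightarrow> jnorm2 s (lam j) u = 0 \<Longrightarrow> AE x in lborel. u x = 0"
  for u :: "'a \<Rightarrow> real"
proof -
  assume u: "Hs s u" and j: "j \<in> {1..3}" and 0: "jnorm2 s (lam j) u = 0"
  have "(LINT x|lborel. (u x)\<^sup>2) \<le> 0" using L2_le_jnorm2[OF j, of u] 0 by simp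
  then have "(LINT x|lborel. (u x)\<^sup>2) = 0" by (simp add: order_antisym)
  then show ?thesis
    by (subst (asm) integral_nonneg_eq_0_iff_AE) (use u in \<open>auto simp: Hs_def\<close>)
qed

lemma nrm_eq_0_imp: "Hs3 u \<Longrightarrow> nrm u = 0 \<Longrightarrow> j \<in> {1..3} \<Longrightarrow> AE x in lborel. u j x = 0"
  using jnorm2_le_nrm[of j u] jnorm2_nonneg[of j "u j"] by (intro jnorm2_eq_0_imp) (auto simp: Hs3_def)

lemma L4_bound: "\<exists>C>0. \<forall>j\<in>{1..3}. \<forall>u::'a \<Rightarrow> real. Hs s u \<longrightarrow> (LINT x|lborel. (u x)^4) \<le> C * (jnorm2 s (lam j) u)\<^sup>2"
proof -
  obtain C where C: "C > 0" "\<And>(u::'a \<Rightarrow> real) t. Hs s u \<Longrightarrow> t > 0 \<Longrightarrow> (LINT x|lborel. (u x)\<^sup>2) \<le> t \<Longrightarrow> gagliardo s u \<le> t \<Longrightarrow>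
     int4 u \<and> (LINT x|lborel. (u x)^4) \<le> C * t\<^sup>2"
    using sobolev_scaled[where 'a='a, OF s_pos dim_s] by blast
  have "(LINT x|lborel. (u x)^4) \<le> (C * nconst\<^sup>2) * (jnorm2 s (lam j) u)\<^sup>2"
    if j: "j \<in> {1..3}" and u: "Hs s u" for j and u :: "'a \<Rightarrow> real"
  proof (cases "jnorm2 s (lam j) u = 0")
    case True
    then have "AE x in lborel. u x = 0" by (rule jnorm2_eq_0_imp[OF u j])
    then have "(LINT x|lborel. (u x)^4) = 0"
      by (intro integral_eq_zero_AE) (auto elim: eventually_mono)
    then show ?thesis using True by simp
  next
    case False
    then have "0 < nconst * jnorm2 s (lam j) u"
      using jnorm2_nonneg[OF j, of u] nconst_pos by (simp add: less_le)
    then show ?thesis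
      using C(2)[OF u _ L2_le_jnorm2[OF j] gagliardo_le_jnorm2[OF j]] by (simp add: power_mult_distrib mult.assoc)
  qed
  then show ?thesis using C(1) nconst_pos by (intro exI[of _ "C * nconst\<^sup>2"]) auto
qed

lemma mixed_le:
  assumes u: "int4 u" and v: "int4 v"
  shows "0 \<le> (LINT x|lborel. (u x)\<^sup>2 * (v x)\<^sup>2)"
    and "(LINT x|lborel. (u x)\<^sup>2 * (v x)\<^sup>2) \<le> (LINT x|lborel. (u x)^4) + (LINT x|lborel. (v x)^4)"
proof -
  show "0 \<le> (LINT x|lborel. (u x)\<^sup>2 * (v x)\<^sup>2)" by (intro Bochner_Integration.integral_nonneg) simp
  have "(LINT x|lborel. (u x)\<^sup>2 * (v x)\<^sup>2) \<le> (LINT x|lborel. (u x)^4 + (v x)^4)"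
  proof (rule integral_mono[OF int4_integrable_square_mult[OF u v]])
    show "integrable lborel (\<lambda>x. (u x)^4 + (v x)^4)" using u v by (simp add: int4_def)
    show "(u x)\<^sup>2 * (v x)\<^sup>2 \<le> (u x)^4 + (v x)^4" for x
      using young_ineq[of 1 "(u x)\<^sup>2" "(v x)\<^sup>2"] by simp
  qed
  then show "(LINT x|lborel. (u x)\<^sup>2 * (v x)\<^sup>2) \<le> (LINT x|lborel. (u x)^4) + (LINT x|lborel. (v x)^4)"
    using u v by (simp add: int4_def)
qed

definition bsum :: real where "bsum = (\<Sum>i\<in>{1..3}. \<Sum>j\<in>{1..3}. \<bar>coef i j\<bar>)"

lemma bsum_nonneg: "0 \<le> bsum"
  unfolding bsum_def by (intro sum_nonneg) auto

text \<open>Absolute values of the coefficients absorb couplings of either sign. With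
  \<open>T = 0\<close> it shows that a trivial vector has no positive quartic part; with small
  \<open>T\<close> it forces some component to be substantial.\<close>

lemma quart_le_L4:
  assumes u: "Hs3 u" and T: "\<And>j. j \<in> {1..3} \<Longrightarrow> (LINT x|lborel. (u j x)^4) \<le> T"
  shows "quart u \<le> bsum * (2 * T)"
proof -
  have "coef i j * (LINT x|lborel. (u i x)\<^sup>2 * (u j x)\<^sup>2) \<le> \<bar>coef i j\<bar> * (2 * T)"
    if ij: "i \<in> {1..3}" "j \<in> {1..3}" for i j
  proof -
    note m = mixed_le[OF Hs3_int4[OF u ij(1)] Hs3_int4[OF u ij(2)]]
    have "coef i j * (LINT x|lborel. (u i x)\<^sup>2 * (u j x)\<^sup>2) \<le> \<bar>coef i j\<bar> * (LINT x|lborel. (u i x)\<^sup>2 * (u j x)\<^sup>2)"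
      using m(1) by (intro mult_right_mono) auto
    also have "\<dots> \<le> \<bar>coef i j\<bar> * (2 * T)"
      using m(2) T[OF ij(1)] T[OF ij(2)] by (intro mult_left_mono) auto
    finally show ?thesis .
  qed
  then have "quart u \<le> (\<Sum>i\<in>{1..3}. \<Sum>j\<in>{1..3}. \<bar>coef i j\<bar> * (2 * T))"
    unfolding quart_def by (intro sum_mono)
  then show ?thesis by (simp only: bsum_def sum_distrib_right)
qed

lemma quart_bounded: "\<exists>C. \<forall>u. Hs3 u \<longrightarrow> nrm u \<le> 1 \<longrightarrow> quart u \<le> C"
proof -
  obtain C where C: "C > 0" "\<And>j (u::'a \<Rightarrow> real). j \<in> {1..3} \<Longrightarrow> Hs s u \<Longrightarrow> (LINT x|lborel. (u x)^4) \<le> C * (jnorm2 s (lam j) u)\<^sup>2"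
    using L4_bound by blast
  have "quart u \<le> bsum * (2 * C)" if u: "Hs3 u" "nrm u \<le> 1" for u
  proof (rule quart_le_L4[OF u(1)])
    fix j :: nat assume j: "j \<in> {1..3}"
    have "(LINT x|lborel. (u j x)^4) \<le> C * (jnorm2 s (lam j) (u j))\<^sup>2" by (rule C(2)[OF j Hs3D[OF u(1) j]])
    also have "\<dots> \<le> C * 1"
      using C(1) jnorm2_nonneg[OF j] jnorm2_le_nrm[OF j, of u] u(2) by (intro mult_left_mono power_le_one) auto
    finally show "(LINT x|lborel. (u j x)^4) \<le> C" by simp
  qed
  then show ?thesis by blast
qed

text \<open>The ball \<open>nrm u \<le> 1\<close> rather than the sphere: it contains the zero
  vector, and rearrangements are only known to respect the inequality. Homogeneity and
  \<open>Smax_pos\<close> then push maximisers to the sphere.\<close>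

definition Smax :: real where "Smax = Sup {quart u | u. Hs3 u \<and> nrm u \<le> 1}"

lemma quart_le_Smax1: "Hs3 u \<Longrightarrow> nrm u \<le> 1 \<Longrightarrow> quart u \<le> Smax"
  unfolding Smax_def using quart_bounded by (intro cSup_upper) (auto intro!: bdd_aboveI2 simp: bdd_above_def)

text \<open>Scaling to \<open>nrm u = 1\<close> uses that \<open>nrm\<close> has degree 2 and
  \<open>quart\<close> degree 4; a vector of norm 0 vanishes almost everywhere and is treated
  apart.\<close>

lemma quart_le_Smax:
  assumes u: "Hs3 u"
  shows "quart u \<le> Smax * (nrm u)\<^sup>2"
proof (cases "nrm u = 0")
  case True
  have "(LINT x|lborel. (u j x)^4) \<le> 0" if "j \<in> {1..3}" for j
  proof -
    have "(LINT x|lborel. (u j x)^4) = 0"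
      using nrm_eq_0_imp[OF u True that] by (intro integral_eq_zero_AE) (auto elim: eventually_mono)
    then show ?thesis by simp
  qed
  then show ?thesis using quart_le_L4[OF u, of 0] True by simp
next
  case False
  then have n: "0 < nrm u" using nrm_nonneg[of u] by simp
  define c where "c = 1 / sqrt (nrm u)"
  have c2: "c\<^sup>2 = 1 / nrm u" using n by (simp add: c_def power_divide)
  have "c^4 = (c\<^sup>2)\<^sup>2" by simp
  then have c4: "c^4 = 1 / (nrm u)\<^sup>2" by (simp only: c2 power_divide power_one)
  have "quart (\<lambda>j x. c * u j x) \<le> Smax"
    using n by (intro quart_le_Smax1 Hs3_cmult u) (simp add: nrm_cmult c2)
  then show ?thesis using n by (simp add: quart_cmult c4 field_simps)
qed

text \<open>One component suffices: a bump in the first has quartic part \<open>mu 1\<close> times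
  its fourth moment, whatever the couplings are.\<close>

lemma Smax_pos: "0 < Smax"
proof -
  define \<phi> where "\<phi> = (\<lambda>x::'a. max 0 (1 - norm x))"
  have \<phi>: "Hs s \<phi>" "\<not> (AE x in lborel. \<phi> x = 0)" unfolding \<phi>_def by (rule Hs_bump[OF s_pos s_less_1])+
  define u where "u j = (if j = 1 then \<phi> else (\<lambda>x. 0))" for j :: nat
  have u: "Hs3 u" using \<phi>(1) by (simp add: Hs3_def u_def Hs_zero)
  have i4: "int4 \<phi>" by (rule Hs_int4[OF \<phi>(1)])
  have S: "{1..3} = {1, 2, 3::nat}" by auto
  have q: "quart u = mu 1 * (LINT x|lborel. (\<phi> x)^4)"
    unfolding quart_def S by (simp add: u_def coef_def flip: power_add)
  have "(LINT x|lborel. (\<phi> x)^4) \<noteq> 0"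
  proof
    assume "(LINT x|lborel. (\<phi> x)^4) = 0"
    then have "AE x in lborel. (\<phi> x)^4 = 0"
      by (subst (asm) integral_nonneg_eq_0_iff_AE) (use i4 in \<open>auto simp: int4_def\<close>)
    then show False using \<phi>(2) by simp
  qed
  moreover have "(LINT x|lborel. (\<phi> x)^4) \<ge> 0" by (intro Bochner_Integration.integral_nonneg) simp
  ultimately have "0 < (LINT x|lborel. (\<phi> x)^4)" by linarith
  then have "0 < quart u" unfolding q using mu_pos[of 1] by simp
  then have "0 < Smax * (nrm u)\<^sup>2" using quart_le_Smax[OF u] by linarith
  then show ?thesis by (simp add: zero_less_mult_iff)
qed

lemma maximising_sequence: "\<exists>U. \<forall>n. Hs3 (U n) \<and> nrm (U n) \<le> 1 \<and> Smax - 1 / real (Suc n) < quart (U n)"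
proof -
  have "\<exists>u. Hs3 u \<and> nrm u \<le> 1 \<and> Smax - 1 / real (Suc n) < quart u" for n
  proof -
    have "Hs3 (\<lambda>j x. 0)" by (simp add: Hs3_def Hs_zero)
    moreover have "nrm (\<lambda>j x. 0) \<le> 1" using nrm_cmult[of 0 "\<lambda>j x. 0"] by simp
    ultimately have "{quart u | u. Hs3 u \<and> nrm u \<le> 1} \<noteq> {}" by blast
    then have "\<exists>y\<in>{quart u | u. Hs3 u \<and> nrm u \<le> 1}. Smax - 1 / real (Suc n) < y"
      unfolding Smax_def by (intro less_cSupD) auto
    then show ?thesis by blast
  qed
  then show ?thesis by metis
qed

section \<open>Translating a maximising sequence and passing to the limit\<close>

lemma
  assumes T: "measure_preserving T" and iso: "\<And>x y. norm (T x - T y) = norm (x - y)" and u: "Hs3 u"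
  shows Hs3_comp: "Hs3 (\<lambda>j x. u j (T x))" and nrm_comp: "nrm (\<lambda>j x. u j (T x)) = nrm u"
    and quart_comp: "quart (\<lambda>j x. u j (T x)) = quart u"
proof -
  show "Hs3 (\<lambda>j x. u j (T x))" using Hs_comp[OF T iso] u by (simp add: Hs3_def)
  show "nrm (\<lambda>j x. u j (T x)) = nrm u"
    unfolding nrm_def jnorm2_eq
    by (intro sum.cong refl arg_cong2[where f="(+)"] arg_cong2[where f="(*)"]
        gagliardo_comp[OF T iso] L2_comp[OF T iso, where s=s] Hs3D[OF u])
  have "(LINT x|lborel. (u i (T x))\<^sup>2 * (u j (T x))\<^sup>2) = (LINT x|lborel. (u i x)\<^sup>2 * (u j x)\<^sup>2)"
    if ij: "i \<in> {1..3}" "j \<in> {1..3}" for i j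
  proof -
    have [measurable]: "u i \<in> borel_measurable borel" "u j \<in> borel_measurable borel"
      using Hs3D[OF u ij(1)] Hs3D[OF u ij(2)] by auto
    show ?thesis by (rule measure_preserving_integral[OF T, of "\<lambda>x. (u i x)\<^sup>2 * (u j x)\<^sup>2"]) measurable
  qed
  then show "quart (\<lambda>j x. u j (T x)) = quart u"
    unfolding quart_def by (intro sum.cong) auto
qed

lemma average_translate:
  fixes u :: "'a \<Rightarrow> real"
  assumes [measurable]: "u \<in> borel_measurable borel" and r: "r > 0"
  shows "average (ball z r) u = average (ball 0 r) (\<lambda>x. u (z + x))"
proof -
  have [measurable]: "ball z r \<in> sets borel" by simp
  have "(LINT y|lborel. indicator (ball z r) y * u y) = (LINT y|lborel. indicator (ball z r) (z + y) * u (z + y))"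
    by (rule measure_preserving_integral[OF measure_preserving_translation[of z], symmetric]) measurable
  also have "\<dots> = (LINT y|lborel. indicator (ball 0 r) y * u (z + y))"
    by (intro Bochner_Integration.integral_cong) (auto simp: indicator_def dist_norm)
  finally show ?thesis
    using r by (simp add: average_def measure_ball_scale[of r z] measure_ball_scale[of r 0])
qed

lemma average_cmult: "average S (\<lambda>x. c * u x) = c * average S u" for u :: "'a \<Rightarrow> real"
  by (simp add: average_def mult.left_commute[of _ c])

lemma nonvanishing_component:
  "\<exists>\<rho>>0. \<exists>\<delta>>0. \<forall>u. Hs3 u \<longrightarrow> nrm u \<le> 1 \<longrightarrow> Smax / 2 \<le> quart u \<longrightarrow>
     (\<exists>j\<in>{1..3}. \<exists>z. \<delta> < \<bar>average (ball z \<rho>) (u j)\<bar>)"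
proof -
  \<comment> \<open>If all three fourth moments were below \<open>\<epsilon>\<close>, the quartic
    part would be at most \<open>bsum * (2 * \<epsilon>)\<close>, which is less than
    \<open>Smax / 2\<close>. The added 1 makes the denominator visibly positive.\<close>
  define \<epsilon> where "\<epsilon> = Smax / (4 * (bsum + 1))"
  have \<epsilon>: "\<epsilon> > 0" using Smax_pos bsum_nonneg by (simp add: \<epsilon>_def)
  have \<epsilon>b: "bsum * (2 * \<epsilon>) < Smax / 2"
  proof -
    have "(bsum + 1) * \<epsilon> = Smax / 4" using bsum_nonneg by (simp add: \<epsilon>_def field_simps)
    then have "bsum * \<epsilon> + \<epsilon> = Smax / 4" by (simp add: distrib_right)
    then show ?thesis using \<epsilon> by linarith
  qed
  define K where "K = nconst"
  have K: "K > 0" unfolding K_def by (rule nconst_pos)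
  \<comment> \<open>Scaling by \<open>c\<close> brings each component of a vector with
    \<open>nrm u \<le> 1\<close> into the unit balls required by
    \<open>nonvanishing\<close>.\<close>
  define c where "c = 1 / sqrt K"
  have c: "c > 0" using K by (simp add: c_def)
  have c2: "c\<^sup>2 = 1 / K" using K by (simp add: c_def power_divide)
  have \<epsilon>': "c^4 * \<epsilon> > 0" using c \<epsilon> by simp
  obtain \<rho> \<delta> where \<rho>: "\<rho> > 0" and \<delta>: "\<delta> > 0"
    and nv: "\<And>u::'a \<Rightarrow> real. Hs s u \<Longrightarrow> (LINT x|lborel. (u x)\<^sup>2) \<le> 1 \<Longrightarrow> gagliardo s u \<le> 1 \<Longrightarrow>
     c^4 * \<epsilon> \<le> (LINT x|lborel. (u x)^4) \<Longrightarrow> (\<exists>x. \<delta> < \<bar>average (ball x \<rho>) u\<bar>)"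
    using nonvanishing[where 'a='a, OF s_pos dim_s \<epsilon>'] by blast
  have "\<exists>j\<in>{1..3}. \<exists>z. \<delta> / c < \<bar>average (ball z \<rho>) (u j)\<bar>"
    if u: "Hs3 u" "nrm u \<le> 1" "Smax / 2 \<le> quart u" for u
  proof -
    have "\<exists>j\<in>{1..3}. \<epsilon> \<le> (LINT x|lborel. (u j x)^4)"
    proof (rule ccontr)
      assume "\<not> ?thesis"
      then have "quart u \<le> bsum * (2 * \<epsilon>)" by (intro quart_le_L4[OF u(1)]) (auto simp: not_le less_imp_le)
      then show False using \<epsilon>b u(3) by linarith
    qed
    then obtain j where j: "j \<in> {1..3}" and e: "\<epsilon> \<le> (LINT x|lborel. (u j x)^4)" by blast
    have n1: "nconst * jnorm2 s (lam j) (u j) \<le> K"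
      using mult_left_mono[OF order_trans[OF jnorm2_le_nrm[OF j] u(2)], of nconst] nconst_pos by (simp add: K_def)
    have "(LINT x|lborel. (c * u j x)\<^sup>2) \<le> 1"
      using order_trans[OF L2_le_jnorm2[OF j] n1] K by (simp add: power_mult_distrib c2)
    moreover have "gagliardo s (\<lambda>x. c * u j x) \<le> 1"
      using order_trans[OF gagliardo_le_jnorm2[OF j] n1] K by (simp add: gagliardo_cmult c2)
    moreover have "c^4 * \<epsilon> \<le> (LINT x|lborel. (c * u j x)^4)"
      using e c by (simp add: power_mult_distrib)
    ultimately obtain z where "\<delta> < \<bar>average (ball z \<rho>) (\<lambda>x. c * u j x)\<bar>"
      using nv[OF Hs_cmult[OF Hs3D[OF u(1) j]]] by blast
    then have "\<delta> / c < \<bar>average (ball z \<rho>) (u j)\<bar>"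
      using c by (simp add: average_cmult abs_mult field_simps)
    then show ?thesis using j by blast
  qed
  moreover have "0 < \<delta> / c" using \<delta> c by simp
  ultimately show ?thesis using \<rho> by blast
qed

lemma compactness_finite:
  assumes "finite J" and "J \<subseteq> {1..3}" and U: "\<And>n. Hs3 (U n)" and n: "\<And>n. nrm (U n) \<le> 1"
  shows "\<exists>r. strict_mono (r :: nat \<Rightarrow> nat) \<and> (\<forall>j\<in>J. AE x in lborel. convergent (\<lambda>n. U (r n) j x))"
  using assms(1,2)
proof (induction J)
  case empty
  show ?case by (intro exI[of _ "\<lambda>n. n"]) (simp add: strict_mono_def)
next
  case (insert j J)
  then obtain r where r: "strict_mono r" "\<And>i. i \<in> J \<Longrightarrow> AE x in lborel. convergent (\<lambda>n. U (r n) i x)" by blast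
  have j: "j \<in> {1..3}" using insert by auto
  define K where "K = nconst"
  have K: "K > 0" unfolding K_def by (rule nconst_pos)
  define c where "c = 1 / sqrt K"
  have c: "c > 0" using K by (simp add: c_def)
  have c2: "c\<^sup>2 = 1 / K" using K by (simp add: c_def power_divide)
  have n1: "nconst * jnorm2 s (lam j) (U m j) \<le> K" for m
    using mult_left_mono[OF order_trans[OF jnorm2_le_nrm[OF j] n[of m]], of nconst] nconst_pos by (simp add: K_def)
  have "\<exists>r'. strict_mono (r' :: nat \<Rightarrow> nat) \<and> (AE x in lborel. convergent (\<lambda>n. c * U (r (r' n)) j x))"
  proof (rule compactness_AE[OF s_pos s_less_1, where u="\<lambda>n x. c * U (r n) j x"])
    fix m
    show "Hs s (\<lambda>x. c * U (r m) j x)" by (intro Hs_cmult Hs3D[OF U j])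
    show "(LINT x|lborel. (c * U (r m) j x)\<^sup>2) \<le> 1"
      using order_trans[OF L2_le_jnorm2[OF j] n1] K by (simp add: power_mult_distrib c2)
    show "gagliardo s (\<lambda>x. c * U (r m) j x) \<le> 1"
      using order_trans[OF gagliardo_le_jnorm2[OF j] n1] K by (simp add: gagliardo_cmult c2)
  qed
  then obtain r' where r': "strict_mono (r' :: nat \<Rightarrow> nat)" "AE x in lborel. convergent (\<lambda>n. c * U (r (r' n)) j x)"
    by blast
  have "AE x in lborel. convergent (\<lambda>n. U ((r \<circ> r') n) j x)"
    using r'(2) by eventually_elim (use c in \<open>simp add: convergent_mult_const_iff\<close>)
  moreover have "AE x in lborel. convergent (\<lambda>n. U ((r \<circ> r') n) i x)" if "i \<in> J" for i
    using r(2)[OF that]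
  proof eventually_elim
    case (elim x)
    then show ?case using convergent_subseq_convergent[OF elim r'(1)] by (simp add: o_def)
  qed
  ultimately show ?case using strict_mono_o[OF r(1) r'(1)] by blast
qed

text \<open>All components are translated by the same vector, so norm and quartic part are
  unchanged. The component with a large average may depend on \<open>n\<close>; this is enough,
  since a trivial limit would make all three averages small.\<close>

lemma maximising_sequence_nonvanishing:
  "\<exists>V \<rho> \<delta>. (\<forall>n. Hs3 (V n)) \<and> (\<forall>n. nrm (V n) \<le> 1) \<and> (\<lambda>n. quart (V n)) \<longlonglongrightarrow> Smax \<and> \<rho> > 0 \<and> \<delta> > 0 \<and>
     (\<forall>n. \<exists>j\<in>{1..3}. \<delta> < \<bar>average (ball 0 \<rho>) (V n j)\<bar>)"
proof -
  obtain U where U: "\<And>n. Hs3 (U n)" "\<And>n. nrm (U n) \<le> 1" "\<And>n. Smax - 1 / real (Suc n) < quart (U n)"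
    using maximising_sequence by blast
  obtain \<rho> \<delta> where \<rho>: "\<rho> > 0" and \<delta>: "\<delta> > 0" and nv: "\<And>u. Hs3 u \<Longrightarrow> nrm u \<le> 1 \<Longrightarrow> Smax / 2 \<le> quart u \<Longrightarrow>
     (\<exists>j\<in>{1..3}. \<exists>z. \<delta> < \<bar>average (ball z \<rho>) (u j)\<bar>)"
    using nonvanishing_component by blast
  have q: "(\<lambda>n. quart (U n)) \<longlonglongrightarrow> Smax"
  proof (rule tendsto_sandwich)
    show "(\<lambda>n. Smax - 1 / real (Suc n)) \<longlonglongrightarrow> Smax"
      using tendsto_diff[OF tendsto_const LIMSEQ_Suc[OF lim_const_over_n[of 1]], of Smax] by simp
    show "\<forall>\<^sub>F n in sequentially. Smax - 1 / real (Suc n) \<le> quart (U n)"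
      using U(3) by (intro always_eventually) (auto simp: less_imp_le)
    show "\<forall>\<^sub>F n in sequentially. quart (U n) \<le> Smax"
      using quart_le_Smax1 U by (intro always_eventually) auto
  qed simp
  have "\<forall>\<^sub>F n in sequentially. Smax / 2 < quart (U n)"
    using order_tendstoD(1)[OF q, of "Smax / 2"] Smax_pos by simp
  then obtain n0 where n0: "\<And>n. n \<ge> n0 \<Longrightarrow> Smax / 2 < quart (U n)" by (auto simp: eventually_sequentially)
  have "\<exists>z. \<exists>j\<in>{1..3}. \<delta> < \<bar>average (ball z \<rho>) (U (n + n0) j)\<bar>" for n
    using nv[OF U(1) U(2), of "n + n0"] n0[of "n + n0"] by fastforce
  then obtain z where z: "\<And>n. \<exists>j\<in>{1..3}. \<delta> < \<bar>average (ball (z n) \<rho>) (U (n + n0) j)\<bar>" by metis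
  define V where "V n j x = U (n + n0) j (z n + x)" for n j x
  have iso: "norm ((z n + x) - (z n + y)) = norm (x - y)" for n x y by simp
  have V: "V n = (\<lambda>j x. U (n + n0) j ((+) (z n) x))" for n by (simp add: V_def fun_eq_iff)
  note T = measure_preserving_translation
  have "Hs3 (V n)" "nrm (V n) \<le> 1" "quart (V n) = quart (U (n + n0))" for n
    unfolding V using Hs3_comp[OF T iso U(1)] nrm_comp[OF T iso U(1)] quart_comp[OF T iso U(1)] U(2) by auto
  moreover have "(\<lambda>n. quart (U (n + n0))) \<longlonglongrightarrow> Smax" by (rule LIMSEQ_ignore_initial_segment[OF q])
  moreover have "\<exists>j\<in>{1..3}. \<delta> < \<bar>average (ball 0 \<rho>) (V n j)\<bar>" for n
  proof -
    obtain j where j: "j \<in> {1..3}" "\<delta> < \<bar>average (ball (z n) \<rho>) (U (n + n0) j)\<bar>" using z by blast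
    have "U (n + n0) j \<in> borel_measurable borel" using Hs3D[OF U(1) j(1)] by auto
    then show ?thesis using average_translate[OF _ \<rho>, of "U (n + n0) j" "z n"] j by (auto simp: V_def[abs_def])
  qed
  ultimately show ?thesis using \<rho> \<delta> by (intro exI[of _ V] exI[of _ \<rho>] exI[of _ \<delta>]) simp
qed

text \<open>Convergence almost everywhere and an L2 bound give L1 convergence on the ball; in
  \<open>brezis_lieb_core\<close> the squared indicator plays the part of \<open>k\<close>.\<close>

lemma average_tendsto_0:
  fixes f :: "nat \<Rightarrow> 'a \<Rightarrow> real"
  assumes f: "\<And>n. sq_integrable lborel (f n)" and K: "\<And>n. (LINT x|lborel. (f n x)\<^sup>2) \<le> K"
    and lim: "AE x in lborel. (\<lambda>n. f n x) \<longlonglongrightarrow> 0" and \<rho>: "\<rho> > 0"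
  shows "(\<lambda>n. average (ball 0 \<rho>) (f n)) \<longlonglongrightarrow> 0"
proof -
  interpret finite_set_average "ball (0::'a) \<rho>" by (rule finite_set_average_ball[OF \<rho>])
  have gi: "integrable lborel (\<lambda>x. indicator (ball 0 \<rho>) x * f n x)" for n
    by (rule sq_integrable_mult[OF sq_integrable_indicator f])
  have "(\<lambda>n. LINT x|lborel. \<bar>indicator (ball 0 \<rho>) x * f n x\<bar>) \<longlonglongrightarrow> 0"
  proof (rule brezis_lieb_core[where h="\<lambda>n x. (f n x)\<^sup>2" and k="\<lambda>x. (indicator (ball 0 \<rho>) x)\<^sup>2" and B=K])
    show "(\<lambda>x. indicator (ball 0 \<rho>) x * f n x) \<in> borel_measurable lborel" for n using gi by auto
    show "AE x in lborel. (\<lambda>n. indicator (ball 0 \<rho>) x * f n x) \<longlonglongrightarrow> 0"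
      using lim by eventually_elim (rule tendsto_mult_right_zero)
    show "\<exists>C. \<forall>n x. \<bar>indicator (ball 0 \<rho>) x * f n x\<bar> \<le> e * (f n x)\<^sup>2 + C * (indicator (ball 0 \<rho>) x)\<^sup>2" if "e > 0" for e
    proof (intro exI allI)
      fix n x
      show "\<bar>indicator (ball 0 \<rho>) x * f n x\<bar> \<le> e * (f n x)\<^sup>2 + (1 / e) * (indicator (ball 0 \<rho>) x)\<^sup>2"
        using young_ineq[OF that, of "f n x" "indicator (ball 0 \<rho>) x"] by (simp add: mult.commute)
    qed
  qed (use f K sq_integrable_indicator in \<open>auto simp: sq_integrable_def\<close>)
  then have "(\<lambda>n. LINT x|lborel. indicator (ball 0 \<rho>) x * f n x) \<longlonglongrightarrow> 0"
    by (rule Lim_null_comparison[rotated]) (auto intro!: always_eventually integral_abs_bound)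
  then show ?thesis unfolding average_def by (rule tendsto_divide_zero)
qed

text \<open>Bookkeeping for the splitting: \<open>a\<close> and \<open>d\<close> are norm and
  quartic part of the remainder, \<open>b\<close> is the difference of the norms, \<open>c\<close>
  the maximising values, \<open>q\<close> and \<open>Q\<close> belong to the limit. Passing to the
  limit gives \<open>S \<le> S * (q\<^sup>2 + (1 - q)\<^sup>2)\<close>, that is
  \<open>q * (1 - q) \<le> 0\<close>, which leaves only \<open>q = 1\<close>.\<close>

lemma limit_dichotomy:
  fixes a b :: "nat \<Rightarrow> real"
  assumes a: "\<And>n. 0 \<le> a n" and b: "b \<longlonglongrightarrow> q" and ab: "\<And>n. a n + b n \<le> 1"
    and c: "c \<longlonglongrightarrow> S" and d: "(\<lambda>n. c n - d n) \<longlonglongrightarrow> Q" and dS: "\<And>n. d n \<le> S * (a n)\<^sup>2"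
    and QS: "Q \<le> S * q\<^sup>2" and S: "0 < S" and q: "0 < q"
  shows "q = 1 \<and> Q = S"
proof -
  have b1: "b n \<le> 1" for n using a[of n] ab[of n] by linarith
  have q1: "q \<le> 1" by (rule LIMSEQ_le_const2[OF b]) (use b1 in auto)
  have "S - Q \<le> S * (1 - q)\<^sup>2"
  proof (rule LIMSEQ_le)
    show "(\<lambda>n. c n - (c n - d n)) \<longlonglongrightarrow> S - Q" by (intro tendsto_diff c d)
    show "(\<lambda>n. S * (1 - b n)\<^sup>2) \<longlonglongrightarrow> S * (1 - q)\<^sup>2" by (intro tendsto_intros b)
    have "c n - (c n - d n) \<le> S * (1 - b n)\<^sup>2" for n
    proof -
      have "(a n)\<^sup>2 \<le> (1 - b n)\<^sup>2" using a[of n] ab[of n] by (intro power_mono) auto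
      then have "S * (a n)\<^sup>2 \<le> S * (1 - b n)\<^sup>2" using S by (intro mult_left_mono) auto
      then show ?thesis using dS[of n] by linarith
    qed
    then show "\<exists>N. \<forall>n\<ge>N. c n - (c n - d n) \<le> S * (1 - b n)\<^sup>2" by blast
  qed
  then have 1: "S \<le> S * q\<^sup>2 + S * (1 - q)\<^sup>2" using QS by linarith
  then have "S * 1 \<le> S * (q\<^sup>2 + (1 - q)\<^sup>2)" by (simp add: distrib_left)
  then have "1 \<le> q\<^sup>2 + (1 - q)\<^sup>2" using S by (simp only: mult_le_cancel_left_pos)
  then have "q * (1 - q) \<le> 0" by (simp add: power2_eq_square algebra_simps)
  then have "1 - q \<le> 0" using q by (simp add: mult_le_0_iff)
  then have "q = 1" using q1 by simp
  then show ?thesis using \<open>S - Q \<le> S * (1 - q)\<^sup>2\<close> QS by simp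
qed

lemma maximiser_exists: "\<exists>u. Hs3 u \<and> nrm u = 1 \<and> quart u = Smax"
proof -
  obtain W \<rho> \<delta> where W: "\<And>n. Hs3 (W n)" "\<And>n. nrm (W n) \<le> 1" "(\<lambda>n. quart (W n)) \<longlonglongrightarrow> Smax"
    and \<rho>: "\<rho> > 0" and \<delta>: "\<delta> > 0" and nv: "\<And>n. \<exists>j\<in>{1..3}. \<delta> < \<bar>average (ball 0 \<rho>) (W n j)\<bar>"
    using maximising_sequence_nonvanishing by blast
  obtain r where r: "strict_mono (r :: nat \<Rightarrow> nat)" "\<And>j. j \<in> {1..3} \<Longrightarrow> AE x in lborel. convergent (\<lambda>n. W (r n) j x)"
    using compactness_finite[of "{1..3}" W, OF _ _ W(1,2)] by auto
  define V where "V n = W (r n)" for n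
  have V: "Hs3 (V n)" "nrm (V n) \<le> 1" "\<exists>j\<in>{1..3}. \<delta> < \<bar>average (ball 0 \<rho>) (V n j)\<bar>" for n
    using W nv by (auto simp: V_def)
  have VS: "(\<lambda>n. quart (V n)) \<longlonglongrightarrow> Smax"
    using LIMSEQ_subseq_LIMSEQ[OF W(3) r(1)] by (simp add: V_def o_def)
  \<comment> \<open>Where the sequence diverges \<open>lim\<close> is a default value; for the
    components 1 to 3 this happens only on a null set, and the limit is still measurable.\<close>
  define u where "u j x = lim (\<lambda>n. V n j x)" for j x
  have lim: "AE x in lborel. (\<lambda>n. V n j x) \<longlonglongrightarrow> u j x" if "j \<in> {1..3}" for j
    using r(2)[OF that] by eventually_elim (simp add: u_def V_def convergent_LIMSEQ_iff)
  have Vm: "V n j \<in> borel_measurable borel" if "j \<in> {1..3}" for n j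
    using Hs3D[OF V(1) that] by auto
  have um: "u j \<in> borel_measurable borel" if "j \<in> {1..3}" for j
    unfolding u_def by (rule borel_measurable_lim_metric) (rule Vm[OF that])
  have Vsq: "sq_integrable lborel (V n j)" and Vdsq: "sq_integrable (lborel \<Otimes>\<^sub>M lborel) (dquot s (V n j))"
    if "j \<in> {1..3}" for n j using Hs3D[OF V(1) that] by (auto simp: Hs_iff)
  have dlim: "AE z in lborel \<Otimes>\<^sub>M lborel. (\<lambda>n. dquot s (V n j) z) \<longlonglongrightarrow> dquot s (u j) z" if "j \<in> {1..3}" for j
    using AE_fst_snd[OF lim[OF that]]
  proof eventually_elim
    case (elim z)
    show ?case
      unfolding dquot_def divide_inverse using elim by (intro tendsto_intros) auto
  qed
  have n1: "nconst * jnorm2 s (lam j) (V n j) \<le> nconst" if "j \<in> {1..3}" for n j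
    using mult_left_mono[OF order_trans[OF jnorm2_le_nrm[OF that] V(2)[of n]], of nconst] nconst_pos by simp
  have VK: "(LINT x|lborel. (V n j x)\<^sup>2) \<le> nconst" and VdK: "gagliardo s (V n j) \<le> nconst" if "j \<in> {1..3}" for n j
    using order_trans[OF L2_le_jnorm2[OF that] n1[OF that]] order_trans[OF gagliardo_le_jnorm2[OF that] n1[OF that]] by auto
  have usq: "sq_integrable lborel (u j)" if "j \<in> {1..3}" for j
    by (rule sq_integrable_limit[OF Vsq[OF that] _ lim[OF that] VK[OF that]]) (use um[OF that] in simp)
  have udsq: "sq_integrable (lborel \<Otimes>\<^sub>M lborel) (dquot s (u j))" if "j \<in> {1..3}" for j
    by (rule sq_integrable_limit[OF Vdsq[OF that] _ dlim[OF that] VdK[OF that, unfolded gagliardo_def]])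
       (use um[OF that] in measurable)
  have u: "Hs3 u" unfolding Hs3_def Hs_iff using usq udsq by blast
  obtain C where C: "C > 0" "\<And>j (u::'a \<Rightarrow> real). j \<in> {1..3} \<Longrightarrow> Hs s u \<Longrightarrow> (LINT x|lborel. (u x)^4) \<le> C * (jnorm2 s (lam j) u)\<^sup>2"
    using L4_bound by blast
  have V4: "(LINT x|lborel. (V n j x)^4) \<le> C" if "j \<in> {1..3}" for n j
  proof -
    have "(LINT x|lborel. (V n j x)^4) \<le> C * (jnorm2 s (lam j) (V n j))\<^sup>2" by (rule C(2)[OF that Hs3D[OF V(1) that]])
    also have "\<dots> \<le> C * 1"
      using C(1) jnorm2_nonneg[OF that] order_trans[OF jnorm2_le_nrm[OF that] V(2)] by (intro mult_left_mono power_le_one) auto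
    finally show ?thesis by simp
  qed
  define D where "D n j x = V n j x - u j x" for n j x
  have D: "Hs3 (D n)" for n unfolding D_def by (rule Hs3_diff[OF V(1) u])
  have nlim: "(\<lambda>n. nrm (V n) - nrm (D n)) \<longlonglongrightarrow> nrm u"
  proof -
    have "(\<lambda>n. jnorm2 s (lam j) (V n j) - jnorm2 s (lam j) (D n j)) \<longlonglongrightarrow> jnorm2 s (lam j) (u j)" if j: "j \<in> {1..3}" for j
    proof -
      have 1: "(\<lambda>n. gagliardo s (V n j) - gagliardo s (D n j)) \<longlonglongrightarrow> gagliardo s (u j)"
        using brezis_lieb_square[OF Vdsq[OF j] udsq[OF j] dlim[OF j] VdK[OF j, unfolded gagliardo_def]]
        unfolding gagliardo_def D_def dquot_diff .
      have 2: "(\<lambda>n. (LINT x|lborel. (V n j x)\<^sup>2) - (LINT x|lborel. (D n j x)\<^sup>2)) \<longlonglongrightarrow> (LINT x|lborel. (u j x)\<^sup>2)"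
        using brezis_lieb_square[OF Vsq[OF j] usq[OF j] lim[OF j] VK[OF j]] unfolding D_def .
      have "(\<lambda>n. gconst * (gagliardo s (V n j) - gagliardo s (D n j))
          + lam j * ((LINT x|lborel. (V n j x)\<^sup>2) - (LINT x|lborel. (D n j x)\<^sup>2)))
          \<longlonglongrightarrow> gconst * gagliardo s (u j) + lam j * (LINT x|lborel. (u j x)\<^sup>2)"
        by (intro tendsto_add tendsto_mult_left 1 2)
      then show ?thesis unfolding jnorm2_eq by (simp add: algebra_simps)
    qed
    then have "(\<lambda>n. \<Sum>j\<in>{1..3}. jnorm2 s (lam j) (V n j) - jnorm2 s (lam j) (D n j)) \<longlonglongrightarrow> nrm u"
      unfolding nrm_def by (intro tendsto_sum)
    then show ?thesis by (simp add: nrm_def sum_subtractf)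
  qed
  have qlim: "(\<lambda>n. quart (V n) - quart (D n)) \<longlonglongrightarrow> quart u"
  proof -
    have "(\<lambda>n. \<Sum>i\<in>{1..3}. \<Sum>j\<in>{1..3}. coef i j * ((LINT x|lborel. (V n i x)\<^sup>2 * (V n j x)\<^sup>2) - (LINT x|lborel. (D n i x)\<^sup>2 * (D n j x)\<^sup>2)))
       \<longlonglongrightarrow> quart u"
      unfolding quart_def D_def
      by (intro tendsto_sum tendsto_mult_left brezis_lieb_quartic[where K=C] Hs3_int4 V u lim V4) auto
    then show ?thesis by (simp only: quart_def right_diff_distrib sum_subtractf)
  qed
  \<comment> \<open>A trivial limit would let the averages over the fixed ball tend to 0, against
    the lower bound \<open>\<delta>\<close> secured by the translations.\<close>
  have "nrm u \<noteq> 0"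
  proof
    assume 0: "nrm u = 0"
    have "\<forall>\<^sub>F n in sequentially. \<bar>average (ball 0 \<rho>) (V n j)\<bar> < \<delta>" if j: "j \<in> {1..3}" for j
    proof -
      have "AE x in lborel. (\<lambda>n. V n j x) \<longlonglongrightarrow> 0"
        using lim[OF j] nrm_eq_0_imp[OF u 0 j] by eventually_elim simp
      then have "(\<lambda>n. average (ball 0 \<rho>) (V n j)) \<longlonglongrightarrow> 0"
        by (intro average_tendsto_0[OF Vsq[OF j] VK[OF j] _ \<rho>])
      then have "(\<lambda>n. \<bar>average (ball 0 \<rho>) (V n j)\<bar>) \<longlonglongrightarrow> 0" by (rule tendsto_rabs_zero)
      then show ?thesis using \<delta> by (rule order_tendstoD(2))
    qed
    then have "\<forall>\<^sub>F n in sequentially. \<forall>j\<in>{1..3}. \<bar>average (ball 0 \<rho>) (V n j)\<bar> < \<delta>"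
      by (simp add: eventually_ball_finite)
    then obtain n where "\<forall>j\<in>{1..3}. \<bar>average (ball 0 \<rho>) (V n j)\<bar> < \<delta>"
      by (auto simp: eventually_sequentially)
    then show False using V(3)[of n] by force
  qed
  then have q: "0 < nrm u" using nrm_nonneg[of u] by simp
  have "nrm u = 1 \<and> quart u = Smax"
    by (rule limit_dichotomy[OF nrm_nonneg nlim _ VS qlim quart_le_Smax[OF D] quart_le_Smax[OF u] Smax_pos q])
       (use V(2) in simp)
  then show ?thesis using u by blast
qed

end

section \<open>Polarisation\<close>

definition reflection :: "'a::euclidean_space \<Rightarrow> real \<Rightarrow> 'a \<Rightarrow> 'a" where
  "reflection e c x = x - (2 * (x \<bullet> e - c)) *\<^sub>R e"

context
  fixes e :: "'a::euclidean_space"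
  assumes e: "norm e = 1"
begin

lemma inner_self_unit: "e \<bullet> e = 1"
  using e by (simp add: dot_square_norm)

lemma reflection_height: "reflection e c x \<bullet> e - c = - (x \<bullet> e - c)"
  by (simp add: reflection_def inner_diff_left inner_self_unit)

lemma reflection_involution: "reflection e c (reflection e c x) = x"
proof -
  have "reflection e c (reflection e c x) = reflection e c x - (2 * (- (x \<bullet> e - c))) *\<^sub>R e"
    by (subst reflection_def) (simp only: reflection_height)
  also have "\<dots> = x" unfolding reflection_def by (simp add: algebra_simps)
  finally show ?thesis .
qed

text \<open>The sign of the product of heights tells which of \<open>y\<close> and its mirror image
  is nearer to \<open>x\<close>; this is the geometric core of the polarisation inequality.\<close>

lemma norm_reflection_power2:
  "(norm (x - reflection e c y))\<^sup>2 = (norm (x - y))\<^sup>2 + 4 * ((x \<bullet> e - c) * (y \<bullet> e - c))"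
proof -
  have eq: "x - reflection e c y = (x - y) + (2 * (y \<bullet> e - c)) *\<^sub>R e" by (simp add: reflection_def)
  have "(norm (w + t *\<^sub>R e))\<^sup>2 = (norm w)\<^sup>2 + 2 * t * (w \<bullet> e) + t\<^sup>2" for w and t :: real
    by (simp add: power2_norm_eq_inner inner_add_left inner_add_right inner_self_unit inner_commute
        power2_eq_square[of t] algebra_simps)
  then have "(norm (x - reflection e c y))\<^sup>2
    = (norm (x - y))\<^sup>2 + 2 * (2 * (y \<bullet> e - c)) * ((x - y) \<bullet> e) + (2 * (y \<bullet> e - c))\<^sup>2"
    unfolding eq .
  also have "\<dots> = (norm (x - y))\<^sup>2 + 4 * ((x \<bullet> e - c) * (y \<bullet> e - c))"
    by (simp add: inner_diff_left power2_eq_square algebra_simps)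
  finally show ?thesis .
qed

lemma norm_reflection_diff: "norm (reflection e c x - reflection e c y) = norm (x - y)"
proof -
  have "(norm (reflection e c x - reflection e c y))\<^sup>2 = (norm (x - y))\<^sup>2"
    using norm_reflection_power2[of "reflection e c x" c y] norm_reflection_power2[of y c x]
    by (simp add: reflection_height norm_minus_commute algebra_simps)
  then show ?thesis by (simp add: power2_eq_iff_nonneg)
qed

lemma norm_reflection_swap: "norm (reflection e c x - y) = norm (x - reflection e c y)"
  using norm_reflection_diff[of c x "reflection e c y"] by (simp add: reflection_involution)

lemma measure_preserving_reflection: "measure_preserving (reflection e c)"
proof -
  have "linear (reflection e 0)"
    by (auto intro!: linearI simp: reflection_def inner_add_left algebra_simps)
  moreover have "norm (reflection e 0 x) = norm x" for x
    using norm_reflection_diff[of 0 x 0] by (simp add: reflection_def)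
  ultimately have "measure_preserving (reflection e 0)" by (rule measure_preserving_linear_isometry)
  then have "measure_preserving (\<lambda>x. (2 * c) *\<^sub>R e + reflection e 0 x)"
    by (rule measure_preserving_comp[OF measure_preserving_translation])
  moreover have "(\<lambda>x. (2 * c) *\<^sub>R e + reflection e 0 x) = reflection e c"
    by (auto simp: fun_eq_iff reflection_def algebra_simps)
  ultimately show ?thesis by simp
qed

end

lemma measure_preserving_id: "measure_preserving (\<lambda>x. x)"
  using measure_preserving_translation[of 0] by simp

text \<open>Two-point rearrangement: of the values at mirror points the larger goes to the side
  \<open>c < x \<bullet> e\<close>. For a unit vector \<open>e\<close> the two points coincide on
  the hyperplane, so the branch taken there is immaterial.\<close>

definition polarise :: "'a::euclidean_space \<Rightarrow> real \<Rightarrow> ('a \<Rightarrow> real) \<Rightarrow> 'a \<Rightarrow> real" where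
  "polarise e c u x = (if c < x \<bullet> e then max (u x) (u (reflection e c x)) else min (u x) (u (reflection e c x)))"

lemma polarise_mirror:
  assumes e: "norm e = 1"
  shows "polarise e c u (reflection e c x) =
    (if x \<bullet> e < c then max (u x) (u (reflection e c x)) else min (u x) (u (reflection e c x)))"
  using reflection_height[OF e, of c x] unfolding polarise_def reflection_involution[OF e]
  by (auto simp: max.commute min.commute)

lemma polarise_measurable [measurable]:
  assumes [measurable]: "u \<in> borel_measurable borel"
  shows "polarise e c u \<in> borel_measurable borel"
proof -
  have [measurable]: "reflection e c \<in> borel_measurable borel" unfolding reflection_def by measurable
  show ?thesis unfolding polarise_def by measurable
qed

text \<open>The smaller numerator is matched with the smaller denominator, which lowers the sum. The
  condition for \<open>k = 0\<close> covers the diagonal, where the quotient is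
  \<open>0 / 0 = 0\<close>. The equality case is recorded because symmetry is deduced from
  it.\<close>

lemma rearrange_quotients:
  fixes P R k l :: real
  assumes "0 \<le> P" "0 \<le> R" "0 \<le> k" "k \<le> l" "k = 0 \<longrightarrow> P = 0"
  shows "min P R / k + max P R / l \<le> P / k + R / l"
    and "k < l \<Longrightarrow> min P R / k + max P R / l = P / k + R / l \<Longrightarrow> P \<le> R"
proof -
  have *: "min P R / k + max P R / l \<le> P / k + R / l \<and> (k < l \<longrightarrow> min P R / k + max P R / l = P / k + R / l \<longrightarrow> P \<le> R)"
  proof (cases "P \<le> R")
    case False
    then have k: "0 < k" using assms by force
    have "P / k + R / l - (R / k + P / l) = (P - R) * (1 / k - 1 / l)"
      by (simp add: diff_divide_distrib algebra_simps)
    moreover have "0 \<le> (P - R) * (1 / k - 1 / l)"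
      using k assms(4) False by (intro mult_nonneg_nonneg) (auto simp: frac_le)
    moreover have "0 < (P - R) * (1 / k - 1 / l)" if "k < l"
      using k that False by (intro mult_pos_pos) (auto simp: divide_strict_left_mono)
    ultimately have "R / k + P / l \<le> P / k + R / l" "k < l \<Longrightarrow> R / k + P / l < P / k + R / l"
      by linarith+
    then show ?thesis using False by auto
  qed auto
  from * show "min P R / k + max P R / l \<le> P / k + R / l" by simp
  from * show "k < l \<Longrightarrow> min P R / k + max P R / l = P / k + R / l \<Longrightarrow> P \<le> R" by blast
qed

text \<open>The two pairings of \<open>a\<close>, \<open>a'\<close> with \<open>b\<close>,
  \<open>b'\<close> differ by twice \<open>(a - a') * (b - b')\<close>, so pairing sorted with
  sorted gives the smaller sum of squares.\<close>

lemma sorted_distance: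
  fixes a a' b b' :: real
  shows "(max a a' - max b b')\<^sup>2 + (min a a' - min b b')\<^sup>2 = min ((a - b)\<^sup>2 + (a' - b')\<^sup>2) ((a - b')\<^sup>2 + (a' - b)\<^sup>2)"
    and "(max a a' - min b b')\<^sup>2 + (min a a' - max b b')\<^sup>2 = max ((a - b)\<^sup>2 + (a' - b')\<^sup>2) ((a - b')\<^sup>2 + (a' - b)\<^sup>2)"
proof -
  have d: "((a - b)\<^sup>2 + (a' - b')\<^sup>2) - ((a - b')\<^sup>2 + (a' - b)\<^sup>2) = - 2 * ((a - a') * (b - b'))"
    by (simp add: power2_eq_square algebra_simps)
  consider "a' \<le> a" "b' \<le> b" | "a \<le> a'" "b \<le> b'" | "a' \<le> a" "b \<le> b'" | "a \<le> a'" "b' \<le> b" by linarith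
  then have "(max a a' - max b b')\<^sup>2 + (min a a' - min b b')\<^sup>2 = min ((a - b)\<^sup>2 + (a' - b')\<^sup>2) ((a - b')\<^sup>2 + (a' - b)\<^sup>2)
    \<and> (max a a' - min b b')\<^sup>2 + (min a a' - max b b')\<^sup>2 = max ((a - b)\<^sup>2 + (a' - b')\<^sup>2) ((a - b')\<^sup>2 + (a' - b)\<^sup>2)"
  proof cases
    case 1
    then have "(a - b)\<^sup>2 + (a' - b')\<^sup>2 \<le> (a - b')\<^sup>2 + (a' - b)\<^sup>2"
      using d mult_nonneg_nonneg[of "a - a'" "b - b'"] by linarith
    with 1 show ?thesis by (simp add: max_absorb1 max_absorb2 min_absorb1 min_absorb2)
  next
    case 2
    then have "(a - b)\<^sup>2 + (a' - b')\<^sup>2 \<le> (a - b')\<^sup>2 + (a' - b)\<^sup>2"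
      using d mult_nonpos_nonpos[of "a - a'" "b - b'"] by linarith
    with 2 show ?thesis by (simp add: max_absorb1 max_absorb2 min_absorb1 min_absorb2 add.commute)
  next
    case 3
    then have "(a - b')\<^sup>2 + (a' - b)\<^sup>2 \<le> (a - b)\<^sup>2 + (a' - b')\<^sup>2"
      using d mult_nonneg_nonpos[of "a - a'" "b - b'"] by linarith
    with 3 show ?thesis by (simp add: max_absorb1 max_absorb2 min_absorb1 min_absorb2)
  next
    case 4
    then have "(a - b')\<^sup>2 + (a' - b)\<^sup>2 \<le> (a - b)\<^sup>2 + (a' - b')\<^sup>2"
      using d mult_nonpos_nonneg[of "a - a'" "b - b'"] by linarith
    with 4 show ?thesis by (simp add: max_absorb1 max_absorb2 min_absorb1 min_absorb2 add.commute)
  qed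
  then show "(max a a' - max b b')\<^sup>2 + (min a a' - min b b')\<^sup>2 = min ((a - b)\<^sup>2 + (a' - b')\<^sup>2) ((a - b')\<^sup>2 + (a' - b)\<^sup>2)"
    and "(max a a' - min b b')\<^sup>2 + (min a a' - max b b')\<^sup>2 = max ((a - b)\<^sup>2 + (a' - b')\<^sup>2) ((a - b')\<^sup>2 + (a' - b)\<^sup>2)"
    by blast+
qed

text \<open>The sum over the orbit of a pair under reflecting either point. Single terms may
  increase under polarisation, but the sum does not, and all four terms have the same
  integral.\<close>

definition four_point :: "real \<Rightarrow> 'a::euclidean_space \<Rightarrow> real \<Rightarrow> ('a \<Rightarrow> real) \<Rightarrow> 'a \<times> 'a \<Rightarrow> real" where
  "four_point s e c u z = (dquot s u z)\<^sup>2 + (dquot s u (reflection e c (fst z), reflection e c (snd z)))\<^sup>2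
     + (dquot s u (fst z, reflection e c (snd z)))\<^sup>2 + (dquot s u (reflection e c (fst z), snd z))\<^sup>2"

context
  fixes e :: "'a::euclidean_space" and c s :: real
  assumes e: "norm e = 1" and s: "0 < s"
begin

lemma four_point_eq:
  fixes u :: "'a \<Rightarrow> real"
  defines "\<sigma> \<equiv> reflection e c" and "a \<equiv> real DIM('a) + 2 * s"
  shows "four_point s e c u (x, y)
    = ((u x - u y)\<^sup>2 + (u (\<sigma> x) - u (\<sigma> y))\<^sup>2) / norm (x - y) powr a
    + ((u x - u (\<sigma> y))\<^sup>2 + (u (\<sigma> x) - u y)\<^sup>2) / norm (x - \<sigma> y) powr a"
  by (simp add: four_point_def dquot_power2 norm_reflection_diff[OF e] norm_reflection_swap[OF e]
      reflection_involution[OF e] \<sigma>_def a_def add_divide_distrib)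

text \<open>Only two distances occur on the orbit, with numerators \<open>P\<close> and
  \<open>R\<close>. Polarising gives the shorter distance the smaller numerator, so
  \<open>min P R\<close> goes with \<open>x - y\<close> if both points lie on the same side and with
  the mirrored pair otherwise. Equality for two points above the hyperplane means
  \<open>P \<le> R\<close> from the start, and this is the sign condition.\<close>

lemma polarise_four_point:
  fixes u :: "'a \<Rightarrow> real"
  shows "four_point s e c (polarise e c u) z \<le> four_point s e c u z"
    and "four_point s e c (polarise e c u) z = four_point s e c u z \<Longrightarrow> c < fst z \<bullet> e \<Longrightarrow> c < snd z \<bullet> e \<Longrightarrow>
      0 \<le> (u (fst z) - u (reflection e c (fst z))) * (u (snd z) - u (reflection e c (snd z)))"
proof -
  obtain x y where z: "z = (x, y)" by (cases z)
  define \<sigma> where "\<sigma> = reflection e c"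
  define a where "a = real DIM('a) + 2 * s"
  have a: "a > 0" using s by (simp add: a_def)
  define p where "p = polarise e c u"
  define k where "k = norm (x - y) powr a"
  define l where "l = norm (x - \<sigma> y) powr a"
  define P where "P = (u x - u y)\<^sup>2 + (u (\<sigma> x) - u (\<sigma> y))\<^sup>2"
  define R where "R = (u x - u (\<sigma> y))\<^sup>2 + (u (\<sigma> x) - u y)\<^sup>2"
  define P' where "P' = (p x - p y)\<^sup>2 + (p (\<sigma> x) - p (\<sigma> y))\<^sup>2"
  define R' where "R' = (p x - p (\<sigma> y))\<^sup>2 + (p (\<sigma> x) - p y)\<^sup>2"
  have G: "four_point s e c u z = P / k + R / l" and G': "four_point s e c p z = P' / k + R' / l"
    unfolding z four_point_eq P_def R_def P'_def R'_def k_def l_def \<sigma>_def a_def by (rule refl)+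
  have PR0: "0 \<le> P" "0 \<le> R" by (auto simp: P_def R_def)
  have kl0: "0 \<le> k" "0 \<le> l" by (auto simp: k_def l_def)
  have k0: "k = 0 \<longrightarrow> P = 0" by (simp add: k_def P_def)
  have l0: "l = 0 \<longrightarrow> R = 0"
  proof
    assume "l = 0"
    then have "x = \<sigma> y" by (simp add: l_def)
    moreover from this have "\<sigma> x = y" by (simp add: \<sigma>_def reflection_involution[OF e])
    ultimately show "R = 0" by (simp add: R_def)
  qed
  \<comment> \<open>Positive when \<open>x\<close> and \<open>y\<close> lie strictly on the same
    side, negative when on opposite sides, 0 when one of them is its own mirror image.\<close>
  define \<tau> where "\<tau> = (x \<bullet> e - c) * (y \<bullet> e - c)"
  have n: "(norm (x - \<sigma> y))\<^sup>2 = (norm (x - y))\<^sup>2 + 4 * \<tau>"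
    unfolding \<sigma>_def \<tau>_def by (rule norm_reflection_power2[OF e])
  have kl: "k \<le> l" if "0 \<le> \<tau>"
  proof -
    have "(norm (x - y))\<^sup>2 \<le> (norm (x - \<sigma> y))\<^sup>2" using n that by simp
    then have "norm (x - y) \<le> norm (x - \<sigma> y)" by (simp add: power2_le_iff_abs_le)
    then show ?thesis unfolding k_def l_def using a by (intro powr_mono2) auto
  qed
  have lk: "l \<le> k" if "\<tau> \<le> 0"
  proof -
    have "(norm (x - \<sigma> y))\<^sup>2 \<le> (norm (x - y))\<^sup>2" using n that by simp
    then have "norm (x - \<sigma> y) \<le> norm (x - y)" by (simp add: power2_le_iff_abs_le)
    then show ?thesis unfolding k_def l_def using a by (intro powr_mono2) auto
  qed
  have px: "p x = (if c < x \<bullet> e then max (u x) (u (\<sigma> x)) else min (u x) (u (\<sigma> x)))"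
    and py: "p y = (if c < y \<bullet> e then max (u y) (u (\<sigma> y)) else min (u y) (u (\<sigma> y)))"
    and psx: "p (\<sigma> x) = (if x \<bullet> e < c then max (u x) (u (\<sigma> x)) else min (u x) (u (\<sigma> x)))"
    and psy: "p (\<sigma> y) = (if y \<bullet> e < c then max (u y) (u (\<sigma> y)) else min (u y) (u (\<sigma> y)))"
    unfolding p_def \<sigma>_def by (simp_all only: polarise_mirror[OF e]) (simp_all only: polarise_def)
  have same: "P' = min P R \<and> R' = max P R" if "0 < \<tau>"
  proof -
    have "(c < x \<bullet> e \<and> c < y \<bullet> e) \<or> (x \<bullet> e < c \<and> y \<bullet> e < c)" using that unfolding \<tau>_def by (auto simp: zero_less_mult_iff)
    then show ?thesis
      unfolding P'_def R'_def P_def R_def px py psx psy sorted_distance[symmetric] by auto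
  qed
  have opp: "P' = max P R \<and> R' = min P R" if "\<tau> < 0"
  proof -
    have "(c < x \<bullet> e \<and> y \<bullet> e < c) \<or> (x \<bullet> e < c \<and> c < y \<bullet> e)" using that unfolding \<tau>_def by (auto simp: mult_less_0_iff)
    then show ?thesis
      unfolding P'_def R'_def P_def R_def px py psx psy sorted_distance[symmetric] by auto
  qed
  have bd: "P' = P \<and> R' = R" if \<tau>0: "\<tau> = 0"
  proof -
    have *: "\<sigma> w = w" if "w \<bullet> e = c" for w using that by (simp add: \<sigma>_def reflection_def)
    consider "x \<bullet> e = c" | "y \<bullet> e = c" using \<tau>0 unfolding \<tau>_def by auto
    then show ?thesis
    proof cases
      case 1
      then show ?thesis using *[OF 1] *[of y] unfolding P'_def R'_def P_def R_def px py psx psy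
        by (auto simp: max_def min_def)
    next
      case 2
      then show ?thesis using *[OF 2] *[of x] unfolding P'_def R'_def P_def R_def px py psx psy
        by (auto simp: max_def min_def)
    qed
  qed
  have main: "P' / k + R' / l \<le> P / k + R / l"
  proof (cases "\<tau> = 0")
    case False
    then consider "0 < \<tau>" | "\<tau> < 0" by linarith
    then show ?thesis
    proof cases
      case 1
      then show ?thesis using same rearrange_quotients(1)[OF PR0 kl0(1) kl k0] by auto
    next
      case 2
      then show ?thesis using opp rearrange_quotients(1)[OF PR0(2,1) kl0(2) lk l0]
        by (simp add: min.commute max.commute add.commute)
    qed
  qed (use bd in simp)
  then show "four_point s e c (polarise e c u) z \<le> four_point s e c u z"
    using G G' by (simp add: p_def)
  assume eq: "four_point s e c (polarise e c u) z = four_point s e c u z" and "c < fst z \<bullet> e" "c < snd z \<bullet> e"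
  then have pos: "0 < \<tau>" by (simp add: z \<tau>_def)
  have "(norm (x - y))\<^sup>2 < (norm (x - \<sigma> y))\<^sup>2" using n pos by simp
  then have "norm (x - y) < norm (x - \<sigma> y)" by (rule power2_less_imp_less) simp
  then have "k < l" unfolding k_def l_def using a by (intro powr_less_mono2) auto
  moreover have "min P R / k + max P R / l = P / k + R / l"
    using eq same[OF pos] G G' by (simp add: p_def)
  ultimately have "P \<le> R"
    by (rule rearrange_quotients(2)[OF PR0 kl0(1) kl[OF less_imp_le[OF pos]] k0])
  then have "0 \<le> 2 * ((u x - u (\<sigma> x)) * (u y - u (\<sigma> y)))"
    unfolding P_def R_def by (simp add: power2_eq_square algebra_simps)
  then show "0 \<le> (u (fst z) - u (reflection e c (fst z))) * (u (snd z) - u (reflection e c (snd z)))"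
    by (simp add: z \<sigma>_def)
qed

lemma
  fixes u :: "'a \<Rightarrow> real"
  assumes [measurable]: "u \<in> borel_measurable borel"
    and i: "integrable (lborel \<Otimes>\<^sub>M lborel) (\<lambda>z. (dquot s u z)\<^sup>2)"
  shows integrable_four_point: "integrable (lborel \<Otimes>\<^sub>M lborel) (four_point s e c u)"
    and integral_four_point: "(LINT z|(lborel \<Otimes>\<^sub>M lborel). four_point s e c u z) = 4 * gagliardo s u"
proof -
  have m: "(\<lambda>z. (dquot s u z)\<^sup>2) \<in> borel_measurable (lborel \<Otimes>\<^sub>M lborel)" by measurable
  note r = measure_preserving_reflection[OF e, of c]
  note I = measure_preserving_integrable2[OF _ _ m] measure_preserving_integral2[OF _ _ m]
  note I2 = I(1)[OF r r] I(1)[OF measure_preserving_id r] I(1)[OF r measure_preserving_id]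
    I(2)[OF r r] I(2)[OF measure_preserving_id r] I(2)[OF r measure_preserving_id]
  show "integrable (lborel \<Otimes>\<^sub>M lborel) (four_point s e c u)"
    unfolding four_point_def[abs_def] using i I2 by (intro Bochner_Integration.integrable_add) simp_all
  show "(LINT z|(lborel \<Otimes>\<^sub>M lborel). four_point s e c u z) = 4 * gagliardo s u"
    unfolding four_point_def gagliardo_def using i I2 by simp
qed

lemma
  fixes u :: "'a \<Rightarrow> real"
  assumes u: "Hs s u"
  shows Hs_polarise: "Hs s (polarise e c u)"
    and gagliardo_polarise: "gagliardo s (polarise e c u) \<le> gagliardo s u"
    and gagliardo_polarise_eq: "gagliardo s (polarise e c u) = gagliardo s u \<Longrightarrow>
      AE z in lborel \<Otimes>\<^sub>M lborel. c < fst z \<bullet> e \<longrightarrow> c < snd z \<bullet> e \<longrightarrow>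
      0 \<le> (u (fst z) - u (reflection e c (fst z))) * (u (snd z) - u (reflection e c (snd z)))"
proof -
  have [measurable]: "u \<in> borel_measurable borel" using u by auto
  note r = measure_preserving_reflection[OF e, of c]
  have ui: "integrable (lborel \<Otimes>\<^sub>M lborel) (\<lambda>z. (dquot s u z)\<^sup>2)" using u by (simp add: Hs_iff sq_integrable_def)
  have fi: "integrable (lborel \<Otimes>\<^sub>M lborel) (four_point s e c u)" by (rule integrable_four_point[OF _ ui]) measurable
  have pi: "integrable (lborel \<Otimes>\<^sub>M lborel) (\<lambda>z. (dquot s (polarise e c u) z)\<^sup>2)"
  proof (rule integrable_dominated[OF fi])
    fix z
    have "(dquot s (polarise e c u) z)\<^sup>2 \<le> four_point s e c (polarise e c u) z"
      unfolding four_point_def by simp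
    then show "\<bar>(dquot s (polarise e c u) z)\<^sup>2\<bar> \<le> four_point s e c u z"
      using polarise_four_point(1)[of u z] by simp
  qed measurable
  have pfi: "integrable (lborel \<Otimes>\<^sub>M lborel) (four_point s e c (polarise e c u))"
    by (rule integrable_four_point[OF _ pi]) measurable
  have "integrable lborel (\<lambda>x. (u (reflection e c x))\<^sup>2)"
    using u by (subst measure_preserving_integrable[OF r, of "\<lambda>x. (u x)\<^sup>2"]) (auto simp: Hs_def)
  then have i2: "integrable lborel (\<lambda>x. (u x)\<^sup>2 + (u (reflection e c x))\<^sup>2)" using u by (simp add: Hs_def)
  have "integrable lborel (\<lambda>x. (polarise e c u x)\<^sup>2)"
  proof (rule integrable_dominated[OF i2])
    show "\<bar>(polarise e c u x)\<^sup>2\<bar> \<le> (u x)\<^sup>2 + (u (reflection e c x))\<^sup>2" for x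
      by (auto simp: polarise_def max_def min_def)
  qed measurable
  then show "Hs s (polarise e c u)" using pi by (simp add: Hs_iff sq_integrable_def)
  have le: "4 * gagliardo s (polarise e c u) \<le> 4 * gagliardo s u"
    unfolding integral_four_point[OF _ ui, symmetric, OF \<open>u \<in> borel_measurable borel\<close>]
      integral_four_point[OF _ pi, symmetric, OF polarise_measurable[OF \<open>u \<in> borel_measurable borel\<close>]]
    by (rule integral_mono[OF pfi fi polarise_four_point(1)])
  then show "gagliardo s (polarise e c u) \<le> gagliardo s u" by simp
  assume "gagliardo s (polarise e c u) = gagliardo s u"
  then have "(LINT z|(lborel \<Otimes>\<^sub>M lborel). four_point s e c u z - four_point s e c (polarise e c u) z) = 0"
    using fi pfi integral_four_point[OF _ ui] integral_four_point[OF _ pi] by simp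
  then have "AE z in lborel \<Otimes>\<^sub>M lborel. four_point s e c u z - four_point s e c (polarise e c u) z = 0"
    by (subst (asm) integral_nonneg_eq_0_iff_AE) (use fi pfi polarise_four_point(1)[of u] in auto)
  then show "AE z in lborel \<Otimes>\<^sub>M lborel. c < fst z \<bullet> e \<longrightarrow> c < snd z \<bullet> e \<longrightarrow>
      0 \<le> (u (fst z) - u (reflection e c (fst z))) * (u (snd z) - u (reflection e c (snd z)))"
    by eventually_elim (use polarise_four_point(2)[of u] in auto)
qed

text \<open>Each integral is half the integral of the sum over the two mirror points, so an
  inequality for such sums is enough.\<close>

lemma integral_mirror_le:
  fixes f g :: "'a \<Rightarrow> real"
  assumes f: "integrable lborel f" and g: "integrable lborel g"
    and le: "\<And>x. f x + f (reflection e c x) \<le> g x + g (reflection e c x)"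
  shows "(LINT x|lborel. f x) \<le> (LINT x|lborel. g x)"
proof -
  note r = measure_preserving_reflection[OF e, of c]
  have m: "f \<in> borel_measurable borel" "g \<in> borel_measurable borel" using f g by auto
  have i: "integrable lborel (\<lambda>x. f (reflection e c x))" "integrable lborel (\<lambda>x. g (reflection e c x))"
    using f g m measure_preserving_integrable[OF r] by auto
  have "(LINT x|lborel. f x + f (reflection e c x)) \<le> (LINT x|lborel. g x + g (reflection e c x))"
    using f g i le by (intro integral_mono) auto
  then show ?thesis
    using f g i m measure_preserving_integral[OF r] by simp
qed

lemma L2_polarise:
  fixes u :: "'a \<Rightarrow> real"
  assumes u: "Hs s u"
  shows "(LINT x|lborel. (polarise e c u x)\<^sup>2) \<le> (LINT x|lborel. (u x)\<^sup>2)"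
proof (rule integral_mirror_le)
  show "integrable lborel (\<lambda>x. (polarise e c u x)\<^sup>2)" "integrable lborel (\<lambda>x. (u x)\<^sup>2)"
    using Hs_polarise[OF u] u by (auto simp: Hs_def)
  have *: "reflection e c x = x" if "x \<bullet> e = c" for x using that by (simp add: reflection_def)
  show "(polarise e c u x)\<^sup>2 + (polarise e c u (reflection e c x))\<^sup>2 \<le> (u x)\<^sup>2 + (u (reflection e c x))\<^sup>2" for x
    unfolding polarise_mirror[OF e] unfolding polarise_def using *[of x] by (auto simp: max_def min_def)
qed

text \<open>The rearrangement inequality for two pairs of numbers; nonnegativity lets squaring
  commute with \<open>max\<close> and \<open>min\<close>.\<close>

lemma mixed_polarise:
  fixes u v :: "'a \<Rightarrow> real"
  assumes u: "\<And>x. 0 \<le> u x" and v: "\<And>x. 0 \<le> v x"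
    and i: "integrable lborel (\<lambda>x. (u x)\<^sup>2 * (v x)\<^sup>2)"
    and pi: "integrable lborel (\<lambda>x. (polarise e c u x)\<^sup>2 * (polarise e c v x)\<^sup>2)"
  shows "(LINT x|lborel. (u x)\<^sup>2 * (v x)\<^sup>2) \<le> (LINT x|lborel. (polarise e c u x)\<^sup>2 * (polarise e c v x)\<^sup>2)"
proof (rule integral_mirror_le[OF i pi])
  fix x
  have sq: "(max a a')\<^sup>2 = max (a\<^sup>2) (a'\<^sup>2)" "(min a a')\<^sup>2 = min (a\<^sup>2) (a'\<^sup>2)" if "0 \<le> a" "0 \<le> a'" for a a' :: real
    using that by (auto simp: max_def min_def power_mono_iff)
  have rearr: "A * B + A' * B' \<le> max A A' * max B B' + min A A' * min B B'" for A A' B B' :: real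
  proof -
    have "0 \<le> (A' - A) * (B - B')" if "A \<le> A'" "B' \<le> B" using that by simp
    moreover have "0 \<le> (A - A') * (B' - B)" if "A' \<le> A" "B \<le> B'" using that by simp
    ultimately show ?thesis by (auto simp: max_def min_def algebra_simps)
  qed
  have *: "reflection e c x = x" if "x \<bullet> e = c" using that by (simp add: reflection_def)
  show "(u x)\<^sup>2 * (v x)\<^sup>2 + (u (reflection e c x))\<^sup>2 * (v (reflection e c x))\<^sup>2
    \<le> (polarise e c u x)\<^sup>2 * (polarise e c v x)\<^sup>2
      + (polarise e c u (reflection e c x))\<^sup>2 * (polarise e c v (reflection e c x))\<^sup>2"
  proof (cases "x \<bullet> e" c rule: linorder_cases)
    case less
    then have "\<not> c < x \<bullet> e" "x \<bullet> e < c" by auto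
    then show ?thesis
      unfolding polarise_mirror[OF e] unfolding polarise_def
      using rearr[of "(u x)\<^sup>2" "(v x)\<^sup>2" "(u (reflection e c x))\<^sup>2" "(v (reflection e c x))\<^sup>2"]
      by (simp only: if_True if_False sq[OF u u] sq[OF v v])
  next
    case equal
    then show ?thesis by (simp add: * polarise_def)
  next
    case greater
    then have "c < x \<bullet> e" "\<not> x \<bullet> e < c" by auto
    then show ?thesis
      unfolding polarise_mirror[OF e] unfolding polarise_def
      using rearr[of "(u x)\<^sup>2" "(v x)\<^sup>2" "(u (reflection e c x))\<^sup>2" "(v (reflection e c x))\<^sup>2"]
      by (simp only: if_True if_False sq[OF u u] sq[OF v v])
  qed
qed

end

section \<open>Centres of symmetry\<close>

text \<open>The difference between mirror points, oriented towards the side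
  \<open>c < x \<bullet> e\<close>. For a unit vector \<open>e\<close> it takes the same value at
  both points, so a sign found on one half-space holds on the other.\<close>

definition mirror_sign :: "'a::euclidean_space \<Rightarrow> real \<Rightarrow> ('a \<Rightarrow> real) \<Rightarrow> 'a \<Rightarrow> real" where
  "mirror_sign e c u x = sgn (x \<bullet> e - c) * (u x - u (reflection e c x))"

text \<open>This is what equality in the polarisation inequality means for the function.\<close>
definition two_point :: "('a::euclidean_space \<Rightarrow> real) \<Rightarrow> bool" where
  "two_point u \<longleftrightarrow> (\<forall>e c. norm e = 1 \<longrightarrow>
     (AE x in lborel. 0 \<le> mirror_sign e c u x) \<or> (AE x in lborel. mirror_sign e c u x \<le> 0))"

definition mirror_symmetric :: "'a::euclidean_space \<Rightarrow> real \<Rightarrow> ('a \<Rightarrow> real) \<Rightarrow> bool" where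
  "mirror_symmetric e c u \<longleftrightarrow> (AE x in lborel. u (reflection e c x) = u x)"

text \<open>The mass of \<open>u\<^sup>2\<close> above the hyperplane minus the mass below; its
  zeros are the halving hyperplanes.\<close>

definition imbalance :: "'a::euclidean_space \<Rightarrow> real \<Rightarrow> ('a \<Rightarrow> real) \<Rightarrow> real" where
  "imbalance e c u = (LINT x|lborel. sgn (x \<bullet> e - c) * (u x)\<^sup>2)"

lemma mirror_sign_mirror: "norm e = 1 \<Longrightarrow> mirror_sign e c u (reflection e c x) = mirror_sign e c u x"
  by (simp only: mirror_sign_def reflection_involution reflection_height sgn_minus)
    (simp only: mult_minus_left mult_minus_right[symmetric] minus_diff_eq)

text \<open>The pairs with opposite strict signs form a product set; it is null, so one of its
  factors is null.\<close>

lemma AE_positive_product: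
  fixes d :: "'a::euclidean_space \<Rightarrow> real"
  assumes [measurable]: "d \<in> borel_measurable borel" "H \<in> sets borel"
    and AE: "AE z in lborel \<Otimes>\<^sub>M lborel. fst z \<in> H \<longrightarrow> snd z \<in> H \<longrightarrow> 0 \<le> d (fst z) * d (snd z)"
  shows "(AE x in lborel. x \<in> H \<longrightarrow> 0 \<le> d x) \<or> (AE x in lborel. x \<in> H \<longrightarrow> d x \<le> 0)"
proof -
  define P where "P = {x \<in> H. 0 < d x}"
  define Q where "Q = {x \<in> H. d x < 0}"
  have [measurable]: "P \<in> sets borel" "Q \<in> sets borel" unfolding P_def Q_def by measurable
  have "AE z in lborel \<Otimes>\<^sub>M lborel. z \<notin> P \<times> Q"
    using AE by eventually_elim (auto simp: P_def Q_def zero_le_mult_iff)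
  moreover have PQ: "P \<times> Q \<in> sets (lborel \<Otimes>\<^sub>M lborel)" by (intro pair_measureI) auto
  ultimately have "P \<times> Q \<in> null_sets (lborel \<Otimes>\<^sub>M lborel)" by (simp add: AE_iff_null_sets)
  then have "emeasure lborel P * emeasure lborel Q = 0"
    using lborel.emeasure_pair_measure_Times[of P lborel Q] by (auto simp: null_sets_def)
  then have "P \<in> null_sets lborel \<or> Q \<in> null_sets lborel" by (auto simp: null_sets_def)
  then have "(AE x in lborel. x \<notin> P) \<or> (AE x in lborel. x \<notin> Q)"
    using AE_not_in by blast
  then show ?thesis
  proof
    assume "AE x in lborel. x \<notin> P"
    then have "AE x in lborel. x \<in> H \<longrightarrow> d x \<le> 0" by eventually_elim (auto simp: P_def)
    then show ?thesis ..
  next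
    assume "AE x in lborel. x \<notin> Q"
    then have "AE x in lborel. x \<in> H \<longrightarrow> 0 \<le> d x" by eventually_elim (auto simp: Q_def)
    then show ?thesis ..
  qed
qed

lemma two_pointI:
  fixes u :: "'a::euclidean_space \<Rightarrow> real"
  assumes um [measurable]: "u \<in> borel_measurable borel"
    and H: "\<And>e c. norm e = 1 \<Longrightarrow> AE z in lborel \<Otimes>\<^sub>M lborel. c < fst z \<bullet> e \<longrightarrow> c < snd z \<bullet> e \<longrightarrow>
      0 \<le> (u (fst z) - u (reflection e c (fst z))) * (u (snd z) - u (reflection e c (snd z)))"
  shows "two_point u"
  unfolding two_point_def
proof (intro allI impI)
  fix e :: 'a and c :: real
  assume e: "norm e = 1"
  have [measurable]: "reflection e c \<in> borel_measurable borel" unfolding reflection_def by measurable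
  have [measurable]: "{x. c < x \<bullet> e} \<in> sets borel" by measurable
  define d where "d x = u x - u (reflection e c x)" for x
  have *: "(AE x in lborel. x \<in> {x. c < x \<bullet> e} \<longrightarrow> 0 \<le> d x) \<or> (AE x in lborel. x \<in> {x. c < x \<bullet> e} \<longrightarrow> d x \<le> 0)"
  proof (rule AE_positive_product)
    show "d \<in> borel_measurable borel" unfolding d_def by measurable
    show "AE z in lborel \<Otimes>\<^sub>M lborel. fst z \<in> {x. c < x \<bullet> e} \<longrightarrow> snd z \<in> {x. c < x \<bullet> e} \<longrightarrow> 0 \<le> d (fst z) * d (snd z)"
      using H[OF e, of c] unfolding d_def mem_Collect_eq .
  qed measurable
  \<comment> \<open>A statement on the half-space extends across the mirror because
    \<open>mirror_sign\<close> agrees at mirror points; on the hyperplane itself it is 0.\<close>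
  have ext: "AE x in lborel. P (mirror_sign e c u x)"
    if A: "AE x in lborel. c < x \<bullet> e \<longrightarrow> P (d x)" and P0: "P 0" for P :: "real \<Rightarrow> bool"
    using A measure_preserving_AE[OF measure_preserving_reflection[OF e, of c] A]
  proof eventually_elim
    case (elim x)
    have pos: "mirror_sign e c u y = d y" if "c < y \<bullet> e" for y
      using that by (simp add: mirror_sign_def d_def)
    consider "c < x \<bullet> e" | "c < reflection e c x \<bullet> e" | "x \<bullet> e = c"
      using reflection_height[OF e, of c x] by linarith
    then show ?case
    proof cases
      case 2
      then show ?thesis using elim(2) pos[OF 2] mirror_sign_mirror[OF e, of c u x] by simp
    next
      case 3
      then show ?thesis using P0 by (simp add: mirror_sign_def)
    qed (use elim(1) pos in simp)
  qed
  show "(AE x in lborel. 0 \<le> mirror_sign e c u x) \<or> (AE x in lborel. mirror_sign e c u x \<le> 0)"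
    using * ext[of "\<lambda>t. 0 \<le> t", OF _ order_refl] ext[of "\<lambda>t. t \<le> 0", OF _ order_refl]
    unfolding mem_Collect_eq by blast
qed

lemma integrable_sgn_mult:
  fixes f :: "'a::euclidean_space \<Rightarrow> real"
  assumes f: "integrable lborel f"
  shows "integrable lborel (\<lambda>x. sgn (x \<bullet> e - c) * f x)"
proof (rule integrable_dominated[of _ "\<lambda>x. \<bar>f x\<bar>"])
  have [measurable]: "f \<in> borel_measurable borel" using f by auto
  show "(\<lambda>x. sgn (x \<bullet> e - c) * f x) \<in> borel_measurable lborel"
    unfolding sgn_if by measurable
  show "\<bar>sgn (x \<bullet> e - c) * f x\<bar> \<le> \<bar>f x\<bar>" for x by (simp add: abs_mult abs_sgn_eq)
qed (use f in simp)

text \<open>If \<open>imbalance\<close> has the wrong sign for the chosen order, the mirror difference of \<open>u\<^sup>2\<close> has a sign and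
  a nonpositive integral, so it vanishes.\<close>
lemma imbalance_mirror_sign:
  fixes u :: "'a::euclidean_space \<Rightarrow> real"
  assumes tp: "two_point u" and e: "norm e = 1" and sq: "sq_integrable lborel u" and nn: "\<And>x. 0 \<le> u x"
    and le: "imbalance e c u \<le> 0"
  shows "AE x in lborel. mirror_sign e c u x \<le> 0"
proof -
  note r = measure_preserving_reflection[OF e, of c]
  have [measurable]: "u \<in> borel_measurable borel" using sq by (simp add: sq_integrable_def)
  define h where "h x = mirror_sign e c u x * (u x + u (reflection e c x))" for x
  have heq: "h x = sgn (x \<bullet> e - c) * (u x)\<^sup>2 + sgn (reflection e c x \<bullet> e - c) * (u (reflection e c x))\<^sup>2" for x
  proof -
    have "sgn (reflection e c x \<bullet> e - c) = - sgn (x \<bullet> e - c)" by (simp only: reflection_height[OF e] sgn_minus)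
    then show ?thesis
      by (simp add: h_def mirror_sign_def power2_eq_square distrib_left left_diff_distrib right_diff_distrib)
  qed
  have i: "integrable lborel (\<lambda>x. sgn (x \<bullet> e - c) * (u x)\<^sup>2)"
    by (rule integrable_sgn_mult[OF sq_integrable_square[OF sq]])
  have m: "(\<lambda>x. sgn (x \<bullet> e - c) * (u x)\<^sup>2) \<in> borel_measurable borel" using i by auto
  note I = measure_preserving_integrable[OF r m] measure_preserving_integral[OF r m]
  have hi: "integrable lborel h" unfolding heq using i I(1) by simp
  have hI: "(LINT x|lborel. h x) = 2 * imbalance e c u"
    unfolding heq imbalance_def using i I by simp
  have "(AE x in lborel. 0 \<le> mirror_sign e c u x) \<or> (AE x in lborel. mirror_sign e c u x \<le> 0)"
    using tp e by (simp add: two_point_def)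
  then show ?thesis
  proof
    assume A: "AE x in lborel. 0 \<le> mirror_sign e c u x"
    then have h0: "AE x in lborel. 0 \<le> h x"
      by eventually_elim (use nn in \<open>simp add: h_def\<close>)
    then have "0 \<le> (LINT x|lborel. h x)" by (rule integral_nonneg_AE)
    then have "(LINT x|lborel. h x) = 0" using hI le by linarith
    then have "AE x in lborel. h x = 0" using integral_nonneg_eq_0_iff_AE[OF hi h0] by simp
    then show ?thesis
    proof eventually_elim
      case (elim x)
      then have "mirror_sign e c u x = 0 \<or> u x + u (reflection e c x) = 0" by (simp add: h_def)
      moreover have "u x = 0 \<and> u (reflection e c x) = 0" if "u x + u (reflection e c x) = 0"
        using that nn[of x] nn[of "reflection e c x"] by linarith
      ultimately show ?case by (auto simp: mirror_sign_def)
    qed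
  qed
qed

lemma mirror_sign_flip: "norm e = 1 \<Longrightarrow> mirror_sign (- e) (- c) u x = - mirror_sign e c u x"
proof -
  assume e: "norm e = 1"
  have "reflection (- e) (- c) x = reflection e c x" by (simp add: reflection_def algebra_simps)
  moreover have "x \<bullet> - e - - c = - (x \<bullet> e - c)" by simp
  ultimately show ?thesis by (simp only: mirror_sign_def sgn_minus mult_minus_left)
qed

lemma imbalance_flip: "imbalance (- e) (- c) u = - imbalance e c u"
proof -
  have "sgn (x \<bullet> - e - - c) * (u x)\<^sup>2 = - (sgn (x \<bullet> e - c) * (u x)\<^sup>2)" for x
  proof -
    have "x \<bullet> - e - - c = - (x \<bullet> e - c)" by simp
    then show ?thesis by (simp only: sgn_minus mult_minus_left)
  qed
  then show ?thesis by (simp only: imbalance_def integral_minus)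
qed

text \<open>Zero imbalance meets the hypothesis of \<open>imbalance_mirror_sign\<close> for both
  orientations of the normal, so the mirror difference is both at most and at least 0.\<close>

lemma balanced_imp_symmetric:
  fixes u :: "'a::euclidean_space \<Rightarrow> real"
  assumes tp: "two_point u" and e: "norm e = 1" and sq: "sq_integrable lborel u" and nn: "\<And>x. 0 \<le> u x"
    and eq: "imbalance e c u = 0"
  shows "mirror_symmetric e c u"
proof -
  have "AE x in lborel. mirror_sign e c u x \<le> 0"
    by (rule imbalance_mirror_sign[OF tp e sq nn]) (simp add: eq)
  moreover have "AE x in lborel. mirror_sign (- e) (- c) u x \<le> 0"
    by (rule imbalance_mirror_sign[OF tp _ sq nn]) (use e eq in \<open>simp_all add: imbalance_flip\<close>)
  ultimately show ?thesis
    unfolding mirror_symmetric_def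
  proof eventually_elim
    case (elim x)
    then have "mirror_sign e c u x = 0" by (simp add: mirror_sign_flip[OF e])
    then have "x \<bullet> e = c \<or> u x = u (reflection e c x)" by (auto simp: mirror_sign_def sgn_0_0)
    then show ?case by (auto simp: reflection_def)
  qed
qed

lemma hyperplane_AE: "norm (e::'a::euclidean_space) = 1 \<Longrightarrow> AE x in lborel. x \<bullet> e \<noteq> c"
proof -
  assume e: "norm e = 1"
  have "negligible {x. e \<bullet> x = c}" using e by (intro negligible_hyperplane) auto
  then have "{x. e \<bullet> x = c} \<in> null_sets lborel"
    by (subst null_sets_completion_iff[symmetric]) (auto simp: negligible_iff_null_sets)
  then have "AE x in lborel. x \<notin> {x. e \<bullet> x = c}" by (rule AE_not_in)
  then show ?thesis by (simp add: inner_commute)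
qed

lemma imbalance_tendsto:
  fixes u :: "'a::euclidean_space \<Rightarrow> real"
  assumes sq: "sq_integrable lborel u" and lim: "AE x in lborel. (\<lambda>n. sgn (x \<bullet> e - c n)) \<longlonglongrightarrow> l x"
    and l: "(\<lambda>x. l x * (u x)\<^sup>2) \<in> borel_measurable lborel"
  shows "(\<lambda>n. imbalance e (c n) u) \<longlonglongrightarrow> (LINT x|lborel. l x * (u x)\<^sup>2)"
  unfolding imbalance_def
proof (rule integral_dominated_convergence[OF l])
  have i: "integrable lborel (\<lambda>x. (u x)\<^sup>2)" by (rule sq_integrable_square[OF sq])
  then show "integrable lborel (\<lambda>x. (u x)\<^sup>2)" .
  show "(\<lambda>x. sgn (x \<bullet> e - c n) * (u x)\<^sup>2) \<in> borel_measurable lborel" for n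
    using integrable_sgn_mult[OF i] by auto
  show "AE x in lborel. (\<lambda>n. sgn (x \<bullet> e - c n) * (u x)\<^sup>2) \<longlonglongrightarrow> l x * (u x)\<^sup>2"
    using lim by eventually_elim (intro tendsto_mult_right)
  show "AE x in lborel. norm (sgn (x \<bullet> e - c n) * (u x)\<^sup>2) \<le> (u x)\<^sup>2" for n
    by (simp add: abs_mult abs_sgn_eq)
qed

text \<open>The intermediate value theorem in \<open>c\<close>: the imbalance tends to plus and
  minus the total mass at the two ends, and it is continuous because hyperplanes are null.\<close>

lemma balanced_exists:
  fixes u :: "'a::euclidean_space \<Rightarrow> real"
  assumes sq: "sq_integrable lborel u" and e: "norm e = 1"
  shows "\<exists>c. imbalance e c u = 0"
proof (cases "(LINT x|lborel. (u x)\<^sup>2) = 0")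
  case True
  then have "AE x in lborel. (u x)\<^sup>2 = 0"
    by (subst (asm) integral_nonneg_eq_0_iff_AE[OF sq_integrable_square[OF sq]]) auto
  then have "imbalance e 0 u = 0"
    unfolding imbalance_def by (intro integral_eq_zero_AE) (auto elim: eventually_mono)
  then show ?thesis ..
next
  case False
  then have M: "0 < (LINT x|lborel. (u x)\<^sup>2)" by (simp add: less_le)
  have um: "(\<lambda>x. (u x)\<^sup>2) \<in> borel_measurable lborel" using sq_integrable_square[OF sq] by auto
  have cont: "isCont (\<lambda>c. imbalance e c u) c" for c
  proof (rule continuous_at_sequentiallyI)
    fix t assume t: "t \<longlonglongrightarrow> c"
    have "(\<lambda>n. imbalance e (t n) u) \<longlonglongrightarrow> (LINT x|lborel. sgn (x \<bullet> e - c) * (u x)\<^sup>2)"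
    proof (rule imbalance_tendsto[OF sq])
      show "AE x in lborel. (\<lambda>n. sgn (x \<bullet> e - t n)) \<longlonglongrightarrow> sgn (x \<bullet> e - c)"
        using hyperplane_AE[OF e, of c]
        by eventually_elim (intro tendsto_sgn tendsto_diff tendsto_const t, simp)
      show "(\<lambda>x. sgn (x \<bullet> e - c) * (u x)\<^sup>2) \<in> borel_measurable lborel"
        using integrable_sgn_mult[OF sq_integrable_square[OF sq]] by auto
    qed
    then show "(\<lambda>n. imbalance e (t n) u) \<longlonglongrightarrow> imbalance e c u" by (simp add: imbalance_def)
  qed
  have "(\<lambda>n. imbalance e (real n) u) \<longlonglongrightarrow> (LINT x|lborel. (-1) * (u x)\<^sup>2)"
  proof (rule imbalance_tendsto[OF sq])
    show "AE x in lborel. (\<lambda>n. sgn (x \<bullet> e - real n)) \<longlonglongrightarrow> -1"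
    proof (rule AE_I2)
      fix x
      obtain n0 where "x \<bullet> e < real n0" using reals_Archimedean2 by blast
      then have "\<forall>\<^sub>F n in sequentially. sgn (x \<bullet> e - real n) = -1"
        by (intro eventually_sequentiallyI[of n0]) (auto intro!: sgn_neg)
      then show "(\<lambda>n. sgn (x \<bullet> e - real n)) \<longlonglongrightarrow> -1" by (rule tendsto_eventually)
    qed
  qed (use um in simp)
  then have "\<forall>\<^sub>F n in sequentially. imbalance e (real n) u < 0"
    using M by (intro order_tendstoD(2)) auto
  then obtain n where n: "imbalance e (real n) u < 0" by (auto simp: eventually_sequentially)
  have "(\<lambda>n. imbalance e (- real n) u) \<longlonglongrightarrow> (LINT x|lborel. 1 * (u x)\<^sup>2)"
  proof (rule imbalance_tendsto[OF sq])
    show "AE x in lborel. (\<lambda>n. sgn (x \<bullet> e - - real n)) \<longlonglongrightarrow> 1"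
    proof (rule AE_I2)
      fix x
      obtain n0 where "- (x \<bullet> e) < real n0" using reals_Archimedean2 by blast
      then have "\<forall>\<^sub>F n in sequentially. sgn (x \<bullet> e - - real n) = 1"
        by (intro eventually_sequentiallyI[of n0]) (auto intro!: sgn_pos)
      then show "(\<lambda>n. sgn (x \<bullet> e - - real n)) \<longlonglongrightarrow> 1" by (rule tendsto_eventually)
    qed
  qed (use um in simp)
  then have "\<forall>\<^sub>F n in sequentially. 0 < imbalance e (- real n) u"
    using M by (intro order_tendstoD(1)) auto
  then obtain m where m: "0 < imbalance e (- real m) u" by (auto simp: eventually_sequentially)
  have "\<exists>c. - real m \<le> c \<and> c \<le> real n \<and> imbalance e c u = 0"
    by (rule IVT2) (use n m cont in auto)
  then show ?thesis by blast
qed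

lemma reflection_translate: "reflection e c (z + x) = z + reflection e (c - z \<bullet> e) x"
  by (simp add: reflection_def inner_add_left algebra_simps)

lemma two_point_translate:
  fixes u :: "'a::euclidean_space \<Rightarrow> real"
  assumes tp: "two_point u"
  shows "two_point (\<lambda>x. u (z + x))"
  unfolding two_point_def
proof (intro allI impI)
  fix e :: 'a and c :: real assume e: "norm e = 1"
  have "mirror_sign e c (\<lambda>x. u (z + x)) x = mirror_sign e (c + z \<bullet> e) u (z + x)" for x
  proof -
    have "reflection e (c + z \<bullet> e) (z + x) = z + reflection e c x"
      using reflection_translate[of e "c + z \<bullet> e" z x] by simp
    moreover have "(z + x) \<bullet> e - (c + z \<bullet> e) = x \<bullet> e - c" by (simp add: inner_add_left)
    ultimately show ?thesis by (simp only: mirror_sign_def)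
  qed
  moreover have "(AE x in lborel. 0 \<le> mirror_sign e (c + z \<bullet> e) u x) \<or> (AE x in lborel. mirror_sign e (c + z \<bullet> e) u x \<le> 0)"
    using tp e by (simp add: two_point_def)
  ultimately show "(AE x in lborel. 0 \<le> mirror_sign e c (\<lambda>x. u (z + x)) x) \<or> (AE x in lborel. mirror_sign e c (\<lambda>x. u (z + x)) x \<le> 0)"
    using measure_preserving_AE[OF measure_preserving_translation[of z], of "\<lambda>x. 0 \<le> mirror_sign e (c + z \<bullet> e) u x"]
      measure_preserving_AE[OF measure_preserving_translation[of z], of "\<lambda>x. mirror_sign e (c + z \<bullet> e) u x \<le> 0"]
    by (simp only:) blast
qed

lemma mirror_symmetric_translate:
  assumes "mirror_symmetric e c u"
  shows "mirror_symmetric e (c - z \<bullet> e) (\<lambda>x. u (z + x))"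
  using measure_preserving_AE[OF measure_preserving_translation[of z] assms[unfolded mirror_symmetric_def]]
  by (simp add: mirror_symmetric_def reflection_translate)

text \<open>Hyperplanes halving the mass of \<open>u\<^sup>2\<close> in the coordinate directions meet in a centre of symmetry,
  and every hyperplane through the centre then halves the mass as well.\<close>
lemma two_point_centre:
  fixes u :: "'a::euclidean_space \<Rightarrow> real"
  assumes tp: "two_point u" and sq: "sq_integrable lborel u" and nn: "\<And>x. 0 \<le> u x"
  shows "\<exists>z. \<forall>e. norm e = 1 \<longrightarrow> mirror_symmetric e 0 (\<lambda>x. u (z + x))"
proof -
  have um [measurable]: "u \<in> borel_measurable borel" using sq by (simp add: sq_integrable_def)
  have "\<forall>b::'a. \<exists>c. b \<in> Basis \<longrightarrow> imbalance b c u = 0"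
    using balanced_exists[OF sq] by (metis norm_Basis)
  then obtain c where c: "\<And>b. b \<in> Basis \<Longrightarrow> imbalance b (c b) u = 0" by metis
  define z where "z = (\<Sum>b\<in>Basis. c b *\<^sub>R b)"
  have zb: "z \<bullet> b = c b" if "b \<in> Basis" for b using that by (simp add: z_def)
  define v where "v x = u (z + x)" for x
  have vtp: "two_point v" unfolding v_def by (rule two_point_translate[OF tp])
  have vm [measurable]: "v \<in> borel_measurable borel" unfolding v_def by measurable
  have "integrable lborel (\<lambda>x. (v x)\<^sup>2)"
    unfolding v_def using sq_integrable_square[OF sq]
    by (subst measure_preserving_integrable[OF measure_preserving_translation, of "\<lambda>x. (u x)\<^sup>2"]) auto
  then have vsq: "sq_integrable lborel v" by (simp add: sq_integrable_def)
  have vsym: "mirror_symmetric b 0 v" if "b \<in> Basis" for b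
  proof -
    have "mirror_symmetric b (c b) u" using that by (intro balanced_imp_symmetric[OF tp _ sq nn] c) auto
    then show ?thesis using mirror_symmetric_translate[of b "c b" u z] zb[OF that] by (simp add: v_def[abs_def])
  qed
  \<comment> \<open>The composition of the reflections in the coordinate directions in
    \<open>B\<close>; for the full basis it is negation, so \<open>v\<close> turns out to be
    even.\<close>
  define T where "T B x = x - (\<Sum>b\<in>B. (2 * (x \<bullet> b)) *\<^sub>R b)" for B and x :: 'a
  have "measure_preserving (T B) \<and> (AE x in lborel. v (T B x) = v x)" if "finite B" "B \<subseteq> Basis" for B
    using that
  proof (induction B)
    case empty
    then show ?case using measure_preserving_id by (simp add: T_def)
  next
    case (insert b B)
    have b: "b \<in> Basis" and nb: "norm b = 1" using insert by auto
    have Tb: "T (insert b B) = (\<lambda>x. reflection b 0 (T B x))"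
    proof
      fix x
      have "(\<Sum>b'\<in>B. (2 * (x \<bullet> b')) *\<^sub>R b') \<bullet> b = (\<Sum>b'\<in>B. 2 * (x \<bullet> b') * (b' \<bullet> b))"
        by (simp add: inner_sum_left)
      also have "\<dots> = 0"
      proof (rule sum.neutral, rule ballI)
        fix b' assume "b' \<in> B"
        then have "b' \<bullet> b = 0" using insert by (intro inner_not_same_Basis) auto
        then show "2 * (x \<bullet> b') * (b' \<bullet> b) = 0" by simp
      qed
      finally have "T B x \<bullet> b = x \<bullet> b" by (simp add: T_def inner_diff_left)
      then show "T (insert b B) x = reflection b 0 (T B x)"
        using insert by (simp add: reflection_def) (simp add: T_def algebra_simps)
    qed
    have mp: "measure_preserving (T B)" and sym: "AE x in lborel. v (T B x) = v x" using insert by auto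
    have "AE x in lborel. v (reflection b 0 (T B x)) = v (T B x)"
      by (rule measure_preserving_AE[OF mp vsym[OF b, unfolded mirror_symmetric_def]])
    then have "AE x in lborel. v (T (insert b B) x) = v x"
      using sym by eventually_elim (simp add: Tb)
    then show ?case unfolding Tb
      using measure_preserving_comp[OF measure_preserving_reflection[OF nb] mp] by simp
  qed
  from this[of Basis] have "AE x in lborel. v (T Basis x) = v x" by simp
  moreover have "T Basis x = - x" for x
  proof -
    have "(\<Sum>b\<in>Basis. (2 * (x \<bullet> b)) *\<^sub>R b) = 2 *\<^sub>R (\<Sum>b\<in>Basis. (x \<bullet> b) *\<^sub>R b)"
      by (simp add: scaleR_sum_right)
    then show ?thesis by (simp add: T_def euclidean_representation scaleR_2)
  qed
  ultimately have even: "AE x in lborel. v (- x) = v x" by simp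
  \<comment> \<open>For an even function the odd factor \<open>sgn (x \<bullet> e)\<close> makes the
    imbalance vanish in every direction, not only along the axes.\<close>
  have "mirror_symmetric e 0 v" if e: "norm e = 1" for e
  proof (rule balanced_imp_symmetric[OF vtp e vsq])
    show "0 \<le> v x" for x using nn by (simp add: v_def)
    have m: "(\<lambda>x. sgn (x \<bullet> e - 0) * (v x)\<^sup>2) \<in> borel_measurable borel"
      using integrable_sgn_mult[OF sq_integrable_square[OF vsq], of e 0] by auto
    have "imbalance e 0 v = (LINT x|lborel. sgn (- x \<bullet> e - 0) * (v (- x))\<^sup>2)"
      unfolding imbalance_def by (rule measure_preserving_integral[OF measure_preserving_uminus m, symmetric])
    also have "\<dots> = (LINT x|lborel. - (sgn (x \<bullet> e - 0) * (v x)\<^sup>2))"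
    proof (rule integral_cong_AE)
      show "AE x in lborel. sgn (- x \<bullet> e - 0) * (v (- x))\<^sup>2 = - (sgn (x \<bullet> e - 0) * (v x)\<^sup>2)"
        using even by eventually_elim (simp add: sgn_minus)
      show "(\<lambda>x. sgn (- x \<bullet> e - 0) * (v (- x))\<^sup>2) \<in> borel_measurable lborel"
        using measurable_compose[OF measure_preserving_measurable[OF measure_preserving_uminus] m] by simp
    qed (use m in simp)
    also have "\<dots> = - imbalance e 0 v" by (simp add: imbalance_def)
    finally show "imbalance e 0 v = 0" by simp
  qed
  then show ?thesis by (auto simp: v_def[abs_def])
qed

text \<open>Both functions are compared with their mirror images in the hyperplane bisecting the two centres.\<close>
lemma centred_overlap:
  fixes f g :: "'a::euclidean_space \<Rightarrow> real"
  assumes f: "two_point f" "sq_integrable lborel f" "int4 f" "\<And>x. 0 \<le> f x" "\<And>e. norm e = 1 \<Longrightarrow> mirror_symmetric e 0 f"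
    and g: "two_point g" "sq_integrable lborel g" "int4 g" "\<And>x. 0 \<le> g x" "\<And>e. norm e = 1 \<Longrightarrow> mirror_symmetric e 0 g"
  shows "(LINT x|lborel. (f x)\<^sup>2 * (g (x - d))\<^sup>2) \<le> (LINT x|lborel. (f x)\<^sup>2 * (g x)\<^sup>2)"
proof (cases "d = 0")
  case False
  define e where "e = d /\<^sub>R norm d"
  \<comment> \<open>The hyperplane bisects the segment from 0 to \<open>d\<close>; \<open>f\<close>
    and \<open>g\<close> are both centred at 0, on its lower side.\<close>
  define c where "c = norm d / 2"
  have e: "norm e = 1" and c: "c > 0" and d: "d = (2 * c) *\<^sub>R e" using False by (auto simp: e_def c_def)
  define \<sigma> where "\<sigma> = reflection e c"
  note r = measure_preserving_reflection[OF e, of c, folded \<sigma>_def]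
  have [measurable]: "f \<in> borel_measurable borel" "g \<in> borel_measurable borel" "\<sigma> \<in> borel_measurable borel"
    using f(3) g(3) r by auto
  \<comment> \<open>The imbalance is 0 for the hyperplane through the centre and cannot grow when
    the hyperplane is raised to \<open>c > 0\<close>, so each function is larger on the side of its
    centre.\<close>
  have neg: "AE x in lborel. mirror_sign e c h x \<le> 0"
    if h: "two_point h" "sq_integrable lborel h" "\<And>x. 0 \<le> h x" "mirror_symmetric e 0 h" for h :: "'a \<Rightarrow> real"
  proof (rule imbalance_mirror_sign[OF h(1) e h(2,3)])
    have i: "integrable lborel (\<lambda>x. sgn (x \<bullet> e - t) * (h x)\<^sup>2)" for t
      by (rule integrable_sgn_mult[OF sq_integrable_square[OF h(2)]])
    have hm [measurable]: "h \<in> borel_measurable borel" using h(2) by (simp add: sq_integrable_def)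
    note r0 = measure_preserving_reflection[OF e, of 0]
    have m: "(\<lambda>x. sgn (x \<bullet> e - 0) * (h x)\<^sup>2) \<in> borel_measurable borel" using i[of 0] by auto
    have "imbalance e 0 h = (LINT x|lborel. sgn (reflection e 0 x \<bullet> e - 0) * (h (reflection e 0 x))\<^sup>2)"
      unfolding imbalance_def by (rule measure_preserving_integral[OF r0 m, symmetric])
    also have "\<dots> = (LINT x|lborel. - (sgn (x \<bullet> e - 0) * (h x)\<^sup>2))"
    proof (rule integral_cong_AE)
      show "AE x in lborel. sgn (reflection e 0 x \<bullet> e - 0) * (h (reflection e 0 x))\<^sup>2 = - (sgn (x \<bullet> e - 0) * (h x)\<^sup>2)"
        using h(4)[unfolded mirror_symmetric_def] by eventually_elim (simp only: reflection_height[OF e] sgn_minus mult_minus_left)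
      show "(\<lambda>x. sgn (reflection e 0 x \<bullet> e - 0) * (h (reflection e 0 x))\<^sup>2) \<in> borel_measurable lborel"
        using measurable_compose[OF measure_preserving_measurable[OF r0] m] by simp
    qed (use m in simp)
    also have "\<dots> = - imbalance e 0 h" by (simp add: imbalance_def)
    finally have "imbalance e 0 h = 0" by simp
    moreover have "imbalance e c h \<le> imbalance e 0 h"
      unfolding imbalance_def
      by (rule integral_mono[OF i i], rule mult_right_mono) (use c in \<open>auto simp: sgn_if\<close>)
    ultimately show "imbalance e c h \<le> 0" by simp
  qed
  have fi: "int4 (\<lambda>x. f (\<sigma> x))" and gi: "int4 (\<lambda>x. g (\<sigma> x))"
    using f(3) g(3) measure_preserving_integrable[OF r, of "\<lambda>x. (f x)^4"] measure_preserving_integrable[OF r, of "\<lambda>x. (g x)^4"]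
    by (auto simp: int4_def)
  define h where "h x = (f x)\<^sup>2 * (g x)\<^sup>2 + (f (\<sigma> x))\<^sup>2 * (g (\<sigma> x))\<^sup>2 - (f x)\<^sup>2 * (g (\<sigma> x))\<^sup>2 - (f (\<sigma> x))\<^sup>2 * (g x)\<^sup>2" for x
  have "0 \<le> (LINT x|lborel. h x)"
  proof (rule integral_nonneg_AE)
    show "AE x in lborel. 0 \<le> h x"
      using neg[OF f(1,2,4) f(5)[OF e]] neg[OF g(1,2,4) g(5)[OF e]]
    proof eventually_elim
      case (elim x)
      \<comment> \<open>The two factors always have the same sign, which means that mirroring
        \<open>g\<close> alone can only lose overlap.\<close>
      have heq: "h x = ((f x)\<^sup>2 - (f (\<sigma> x))\<^sup>2) * ((g x)\<^sup>2 - (g (\<sigma> x))\<^sup>2)" by (simp add: h_def algebra_simps)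
      have mono: "a\<^sup>2 \<le> b\<^sup>2" if "0 \<le> a" "a \<le> b" for a b :: real using that by (intro power_mono) auto
      consider "x \<bullet> e = c" | "c < x \<bullet> e" | "x \<bullet> e < c" by linarith
      then show ?case
      proof cases
        case 1
        then have "\<sigma> x = x" by (simp add: \<sigma>_def reflection_def)
        then show ?thesis by (simp add: heq)
      next
        case 2
        then have "f x \<le> f (\<sigma> x)" "g x \<le> g (\<sigma> x)" using elim by (auto simp: mirror_sign_def \<sigma>_def)
        then show ?thesis unfolding heq using mono f(4) g(4) by (intro mult_nonpos_nonpos) auto
      next
        case 3
        then have "f (\<sigma> x) \<le> f x" "g (\<sigma> x) \<le> g x" using elim by (auto simp: mirror_sign_def \<sigma>_def)
        then show ?thesis unfolding heq using mono f(4) g(4) by (intro mult_nonneg_nonneg) auto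
      qed
    qed
  qed
  moreover have "(LINT x|lborel. h x) = 2 * (LINT x|lborel. (f x)\<^sup>2 * (g x)\<^sup>2) - 2 * (LINT x|lborel. (f x)\<^sup>2 * (g (\<sigma> x))\<^sup>2)"
  proof -
    have 1: "(LINT x|lborel. (f (\<sigma> x))\<^sup>2 * (g (\<sigma> x))\<^sup>2) = (LINT x|lborel. (f x)\<^sup>2 * (g x)\<^sup>2)"
      by (rule measure_preserving_integral[OF r, of "\<lambda>x. (f x)\<^sup>2 * (g x)\<^sup>2"]) measurable
    have "(LINT x|lborel. (f (\<sigma> x))\<^sup>2 * (g (\<sigma> (\<sigma> x)))\<^sup>2) = (LINT x|lborel. (f x)\<^sup>2 * (g (\<sigma> x))\<^sup>2)"
      by (rule measure_preserving_integral[OF r, of "\<lambda>x. (f x)\<^sup>2 * (g (\<sigma> x))\<^sup>2"]) measurable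
    then have 2: "(LINT x|lborel. (f (\<sigma> x))\<^sup>2 * (g x)\<^sup>2) = (LINT x|lborel. (f x)\<^sup>2 * (g (\<sigma> x))\<^sup>2)"
      by (simp add: \<sigma>_def reflection_involution[OF e])
    show ?thesis unfolding h_def
      using int4_integrable_square_mult[OF f(3) g(3)] int4_integrable_square_mult[OF fi gi]
        int4_integrable_square_mult[OF f(3) gi] int4_integrable_square_mult[OF fi g(3)] 1 2 by simp
  qed
  moreover have "(LINT x|lborel. (f x)\<^sup>2 * (g (x - d))\<^sup>2) = (LINT x|lborel. (f x)\<^sup>2 * (g (\<sigma> x))\<^sup>2)"
  proof (rule integral_cong_AE)
    have "AE x in lborel. g (reflection e 0 (- d + x)) = g (- d + x)"
      by (rule measure_preserving_AE[OF measure_preserving_translation g(5)[OF e, unfolded mirror_symmetric_def]])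
    \<comment> \<open>A shift by \<open>- d\<close> followed by the reflection through 0 is
      \<open>\<sigma>\<close>, so by the symmetry of \<open>g\<close> the shifted function agrees
      almost everywhere with the mirrored one.\<close>
    moreover have "reflection e 0 (- d + x) = \<sigma> x" for x
      using inner_self_unit[OF e]
      by (simp add: d \<sigma>_def reflection_def inner_add_left algebra_simps) (simp flip: scaleR_add_left scaleR_diff_left)
    ultimately show "AE x in lborel. (f x)\<^sup>2 * (g (x - d))\<^sup>2 = (f x)\<^sup>2 * (g (\<sigma> x))\<^sup>2"
      by (auto elim: eventually_mono)
  qed measurable
  ultimately show ?thesis by linarith
qed simp

section \<open>The radial ground state\<close>

text \<open>Each reflection has its own exceptional null set, and there may be uncountably many of
  them. Averages over balls remove these sets: they are equal at points of equal norm, and by the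
  deviation estimate they converge to \<open>v\<close> almost everywhere.\<close>

lemma radial_representative:
  fixes v :: "'a::euclidean_space \<Rightarrow> real"
  assumes v: "Hs s v" and s: "0 < s" and nn: "\<And>x. 0 \<le> v x" and sym: "\<And>e. norm e = 1 \<Longrightarrow> mirror_symmetric e 0 v"
  shows "\<exists>w. w \<in> borel_measurable borel \<and> (AE x in lborel. w x = v x) \<and> radial w \<and> (\<forall>x. 0 \<le> w x)"
proof -
  have [measurable]: "v \<in> borel_measurable borel" using v by auto
  define r where "r n = inverse (real (Suc n))" for n
  have r: "r n > 0" for n by (simp add: r_def)
  define A where "A n x = average (ball x (r n)) v" for n x
  have Am: "A n \<in> borel_measurable borel" for n
  proof -
    have "(\<lambda>x. LINT y|lborel. (if dist x y < r n then v y else 0)) \<in> borel_measurable (lborel :: 'a measure)"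
    proof (rule lborel.borel_measurable_lebesgue_integral)
      show "(\<lambda>(x, y). if dist x y < r n then v y else 0) \<in> borel_measurable (lborel \<Otimes>\<^sub>M lborel)"
        unfolding case_prod_beta by measurable
    qed
    moreover have "(if dist x y < r n then v y else 0) = indicator (ball x (r n)) y * v y" for x y :: 'a
      by (simp add: indicator_def)
    ultimately have m: "(\<lambda>x. LINT y|lborel. indicator (ball x (r n)) y * v y) \<in> borel_measurable borel" by simp
    have b: "measure lborel (ball x (r n)) = r n ^ DIM('a) * measure lborel (ball (0::'a) 1)" for x :: 'a
      using r[of n] by (intro measure_ball_scale) simp
    show ?thesis unfolding A_def average_def b by (intro borel_measurable_divide borel_measurable_const m)
  qed
  have Anorm: "A n x = A n y" if xy: "norm x = norm y" for n x y
  proof (cases "x = y")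
    case False
    \<comment> \<open>The bisecting hyperplane of \<open>x\<close> and \<open>y\<close> passes
      through 0 because their norms agree, so the reflection through 0 exchanges them.\<close>
    define e where "e = (x - y) /\<^sub>R norm (x - y)"
    have e: "norm e = 1" using False by (simp add: e_def)
    have n0: "norm (x - y) \<noteq> 0" using False by simp
    have "x \<bullet> x = y \<bullet> y" using xy by (simp add: norm_eq)
    then have eq: "2 * (x \<bullet> (x - y)) = (norm (x - y))\<^sup>2"
      by (simp add: power2_norm_eq_inner inner_diff_left inner_diff_right inner_commute)
    have "x \<bullet> e = inverse (norm (x - y)) * (x \<bullet> (x - y))"
      unfolding e_def by (rule inner_scaleR_right)
    then have "2 * (x \<bullet> e) = inverse (norm (x - y)) * (2 * (x \<bullet> (x - y)))" by simp
    also have "\<dots> = norm (x - y)" unfolding eq using n0 by (simp add: power2_eq_square)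
    finally have "2 * (x \<bullet> e) = norm (x - y)" .
    then have "(2 * (x \<bullet> e)) *\<^sub>R e = x - y" using n0 by (simp add: e_def)
    then have ry: "reflection e 0 x = y" by (simp add: reflection_def)
    note mp = measure_preserving_reflection[OF e, of 0]
    have [measurable]: "reflection e 0 \<in> borel_measurable borel" using mp by auto
    have [measurable]: "ball x (r n) \<in> sets borel" "ball y (r n) \<in> sets borel" by auto
    have "(LINT t|lborel. indicator (ball y (r n)) t * v t)
      = (LINT t|lborel. indicator (ball y (r n)) (reflection e 0 t) * v (reflection e 0 t))"
      by (rule measure_preserving_integral[OF mp, symmetric]) measurable
    also have "\<dots> = (LINT t|lborel. indicator (ball x (r n)) t * v t)"
    proof (rule integral_cong_AE)
      show "AE t in lborel. indicator (ball y (r n)) (reflection e 0 t) * v (reflection e 0 t) = indicator (ball x (r n)) t * v t"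
        using sym[OF e, unfolded mirror_symmetric_def]
      proof eventually_elim
        case (elim t)
        have "dist y (reflection e 0 t) = dist x t"
          using norm_reflection_diff[OF e, of 0 x t] by (simp add: ry dist_norm)
        then show ?case using elim by (simp add: indicator_def)
      qed
    qed measurable
    finally show ?thesis
      using r[of n] by (simp add: A_def average_def measure_ball_scale[of "r n" x] measure_ball_scale[of "r n" y])
  qed simp
  have rlim: "r \<longlonglongrightarrow> 0" unfolding r_def by (rule LIMSEQ_inverse_real_of_nat)
  have lim: "AE x in lborel. (\<lambda>n. A n x) \<longlonglongrightarrow> v x"
    using AE_integrable_dquot[OF v]
  proof eventually_elim
    case (elim x)
    define K where "K = gag_density s v x / measure lborel (ball (0::'a) 1)"
    have "(\<lambda>n. r n powr (2 * s) * K) \<longlonglongrightarrow> 0 powr (2 * s) * K"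
      by (intro tendsto_mult_right tendsto_powr' rlim tendsto_const) (use s r in \<open>auto simp: less_imp_le\<close>)
    then have z: "(\<lambda>n. r n powr (2 * s) * K) \<longlonglongrightarrow> 0" by simp
    have le: "(v x - A n x)\<^sup>2 \<le> r n powr (2 * s) * K" for n
      using ball_average_deviation[OF _ r s elim, of n] v by (simp add: A_def K_def Hs_iff)
    have "(\<lambda>n. (v x - A n x)\<^sup>2) \<longlonglongrightarrow> 0"
      by (rule tendsto_sandwich[OF _ _ tendsto_const z]) (use le in \<open>auto intro: always_eventually\<close>)
    then have "(\<lambda>n. v x - A n x) \<longlonglongrightarrow> 0" by (simp add: tendsto_null_power)
    from tendsto_diff[OF tendsto_const[of "v x"] this] show ?case by simp
  qed
  \<comment> \<open>The value depends on \<open>x\<close> only through the sequence of averages, so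
    \<open>w\<close> is radial even where the limit fails to exist; \<open>max 0\<close> keeps it
    nonnegative there.\<close>
  define w where "w x = max 0 (lim (\<lambda>n. A n x))" for x
  have "w \<in> borel_measurable borel"
    unfolding w_def by (intro borel_measurable_max borel_measurable_lim_metric Am) simp
  moreover have "AE x in lborel. w x = v x"
    using lim by eventually_elim (use nn in \<open>simp add: w_def limI\<close>)
  moreover have "radial w"
    unfolding radial_def
  proof (intro allI impI)
    fix x y :: 'a assume "norm x = norm y"
    then have "(\<lambda>n. A n x) = (\<lambda>n. A n y)" by (intro ext Anorm)
    then show "w x = w y" by (simp only: w_def)
  qed
  ultimately show ?thesis by (intro exI[of _ w]) (simp add: w_def)
qed

context coupled_system
begin

section \<open>Maximisers and the sign of their couplings\<close>

definition mixed :: "(nat \<Rightarrow> 'a \<Rightarrow> real) \<Rightarrow> nat \<Rightarrow> nat \<Rightarrow> real" where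
  "mixed u i j = (LINT x|lborel. (u i x)\<^sup>2 * (u j x)\<^sup>2)"

lemma mixed_commute: "mixed u i j = mixed u j i"
  unfolding mixed_def by (intro Bochner_Integration.integral_cong) auto

lemma quart_mixed: "quart u = (\<Sum>i\<in>{1..3}. \<Sum>j\<in>{1..3}. coef i j * mixed u i j)"
  unfolding quart_def mixed_def ..

lemma mixed_nonneg: "0 \<le> mixed u i j"
  unfolding mixed_def by (intro Bochner_Integration.integral_nonneg) simp

lemma coef_sym: "i \<in> {1..3} \<Longrightarrow> j \<in> {1..3} \<Longrightarrow> coef i j = coef j i"
  using beta_sym by (auto simp: coef_def)

lemma quart_split:
  assumes j: "j \<in> {1..3}"
  shows "quart u = mu j * mixed u j j + 2 * (\<Sum>k\<in>{1..3}-{j}. beta j k * mixed u j k)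
    + (\<Sum>i\<in>{1..3}-{j}. \<Sum>k\<in>{1..3}-{j}. coef i k * mixed u i k)"
proof -
  define g where "g i k = coef i k * mixed u i k" for i k
  have gs: "g i k = g k i" if "i \<in> {1..3}" "k \<in> {1..3}" for i k
    using coef_sym[OF that] mixed_commute[of u i k] by (simp add: g_def)
  have "quart u = (\<Sum>i\<in>{1..3}. g i j + (\<Sum>k\<in>{1..3}-{j}. g i k))"
    unfolding quart_mixed g_def[symmetric] using j by (intro sum.cong refl sum.remove) auto
  also have "\<dots> = (\<Sum>i\<in>{1..3}. g i j) + (\<Sum>i\<in>{1..3}. \<Sum>k\<in>{1..3}-{j}. g i k)"
    by (rule sum.distrib)
  also have "(\<Sum>i\<in>{1..3}. g i j) = g j j + (\<Sum>i\<in>{1..3}-{j}. g i j)"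
    using j by (intro sum.remove) auto
  also have "(\<Sum>i\<in>{1..3}-{j}. g i j) = (\<Sum>k\<in>{1..3}-{j}. g j k)"
    using j gs by (intro sum.cong) auto
  also have "(\<Sum>i\<in>{1..3}. \<Sum>k\<in>{1..3}-{j}. g i k)
      = (\<Sum>k\<in>{1..3}-{j}. g j k) + (\<Sum>i\<in>{1..3}-{j}. \<Sum>k\<in>{1..3}-{j}. g i k)"
    using j by (intro sum.remove) auto
  finally have "quart u = g j j + 2 * (\<Sum>k\<in>{1..3}-{j}. g j k) + (\<Sum>i\<in>{1..3}-{j}. \<Sum>k\<in>{1..3}-{j}. g i k)" by simp
  moreover have "(\<Sum>k\<in>{1..3}-{j}. g j k) = (\<Sum>k\<in>{1..3}-{j}. beta j k * mixed u j k)"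
    by (intro sum.cong) (auto simp: g_def coef_def)
  moreover have "g j j = mu j * mixed u j j" by (simp add: g_def coef_def)
  ultimately show ?thesis by (simp add: g_def)
qed

definition maximiser :: "(nat \<Rightarrow> 'a \<Rightarrow> real) \<Rightarrow> bool" where
  "maximiser u \<longleftrightarrow> Hs3 u \<and> nrm u = 1 \<and> quart u = Smax"

text \<open>After absolute values, polarisation or recentring only inequalities are at hand;
  homogeneity turns them into equalities.\<close>

lemma maximiserI:
  assumes u: "Hs3 u" and n: "nrm u \<le> 1" and q: "Smax \<le> quart u"
  shows "maximiser u"
proof -
  have "Smax * 1 \<le> Smax * (nrm u)\<^sup>2" using q quart_le_Smax[OF u] by simp
  then have "1 \<le> (nrm u)\<^sup>2" using Smax_pos by (simp only: mult_le_cancel_left_pos)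
  then have "1 \<le> nrm u" using power2_le_imp_le[of 1 "nrm u"] nrm_nonneg[of u] by simp
  then have "nrm u = 1" using n by simp
  moreover have "quart u \<le> Smax" using quart_le_Smax1[OF u n] .
  ultimately show ?thesis using u q by (simp add: maximiser_def)
qed

lemma maximiser_cong_AE:
  assumes u: "maximiser u" and w: "\<And>j. j \<in> {1..3} \<Longrightarrow> w j \<in> borel_measurable borel"
    and eq: "\<And>j. j \<in> {1..3} \<Longrightarrow> AE x in lborel. w j x = u j x"
  shows "maximiser w"
proof -
  have uH: "Hs3 u" and u1: "nrm u = 1" and uS: "quart u = Smax" using u by (auto simp: maximiser_def)
  have um: "u j \<in> borel_measurable borel" if "j \<in> {1..3}" for j using Hs3D[OF uH that] by auto
  have "Hs3 w" unfolding Hs3_def using Hs_cong_AE(1)[OF Hs3D[OF uH] w eq] by blast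
  moreover have "jnorm2 s (lam j) (w j) = jnorm2 s (lam j) (u j)" if j: "j \<in> {1..3}" for j
  proof -
    have "(LINT x|lborel. (w j x)\<^sup>2) = (LINT x|lborel. (u j x)\<^sup>2)"
      by (rule integral_cong_AE) (use w[OF j] um[OF j] eq[OF j] in \<open>auto elim: eventually_mono\<close>)
    then show ?thesis using Hs_cong_AE(3)[OF Hs3D[OF uH j] w[OF j] eq[OF j]] by (simp add: jnorm2_eq)
  qed
  then have "nrm w = nrm u" unfolding nrm_def by (rule sum.cong[OF refl])
  moreover have "mixed w i j = mixed u i j" if ij: "i \<in> {1..3}" "j \<in> {1..3}" for i j
    unfolding mixed_def
  proof (rule integral_cong_AE)
    show "AE x in lborel. (w i x)\<^sup>2 * (w j x)\<^sup>2 = (u i x)\<^sup>2 * (u j x)\<^sup>2"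
      using eq[OF ij(1)] eq[OF ij(2)] by eventually_elim simp
  qed (use w um ij in auto)
  then have "quart w = quart u" unfolding quart_mixed by (intro sum.cong refl arg_cong2[where f="(*)"])
  ultimately show ?thesis using u1 uS by (simp add: maximiser_def)
qed

text \<open>With square roots as factors the squared norm is linear and the quartic part a quadratic
  form in \<open>t\<close>, so an exchange of energy becomes motion along a line.\<close>

lemma nrm_quart_rescale:
  "nrm (\<lambda>k x. sqrt (t k) * u k x) = (\<Sum>k\<in>{1..3}. t k * jnorm2 s (lam k) (u k))"
  "quart (\<lambda>k x. sqrt (t k) * u k x) = (\<Sum>i\<in>{1..3}. \<Sum>j\<in>{1..3}. coef i j * (t i * t j) * mixed u i j)"
  if "\<And>k. 0 \<le> t k"
proof -
  show "nrm (\<lambda>k x. sqrt (t k) * u k x) = (\<Sum>k\<in>{1..3}. t k * jnorm2 s (lam k) (u k))"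
    using that by (simp add: nrm_def jnorm2_cmult)
  have "mixed (\<lambda>k x. sqrt (t k) * u k x) i j = (t i * t j) * mixed u i j" for i j
  proof -
    have "(sqrt (t i) * a)\<^sup>2 * (sqrt (t j) * b)\<^sup>2 = (t i * t j) * (a\<^sup>2 * b\<^sup>2)" for a b :: real
      using that by (simp add: power_mult_distrib mult_ac)
    then show ?thesis unfolding mixed_def by (simp only: integral_mult_right_zero)
  qed
  then show "quart (\<lambda>k x. sqrt (t k) * u k x) = (\<Sum>i\<in>{1..3}. \<Sum>j\<in>{1..3}. coef i j * (t i * t j) * mixed u i j)"
    unfolding quart_mixed by (simp add: mult.assoc)
qed

text \<open>An exact identity in place of differentiation: the values at \<open>1 + d\<close> and
  \<open>1 - d\<close> have mean \<open>quart u\<close> plus the quadratic form of \<open>d\<close>,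
  and both are at most \<open>Smax\<close>. The bound on \<open>d\<close> keeps the quantities under
  the root nonnegative.\<close>

lemma second_variation:
  assumes u: "maximiser u" and d1: "\<And>k. \<bar>d k\<bar> \<le> 1" and d0: "(\<Sum>k\<in>{1..3}. d k * jnorm2 s (lam k) (u k)) = 0"
  shows "(\<Sum>i\<in>{1..3}. \<Sum>j\<in>{1..3}. coef i j * (d i * d j) * mixed u i j) \<le> 0"
proof -
  have uH: "Hs3 u" and u1: "nrm u = 1" and uS: "quart u = Smax" using u by (auto simp: maximiser_def)
  have var: "(\<Sum>i\<in>{1..3}. \<Sum>j\<in>{1..3}. coef i j * ((1 + p * d i) * (1 + p * d j)) * mixed u i j) \<le> Smax"
    if p: "p = 1 \<or> p = - 1" for p :: real
  proof -
    have t: "0 \<le> 1 + p * d k" for k using p d1[of k] by auto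
    define v where "v = (\<lambda>k x. sqrt (1 + p * d k) * u k x)"
    have "nrm v = (\<Sum>k\<in>{1..3}. jnorm2 s (lam k) (u k) + p * (d k * jnorm2 s (lam k) (u k)))"
      unfolding v_def nrm_quart_rescale(1)[of "\<lambda>k. 1 + p * d k", OF t] by (simp add: algebra_simps)
    also have "\<dots> = nrm u + p * (\<Sum>k\<in>{1..3}. d k * jnorm2 s (lam k) (u k))"
      by (simp only: sum.distrib sum_distrib_left nrm_def)
    finally have "nrm v \<le> 1" using u1 d0 by simp
    moreover have "Hs3 v" using uH by (simp add: v_def Hs3_def Hs_cmult)
    ultimately have "quart v \<le> Smax" by (intro quart_le_Smax1)
    then show ?thesis unfolding v_def nrm_quart_rescale(2)[of "\<lambda>k. 1 + p * d k", OF t] .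
  qed
  have "(\<Sum>i\<in>{1..3}. \<Sum>j\<in>{1..3}. coef i j * ((1 + 1 * d i) * (1 + 1 * d j)) * mixed u i j)
     + (\<Sum>i\<in>{1..3}. \<Sum>j\<in>{1..3}. coef i j * ((1 + (-1) * d i) * (1 + (-1) * d j)) * mixed u i j)
     = 2 * (\<Sum>i\<in>{1..3}. \<Sum>j\<in>{1..3}. coef i j * mixed u i j) + 2 * (\<Sum>i\<in>{1..3}. \<Sum>j\<in>{1..3}. coef i j * (d i * d j) * mixed u i j)"
    unfolding sum.distrib[symmetric] sum_distrib_left by (intro sum.cong refl) (simp add: algebra_simps)
  then show ?thesis using var[of 1] var[of "-1"] uS unfolding quart_mixed by simp
qed

text \<open>Along the segment trading the energy of two components against each other the quotient is strictly
  convex when their coupling is not positive, so a maximiser cannot carry both.\<close>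
lemma maximiser_coupling_pos:
  assumes u: "maximiser u" and ij: "i \<in> {1..3}" "j \<in> {1..3}" "i \<noteq> j"
    and nz: "\<not> (AE x in lborel. u i x = 0)" "\<not> (AE x in lborel. u j x = 0)"
  shows "0 < beta i j"
proof (rule ccontr)
  assume "\<not> 0 < beta i j"
  then have b: "beta i j \<le> 0" "beta j i \<le> 0" using beta_sym[OF ij] by auto
  have uH: "Hs3 u" using u by (simp add: maximiser_def)
  define a where "a k = jnorm2 s (lam k) (u k)" for k
  have a: "0 < a i" "0 < a j"
    using jnorm2_nonneg[OF ij(1), of "u i"] jnorm2_nonneg[OF ij(2), of "u j"]
      jnorm2_eq_0_imp[OF Hs3D[OF uH ij(1)] ij(1)] jnorm2_eq_0_imp[OF Hs3D[OF uH ij(2)] ij(2)] nz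
    by (auto simp: a_def less_le)
  \<comment> \<open>The amount of energy exchanged, at most what either component owns; this gives
    \<open>\<bar>d k\<bar> \<le> 1\<close>.\<close>
  define \<epsilon> where "\<epsilon> = min (a i) (a j)"
  have \<epsilon>: "0 < \<epsilon>" "\<epsilon> \<le> a i" "\<epsilon> \<le> a j" using a by (auto simp: \<epsilon>_def)
  define d where "d k = (if k = i then \<epsilon> / a i else if k = j then - (\<epsilon> / a j) else 0)" for k
  have di: "d i = \<epsilon> / a i" and dj: "d j = - (\<epsilon> / a j)" using ij by (auto simp: d_def)
  have d1: "\<bar>d k\<bar> \<le> 1" for k using a \<epsilon> by (auto simp: d_def)
  have sub: "{i, j} \<subseteq> {1..3}" using ij by auto
  have s2: "(\<Sum>k\<in>{1..3}. g k) = g i + g j" if "\<And>k. k \<noteq> i \<Longrightarrow> k \<noteq> j \<Longrightarrow> g k = 0" for g :: "nat \<Rightarrow> real"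
  proof -
    have "(\<Sum>k\<in>{1..3}. g k) = (\<Sum>k\<in>{i, j}. g k)"
      using sub that by (intro sum.mono_neutral_right) auto
    then show ?thesis using ij by simp
  qed
  have d0: "(\<Sum>k\<in>{1..3}. d k * jnorm2 s (lam k) (u k)) = 0"
  proof -
    have "(\<Sum>k\<in>{1..3}. d k * a k) = d i * a i + d j * a j" by (rule s2) (simp add: d_def)
    then show ?thesis using a by (simp add: a_def[symmetric] di dj)
  qed
  have "(\<Sum>k\<in>{1..3}. \<Sum>l\<in>{1..3}. coef k l * (d k * d l) * mixed u k l)
    = (coef i i * (d i * d i) * mixed u i i + coef i j * (d i * d j) * mixed u i j)
      + (coef j i * (d j * d i) * mixed u j i + coef j j * (d j * d j) * mixed u j j)"
    by (subst s2, simp add: d_def, subst s2, simp add: d_def, subst s2, simp add: d_def, simp)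
  then have le: "(coef i i * (d i * d i) * mixed u i i + coef i j * (d i * d j) * mixed u i j)
      + (coef j i * (d j * d i) * mixed u j i + coef j j * (d j * d j) * mixed u j j) \<le> 0"
    using second_variation[OF u d1 d0] by simp
  have "0 < mixed u i i"
  proof -
    have i4: "integrable lborel (\<lambda>x. (u i x)\<^sup>2 * (u i x)\<^sup>2)"
      by (rule int4_integrable_square_mult[OF Hs3_int4[OF uH ij(1)] Hs3_int4[OF uH ij(1)]])
    have "mixed u i i \<noteq> 0"
    proof
      assume "mixed u i i = 0"
      then have "AE x in lborel. (u i x)\<^sup>2 * (u i x)\<^sup>2 = 0"
        unfolding mixed_def by (subst (asm) integral_nonneg_eq_0_iff_AE[OF i4]) auto
      then show False using nz(1) by simp
    qed
    then show ?thesis using mixed_nonneg[of u i i] by simp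
  qed
  then have 1: "0 < coef i i * (d i * d i) * mixed u i i"
    using mu_pos[OF ij(1)] a \<epsilon> by (simp add: coef_def di)
  have 2: "0 \<le> coef j j * (d j * d j) * mixed u j j"
    using mu_pos[OF ij(2)] mixed_nonneg[of u j j] by (simp add: coef_def)
  have dd: "d i * d j \<le> 0" "d j * d i \<le> 0" using a \<epsilon> by (auto simp: di dj mult_nonneg_nonpos mult_nonpos_nonneg)
  have 3: "0 \<le> coef i j * (d i * d j) * mixed u i j" "0 \<le> coef j i * (d j * d i) * mixed u j i"
    using mult_nonpos_nonpos[OF b(1) dd(1)] mult_nonpos_nonpos[OF b(2) dd(2)] mixed_nonneg[of u] ij(3)
    by (simp_all add: coef_def mult_nonneg_nonneg)
  show False using le 1 2 3 by linarith
qed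

lemma maximiser_nonneg:
  "\<exists>u. maximiser u \<and> (\<forall>j\<in>{1..3}. \<forall>x. 0 \<le> u j x) \<and> (\<forall>j\<in>{1..3}. (\<forall>x. u j x = 0) \<or> \<not> (AE x in lborel. u j x = 0))"
proof -
  obtain u where u: "maximiser u" using maximiser_exists by (auto simp: maximiser_def)
  have uH: "Hs3 u" and u1: "nrm u = 1" and uS: "quart u = Smax" using u by (auto simp: maximiser_def)
  define v where "v j x = \<bar>u j x\<bar>" for j x
  have um: "u j \<in> borel_measurable borel" if "j \<in> {1..3}" for j using Hs3D[OF uH that] by auto
  have vm: "v j \<in> borel_measurable borel" if "j \<in> {1..3}" for j unfolding v_def using um[OF that] by simp
  have vH: "Hs3 v" using uH unfolding Hs3_def v_def by (auto intro: Hs_abs)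
  have "jnorm2 s (lam j) (v j) \<le> jnorm2 s (lam j) (u j)" if j: "j \<in> {1..3}" for j
  proof -
    have "gagliardo s (v j) \<le> gagliardo s (u j)"
      by (rule gagliardo_contraction[OF Hs3D[OF uH j] vm[OF j]]) (auto simp: v_def)
    moreover have "(LINT x|lborel. (v j x)\<^sup>2) = (LINT x|lborel. (u j x)\<^sup>2)" by (simp add: v_def)
    ultimately show ?thesis using gconst_pos by (simp add: jnorm2_eq)
  qed
  then have "nrm v \<le> nrm u" unfolding nrm_def by (rule sum_mono)
  moreover have "quart v = quart u" by (simp add: quart_def v_def)
  ultimately have v: "maximiser v" using u1 uS vH by (intro maximiserI) auto
  \<comment> \<open>Components that vanish almost everywhere are replaced by the zero function, so
    that later case distinctions can be made pointwise.\<close>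
  define w where "w j = (if AE x in lborel. v j x = 0 then (\<lambda>x. 0) else v j)" for j
  have "maximiser w"
    by (rule maximiser_cong_AE[OF v]) (use vm in \<open>auto simp: w_def elim: eventually_mono\<close>)
  moreover have "0 \<le> w j x" for j x by (auto simp: w_def v_def)
  moreover have "(\<forall>x. w j x = 0) \<or> \<not> (AE x in lborel. w j x = 0)" for j by (auto simp: w_def)
  ultimately show ?thesis by blast
qed

text \<open>The polarised vector is again a maximiser, so its norm is still 1. No component's norm
  grows, hence none drops; as the L2 part does not grow either, the Gagliardo energy stays the same
  and its equality case applies.\<close>

lemma maximiser_two_point:
  assumes u: "maximiser u" and nn: "\<And>j x. j \<in> {1..3} \<Longrightarrow> 0 \<le> u j x"
    and z: "\<And>j. j \<in> {1..3} \<Longrightarrow> (\<forall>x. u j x = 0) \<or> \<not> (AE x in lborel. u j x = 0)" and j: "j \<in> {1..3}"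
  shows "two_point (u j)"
proof (rule two_pointI)
  have uH: "Hs3 u" and u1: "nrm u = 1" and uS: "quart u = Smax" using u by (auto simp: maximiser_def)
  show "u j \<in> borel_measurable borel" using Hs3D[OF uH j] by auto
  fix e :: 'a and c :: real
  assume e: "norm e = 1"
  define p where "p j = polarise e c (u j)" for j
  have pH: "Hs3 p" using uH Hs_polarise[OF e s_pos] by (simp add: Hs3_def p_def)
  have g: "gagliardo s (p i) \<le> gagliardo s (u i)" and l: "(LINT x|lborel. (p i x)\<^sup>2) \<le> (LINT x|lborel. (u i x)\<^sup>2)"
    if "i \<in> {1..3}" for i
    unfolding p_def using gagliardo_polarise[OF e s_pos Hs3D[OF uH that]] L2_polarise[OF e s_pos Hs3D[OF uH that]] by auto
  have jle: "jnorm2 s (lam i) (p i) \<le> jnorm2 s (lam i) (u i)" if "i \<in> {1..3}" for i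
    unfolding jnorm2_eq using g[OF that] l[OF that] gconst_pos lam_pos[OF that]
    by (intro add_mono mult_left_mono) auto
  then have nle: "nrm p \<le> nrm u" unfolding nrm_def by (rule sum_mono)
  \<comment> \<open>A negative coupling occurs only when one of the two components is identically
    zero, by \<open>maximiser_coupling_pos\<close>, and polarising keeps it zero.\<close>
  have "coef i k * mixed u i k \<le> coef i k * mixed p i k" if ik: "i \<in> {1..3}" "k \<in> {1..3}" for i k
  proof (cases "(\<forall>x. u i x = 0) \<or> (\<forall>x. u k x = 0)")
    case True
    moreover have "p i x = 0" if "\<forall>x. u i x = 0" for i x using that by (simp add: p_def polarise_def)
    ultimately have "mixed u i k = 0" "mixed p i k = 0" by (auto simp: mixed_def)
    then show ?thesis by simp
  next
    case False
    then have "0 \<le> coef i k"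
      using z[OF ik(1)] z[OF ik(2)] maximiser_coupling_pos[OF u ik] mu_pos[OF ik(1)] by (auto simp: coef_def less_imp_le)
    moreover have "mixed u i k \<le> mixed p i k"
      unfolding mixed_def p_def
      using int4_integrable_square_mult[OF Hs3_int4[OF uH ik(1)] Hs3_int4[OF uH ik(2)]]
        int4_integrable_square_mult[OF Hs3_int4[OF pH ik(1)] Hs3_int4[OF pH ik(2)]]
      by (intro mixed_polarise[OF e s_pos nn[OF ik(1)] nn[OF ik(2)]]) (auto simp: p_def)
    ultimately show ?thesis by (rule mult_left_mono[rotated])
  qed
  then have "quart u \<le> quart p" unfolding quart_mixed by (intro sum_mono)
  then have "maximiser p" using nle u1 uS by (intro maximiserI[OF pH]) auto
  then have "nrm p = nrm u" using u1 by (simp add: maximiser_def)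
  then have "jnorm2 s (lam j) (p j) = jnorm2 s (lam j) (u j)"
    using sum_mono_inv[of "\<lambda>i. jnorm2 s (lam i) (p i)" "{1..3}" "\<lambda>i. jnorm2 s (lam i) (u i)" j] jle j
    by (auto simp: nrm_def)
  moreover have "lam j * (LINT x|lborel. (p j x)\<^sup>2) \<le> lam j * (LINT x|lborel. (u j x)\<^sup>2)"
    using l[OF j] lam_pos[OF j] by (intro mult_left_mono) auto
  ultimately have "gconst * gagliardo s (u j) \<le> gconst * gagliardo s (p j)" unfolding jnorm2_eq by linarith
  then have "gagliardo s (p j) = gagliardo s (u j)" using g[OF j] gconst_pos by simp
  then show "AE z in lborel \<Otimes>\<^sub>M lborel. c < fst z \<bullet> e \<longrightarrow> c < snd z \<bullet> e \<longrightarrow>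
      0 \<le> (u j (fst z) - u j (reflection e c (fst z))) * (u j (snd z) - u j (reflection e c (snd z)))"
    unfolding p_def by (rule gagliardo_polarise_eq[OF e s_pos Hs3D[OF uH j]])
qed

lemma maximiser_radial: "\<exists>u. maximiser u \<and> (\<forall>j\<in>{1..3}. radial (u j) \<and> (\<forall>x. 0 \<le> u j x))"
proof -
  obtain u where u: "maximiser u" and nn: "\<And>j x. j \<in> {1..3} \<Longrightarrow> 0 \<le> u j x"
    and z: "\<And>j. j \<in> {1..3} \<Longrightarrow> (\<forall>x. u j x = 0) \<or> \<not> (AE x in lborel. u j x = 0)"
    using maximiser_nonneg by blast
  have uH: "Hs3 u" and u1: "nrm u = 1" and uS: "quart u = Smax" using u by (auto simp: maximiser_def)
  have um: "u j \<in> borel_measurable borel" if "j \<in> {1..3}" for j using Hs3D[OF uH that] by auto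
  have tp: "two_point (u j)" if "j \<in> {1..3}" for j by (rule maximiser_two_point[OF u nn z that])
  have sq: "sq_integrable lborel (u j)" if "j \<in> {1..3}" for j using Hs3D[OF uH that] by (simp add: Hs_iff)
  have "\<forall>j. \<exists>t. j \<in> {1..3} \<longrightarrow> (\<forall>e. norm e = 1 \<longrightarrow> mirror_symmetric e 0 (\<lambda>x. u j (t + x)))"
    using two_point_centre[OF tp sq nn] by blast
  from choice[OF this] obtain t where t: "\<And>j e. j \<in> {1..3} \<Longrightarrow> norm e = 1 \<Longrightarrow> mirror_symmetric e 0 (\<lambda>x. u j (t j + x))" by blast
  \<comment> \<open>Each component is moved by its own centre, unlike the common translations used
    for compactness. The norms are unaffected, but the overlaps change and need
    \<open>centred_overlap\<close>.\<close>
  define v where "v j x = u j (t j + x)" for j x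
  note mp = measure_preserving_translation
  have vj: "Hs s (v j)" "jnorm2 s (lam j) (v j) = jnorm2 s (lam j) (u j)" if j: "j \<in> {1..3}" for j
  proof -
    have iso: "norm ((t j + x) - (t j + y)) = norm (x - y)" for x y by simp
    show "Hs s (v j)" "jnorm2 s (lam j) (v j) = jnorm2 s (lam j) (u j)"
      using Hs_comp[OF mp iso Hs3D[OF uH j]] gagliardo_comp[OF mp iso Hs3D[OF uH j]] L2_comp[OF mp iso Hs3D[OF uH j]]
      by (simp_all add: v_def[abs_def] jnorm2_eq)
  qed
  have vH: "Hs3 v" using vj by (simp add: Hs3_def)
  have vsq: "sq_integrable lborel (v j)" if "j \<in> {1..3}" for j using vj(1)[OF that] by (simp add: Hs_iff)
  have vnn: "0 \<le> v j x" if "j \<in> {1..3}" for j x using nn[OF that] by (simp add: v_def)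
  have vtp: "two_point (v j)" if "j \<in> {1..3}" for j
    unfolding v_def by (rule two_point_translate[OF tp[OF that]])
  have vsym: "mirror_symmetric e 0 (v j)" if "j \<in> {1..3}" "norm e = 1" for j e
    using t[OF that] by (simp add: v_def[abs_def])
  have "nrm v = nrm u" unfolding nrm_def using vj(2) by (rule sum.cong[OF refl])
  moreover have "coef i k * mixed u i k \<le> coef i k * mixed v i k" if ik: "i \<in> {1..3}" "k \<in> {1..3}" for i k
  proof (cases "(\<forall>x. u i x = 0) \<or> (\<forall>x. u k x = 0)")
    case True
    then have "mixed u i k = 0" "mixed v i k = 0" by (auto simp: mixed_def v_def)
    then show ?thesis by simp
  next
    case False
    then have "0 \<le> coef i k"
      using z[OF ik(1)] z[OF ik(2)] maximiser_coupling_pos[OF u ik] mu_pos[OF ik(1)] by (auto simp: coef_def less_imp_le)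
    moreover have "mixed u i k \<le> mixed v i k"
    proof -
      have m: "(\<lambda>x. (u i x)\<^sup>2 * (u k x)\<^sup>2) \<in> borel_measurable borel" using um[OF ik(1)] um[OF ik(2)] by simp
      have "mixed u i k = (LINT x|lborel. (u i (t i + x))\<^sup>2 * (u k (t i + x))\<^sup>2)"
        unfolding mixed_def by (rule measure_preserving_integral[OF mp m, symmetric])
      \<comment> \<open>Only the relative shift \<open>t k - t i\<close> of the two centres matters
        for the overlap.\<close>
      also have "\<dots> = (LINT x|lborel. (v i x)\<^sup>2 * (v k (x - (t k - t i)))\<^sup>2)"
        by (simp add: v_def algebra_simps)
      also have "\<dots> \<le> mixed v i k"
        unfolding mixed_def
        by (rule centred_overlap[OF vtp[OF ik(1)] vsq[OF ik(1)] Hs3_int4[OF vH ik(1)] vnn[OF ik(1)] vsym[OF ik(1)]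
              vtp[OF ik(2)] vsq[OF ik(2)] Hs3_int4[OF vH ik(2)] vnn[OF ik(2)] vsym[OF ik(2)]])
      finally show ?thesis .
    qed
    ultimately show ?thesis by (rule mult_left_mono[rotated])
  qed
  then have "quart u \<le> quart v" unfolding quart_mixed by (intro sum_mono)
  ultimately have v: "maximiser v" using u1 uS by (intro maximiserI[OF vH]) auto
  have "\<forall>j. \<exists>w. j \<in> {1..3} \<longrightarrow> w \<in> borel_measurable borel \<and> (AE x in lborel. w x = v j x) \<and> radial w \<and> (\<forall>x. 0 \<le> w x)"
    using radial_representative[OF vj(1) s_pos vnn vsym] by blast
  from choice[OF this] obtain w where w: "\<And>j. j \<in> {1..3} \<Longrightarrow> w j \<in> borel_measurable borel \<and> (AE x in lborel. w j x = v j x)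
      \<and> radial (w j) \<and> (\<forall>x. 0 \<le> w j x)" by blast
  have "maximiser w" by (rule maximiser_cong_AE[OF v]) (use w in auto)
  then show ?thesis using w by blast
qed

section \<open>The Euler--Lagrange equation and the energy of critical points\<close>

lemma jnorm2_perturb:
  fixes u \<phi> :: "'a \<Rightarrow> real"
  assumes u: "Hs s u" and \<phi>: "Hs s \<phi>"
  shows "jnorm2 s l (\<lambda>x. u x + t * \<phi> x)
    = jnorm2 s l u + 2 * t * (sform s u \<phi> + l * (LINT x|lborel. u x * \<phi> x)) + t\<^sup>2 * jnorm2 s l \<phi>"
proof -
  have exp: "(\<integral>x. (f x + t * g x)\<^sup>2 \<partial>M) = (\<integral>x. (f x)\<^sup>2 \<partial>M) + 2 * t * (\<integral>x. f x * g x \<partial>M) + t\<^sup>2 * (\<integral>x. (g x)\<^sup>2 \<partial>M)"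
    if f: "sq_integrable M f" and g: "sq_integrable M g" for f g :: "'c \<Rightarrow> real" and M
  proof -
    have "(f x + t * g x)\<^sup>2 = (f x)\<^sup>2 + 2 * t * (f x * g x) + t\<^sup>2 * (g x)\<^sup>2" for x
      by (simp add: power2_eq_square algebra_simps)
    then show ?thesis
      using sq_integrable_square[OF f] sq_integrable_square[OF g] sq_integrable_mult[OF f g] by simp
  qed
  have d: "sq_integrable (lborel \<Otimes>\<^sub>M lborel) (dquot s u)" "sq_integrable (lborel \<Otimes>\<^sub>M lborel) (dquot s \<phi>)"
    "sq_integrable lborel u" "sq_integrable lborel \<phi>"
    using u \<phi> by (auto simp: Hs_iff)
  have "gagliardo s (\<lambda>x. u x + t * \<phi> x)
      = gagliardo s u + 2 * t * (LINT z|(lborel \<Otimes>\<^sub>M lborel). dquot s u z * dquot s \<phi> z) + t\<^sup>2 * gagliardo s \<phi>"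
    unfolding gagliardo_def dquot_add dquot_cmult by (rule exp[OF d(1,2)])
  then show ?thesis
    unfolding jnorm2_eq sform_eq exp[OF d(3,4)] by (simp add: gconst_def algebra_simps)
qed

text \<open>Only the linear coefficient matters for a derivative at 0, so the higher ones stay
  unnamed. Its factor 4 comes from the fourth power in the \<open>mu j\<close> term, and in the
  couplings from the square together with counting each pair twice.\<close>

lemma quart_perturb:
  assumes u: "Hs3 u" and \<phi>: "Hs s \<phi>" and j: "j \<in> {1..3}"
  defines "G \<equiv> mu j * (LINT x|lborel. (u j x)^3 * \<phi> x)
     + (\<Sum>k\<in>{1..3} - {j}. beta j k * (LINT x|lborel. (u k x)\<^sup>2 * u j x * \<phi> x))"
  shows "\<exists>a b c. \<forall>t. quart (u(j := \<lambda>x. u j x + t * \<phi> x)) = quart u + t * (4 * G) + t^2 * a + t^3 * b + t^4 * c"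
proof -
  have uj: "int4 (u j)" and p: "int4 \<phi>" by (rule Hs3_int4[OF u j], rule Hs_int4[OF \<phi>])
  have "(LINT x|lborel. (u j x + t * \<phi> x)\<^sup>2 * (u j x + t * \<phi> x)\<^sup>2)
    = (LINT x|lborel. u j x * u j x * (u j x * u j x)) + 4 * t * (LINT x|lborel. u j x * u j x * (u j x * \<phi> x))
     + 6 * t^2 * (LINT x|lborel. u j x * u j x * (\<phi> x * \<phi> x)) + 4 * t^3 * (LINT x|lborel. u j x * \<phi> x * (\<phi> x * \<phi> x))
     + t^4 * (LINT x|lborel. \<phi> x * \<phi> x * (\<phi> x * \<phi> x))" for t
  proof -
    have "(u j x + t * \<phi> x)\<^sup>2 * (u j x + t * \<phi> x)\<^sup>2
      = u j x * u j x * (u j x * u j x) + 4 * t * (u j x * u j x * (u j x * \<phi> x))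
     + 6 * t^2 * (u j x * u j x * (\<phi> x * \<phi> x)) + 4 * t^3 * (u j x * \<phi> x * (\<phi> x * \<phi> x))
     + t^4 * (\<phi> x * \<phi> x * (\<phi> x * \<phi> x))" for x
      by (simp add: power2_eq_square power3_eq_cube power4_eq_xxxx algebra_simps)
    then show ?thesis
      using int4_integrable_mult[OF uj uj uj uj] int4_integrable_mult[OF uj uj uj p] int4_integrable_mult[OF uj uj p p]
        int4_integrable_mult[OF uj p p p] int4_integrable_mult[OF p p p p] by simp
  qed
  then have 1: "mixed (u(j := \<lambda>x. u j x + t * \<phi> x)) j j = mixed u j j + 4 * t * (LINT x|lborel. (u j x)^3 * \<phi> x)
     + 6 * t^2 * (LINT x|lborel. u j x * u j x * (\<phi> x * \<phi> x)) + 4 * t^3 * (LINT x|lborel. u j x * \<phi> x * (\<phi> x * \<phi> x))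
     + t^4 * (LINT x|lborel. \<phi> x * \<phi> x * (\<phi> x * \<phi> x))" for t
    by (simp add: mixed_def power2_eq_square power3_eq_cube mult.assoc)
  have 2: "mixed (u(j := \<lambda>x. u j x + t * \<phi> x)) j k = mixed u j k + 2 * t * (LINT x|lborel. (u k x)\<^sup>2 * u j x * \<phi> x)
     + t^2 * (LINT x|lborel. (u k x)\<^sup>2 * (\<phi> x)\<^sup>2)" if k: "k \<in> {1..3} - {j}" for t k
  proof -
    have uk: "int4 (u k)" using k by (intro Hs3_int4[OF u]) auto
    have "(u j x + t * \<phi> x)\<^sup>2 * (u k x)\<^sup>2 = (u j x)\<^sup>2 * (u k x)\<^sup>2 + 2 * t * (u k x * u k x * (u j x * \<phi> x))
      + t^2 * ((u k x)\<^sup>2 * (\<phi> x)\<^sup>2)" for x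
      by (simp add: power2_eq_square algebra_simps)
    then have "(LINT x|lborel. (u j x + t * \<phi> x)\<^sup>2 * (u k x)\<^sup>2) = (LINT x|lborel. (u j x)\<^sup>2 * (u k x)\<^sup>2)
      + 2 * t * (LINT x|lborel. u k x * u k x * (u j x * \<phi> x)) + t^2 * (LINT x|lborel. (u k x)\<^sup>2 * (\<phi> x)\<^sup>2)"
      using int4_integrable_square_mult[OF uj uk] int4_integrable_mult[OF uk uk uj p] int4_integrable_square_mult[OF uk p] by simp
    then show ?thesis using k by (simp add: mixed_def power2_eq_square mult.assoc)
  qed
  have 3: "(\<Sum>i\<in>{1..3}-{j}. \<Sum>k\<in>{1..3}-{j}. coef i k * mixed (u(j := \<lambda>x. u j x + t * \<phi> x)) i k)
    = (\<Sum>i\<in>{1..3}-{j}. \<Sum>k\<in>{1..3}-{j}. coef i k * mixed u i k)" for t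
    by (intro sum.cong refl) (auto simp: mixed_def)
  have 4: "(\<Sum>k\<in>{1..3}-{j}. beta j k * mixed (u(j := \<lambda>x. u j x + t * \<phi> x)) j k)
    = (\<Sum>k\<in>{1..3}-{j}. beta j k * mixed u j k) + 2 * t * (\<Sum>k\<in>{1..3}-{j}. beta j k * (LINT x|lborel. (u k x)\<^sup>2 * u j x * \<phi> x))
     + t^2 * (\<Sum>k\<in>{1..3}-{j}. beta j k * (LINT x|lborel. (u k x)\<^sup>2 * (\<phi> x)\<^sup>2))" for t
    unfolding sum_distrib_left sum.distrib[symmetric] by (intro sum.cong refl) (simp add: 2 algebra_simps)
  show ?thesis
  proof (intro exI allI)
    fix t
    show "quart (u(j := \<lambda>x. u j x + t * \<phi> x)) = quart u + t * (4 * G)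
      + t^2 * (6 * mu j * (LINT x|lborel. u j x * u j x * (\<phi> x * \<phi> x)) + 2 * (\<Sum>k\<in>{1..3}-{j}. beta j k * (LINT x|lborel. (u k x)\<^sup>2 * (\<phi> x)\<^sup>2)))
      + t^3 * (4 * mu j * (LINT x|lborel. u j x * \<phi> x * (\<phi> x * \<phi> x))) + t^4 * (mu j * (LINT x|lborel. \<phi> x * \<phi> x * (\<phi> x * \<phi> x)))"
      unfolding quart_split[OF j] 1 3 4 G_def by (simp only: distrib_left distrib_right mult.assoc mult.left_commute mult.commute add.assoc add.left_commute add.commute)
  qed
qed

text \<open>The function \<open>Smax * (nrm v)\<^sup>2 - quart v\<close> is nonnegative and vanishes
  at the maximiser, so its derivative along every direction is 0 there. This homogeneous form
  dispenses with a constraint, and \<open>Smax\<close> appears as the multiplier.\<close>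

lemma euler_lagrange:
  assumes u: "maximiser u" and \<phi>: "Hs s \<phi>" and j: "j \<in> {1..3}"
  shows "Smax * (sform s (u j) \<phi> + lam j * (LINT x|lborel. u j x * \<phi> x)) = mu j * (LINT x|lborel. (u j x)^3 * \<phi> x)
     + (\<Sum>k\<in>{1..3} - {j}. beta j k * (LINT x|lborel. (u k x)\<^sup>2 * u j x * \<phi> x))" (is "Smax * ?B = ?G")
proof -
  have uH: "Hs3 u" and u1: "nrm u = 1" and uS: "quart u = Smax" using u by (auto simp: maximiser_def)
  define A where "A = jnorm2 s (lam j) \<phi>"
  define B where "B = ?B"
  define G where "G = ?G"
  define v where "v t = u(j := \<lambda>x. u j x + t * \<phi> x)" for t
  have vH: "Hs3 (v t)" for t
    using uH \<phi> by (auto simp: Hs3_def v_def intro!: Hs_add Hs_cmult)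
  have vn: "nrm (v t) = 1 + 2 * t * B + t^2 * A" for t
  proof -
    have "nrm (v t) = jnorm2 s (lam j) (\<lambda>x. u j x + t * \<phi> x) + (\<Sum>k\<in>{1..3}-{j}. jnorm2 s (lam k) (u k))"
      unfolding nrm_def using j by (subst sum.remove[of _ j]) (auto simp: v_def intro!: sum.cong)
    moreover have "nrm u = jnorm2 s (lam j) (u j) + (\<Sum>k\<in>{1..3}-{j}. jnorm2 s (lam k) (u k))"
      unfolding nrm_def using j by (subst sum.remove[of _ j]) auto
    ultimately show ?thesis
      using u1 by (simp add: jnorm2_perturb[OF Hs3D[OF uH j] \<phi>] A_def B_def)
  qed
  obtain a b c where q: "\<And>t. quart (v t) = Smax + t * (4 * G) + t^2 * a + t^3 * b + t^4 * c"
    using quart_perturb[OF uH \<phi> j] unfolding v_def G_def uS by blast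
  define f where "f t = Smax * (1 + 2 * t * B + t^2 * A)^2 - (Smax + t * (4 * G) + t^2 * a + t^3 * b + t^4 * c)" for t
  have f0: "f 0 = 0" by (simp add: f_def)
  have f: "0 \<le> f t" for t
    using quart_le_Smax[OF vH, of t] unfolding vn q f_def by simp
  have "(f has_real_derivative 4 * Smax * B - 4 * G) (at 0)"
    unfolding f_def by (auto intro!: derivative_eq_intros)
  then have "4 * Smax * B - 4 * G = 0"
    by (rule DERIV_local_min[of _ _ _ 1]) (use f f0 in auto)
  then show ?thesis by (simp add: B_def G_def)
qed

text \<open>The left side of the equation is linear and the right side cubic in the vector, so a
  factor \<open>c\<close> with \<open>c\<^sup>2 * Smax = 1\<close> absorbs the multiplier.\<close>

lemma critical_of_maximiser:
  assumes u: "maximiser u"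
  shows "crit s lam mu beta (\<lambda>j x. 1 / sqrt Smax * u j x)"
  unfolding crit_def
proof (intro conjI ballI allI impI)
  have uH: "Hs3 u" using u by (simp add: maximiser_def)
  define c where "c = 1 / sqrt Smax"
  have c2: "c\<^sup>2 * Smax = 1" using Smax_pos by (simp add: c_def power_divide)
  show "Hs s (\<lambda>x. 1 / sqrt Smax * u j x)" if "j \<in> {1..3}" for j by (rule Hs_cmult[OF Hs3D[OF uH that]])
  fix j :: nat and \<phi> :: "'a \<Rightarrow> real"
  assume j: "j \<in> {1..3}" and \<phi>: "Hs s \<phi>"
  define B where "B = sform s (u j) \<phi> + lam j * (LINT x|lborel. u j x * \<phi> x)"
  define G where "G = mu j * (LINT x|lborel. (u j x)^3 * \<phi> x)
     + (\<Sum>k\<in>{1..3} - {j}. beta j k * (LINT x|lborel. (u k x)\<^sup>2 * u j x * \<phi> x))"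
  have EL: "Smax * B = G" unfolding B_def G_def by (rule euler_lagrange[OF u \<phi> j])
  have sf: "sform s (\<lambda>x. c * u j x) \<phi> = c * sform s (u j) \<phi>"
    by (simp add: sform_eq dquot_cmult mult.assoc)
  have L: "sform s (\<lambda>x. c * u j x) \<phi> + lam j * (LINT x|lborel. c * u j x * \<phi> x) = c * B"
    by (simp add: sf B_def mult.assoc distrib_left)
  have i1: "(LINT x|lborel. (c * u j x)^3 * \<phi> x) = c^3 * (LINT x|lborel. (u j x)^3 * \<phi> x)"
    by (simp add: power_mult_distrib mult.assoc)
  have i2: "(LINT x|lborel. (c * u k x)\<^sup>2 * (c * u j x) * \<phi> x) = c^3 * (LINT x|lborel. (u k x)\<^sup>2 * u j x * \<phi> x)" for k
  proof -
    have "(c * u k x)\<^sup>2 * (c * u j x) * \<phi> x = c^3 * ((u k x)\<^sup>2 * u j x * \<phi> x)" for x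
      by (simp add: power_mult_distrib power2_eq_square power3_eq_cube)
    then show ?thesis by (simp only: integral_mult_right_zero)
  qed
  have Rr: "mu j * (LINT x|lborel. (c * u j x)^3 * \<phi> x)
      + (\<Sum>k\<in>{1..3} - {j}. beta j k * (LINT x|lborel. (c * u k x)\<^sup>2 * (c * u j x) * \<phi> x)) = c^3 * G"
    unfolding i1 i2 G_def by (simp add: distrib_left sum_distrib_left mult.left_commute)
  have "c^3 * G = c * (c\<^sup>2 * Smax) * B" by (simp add: EL[symmetric] power2_eq_square power3_eq_cube)
  then have "c^3 * G = c * B" by (simp add: c2)
  then show "sform s (\<lambda>x. 1 / sqrt Smax * u j x) \<phi> + lam j * (LINT x|lborel. 1 / sqrt Smax * u j x * \<phi> x)
        = mu j * (LINT x|lborel. (1 / sqrt Smax * u j x)^3 * \<phi> x)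
          + (\<Sum>k\<in>{1..3} - {j}. beta j k * (LINT x|lborel. (1 / sqrt Smax * u k x)\<^sup>2 * (1 / sqrt Smax * u j x) * \<phi> x))"
    using L Rr unfolding c_def by simp
qed

lemma Phi_eq: "Phi s lam mu beta u = 1 / 2 * nrm u - 1 / 4 * quart u" for u :: "nat \<Rightarrow> 'a \<Rightarrow> real"
proof -
  have I: "{1..3} = {1, 2, 3::nat}" by auto
  have "beta 2 1 = beta 1 2" "beta 3 1 = beta 1 3" "beta 3 2 = beta 2 3" using beta_sym by auto
  moreover have "mixed u 2 1 = mixed u 1 2" "mixed u 3 1 = mixed u 1 3" "mixed u 3 2 = mixed u 2 3"
    by (rule mixed_commute)+
  moreover have "(LINT x|lborel. (u j x)^4) = mixed u j j" for j
    unfolding mixed_def by (simp flip: power_add)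
  ultimately show ?thesis
    unfolding Phi_def nrm_def quart_mixed mixed_def[symmetric] I by (simp add: coef_def) (simp add: field_simps)
qed

text \<open>The Nehari identity: each equation is tested with its own component and the results are
  added.\<close>

lemma crit_nrm_eq_quart:
  assumes v: "crit s lam mu beta v"
  shows "Hs3 v" and "nrm v = quart v"
proof -
  show vH: "Hs3 v" using v by (simp add: crit_def Hs3_def)
  have "jnorm2 s (lam j) (v j) = (\<Sum>k\<in>{1..3}. coef j k * mixed v j k)" if j: "j \<in> {1..3}" for j
  proof -
    have "sform s (v j) (v j) + lam j * (LINT x|lborel. v j x * v j x) = mu j * (LINT x|lborel. (v j x)^3 * v j x)
          + (\<Sum>k\<in>{1..3} - {j}. beta j k * (LINT x|lborel. (v k x)\<^sup>2 * v j x * v j x))"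
      using v Hs3D[OF vH j] j unfolding crit_def by blast
    moreover have "(LINT x|lborel. (v j x)^3 * v j x) = mixed v j j"
      by (simp add: mixed_def power2_eq_square power3_eq_cube mult.assoc)
    moreover have "(LINT x|lborel. (v k x)\<^sup>2 * v j x * v j x) = mixed v j k" for k
      unfolding mixed_def by (intro Bochner_Integration.integral_cong) (auto simp: power2_eq_square)
    ultimately have "jnorm2 s (lam j) (v j) = mu j * mixed v j j + (\<Sum>k\<in>{1..3} - {j}. beta j k * mixed v j k)"
      by (simp add: jnorm2_def power2_eq_square)
    also have "\<dots> = coef j j * mixed v j j + (\<Sum>k\<in>{1..3} - {j}. coef j k * mixed v j k)"
      by (auto simp: coef_def intro!: sum.cong)
    also have "\<dots> = (\<Sum>k\<in>{1..3}. coef j k * mixed v j k)"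
      using j by (intro sum.remove[symmetric]) auto
    finally show ?thesis .
  qed
  then show "nrm v = quart v" unfolding nrm_def quart_mixed by (rule sum.cong[OF refl])
qed

lemma ground_state_exists:
  "\<exists>u :: nat \<Rightarrow> 'a \<Rightarrow> real. crit s lam mu beta u \<and> nontriv u \<and> (\<forall>j\<in>{1..3}. radial (u j) \<and> (\<forall>x. u j x \<ge> 0)) \<and>
     (\<forall>v :: nat \<Rightarrow> 'a \<Rightarrow> real. crit s lam mu beta v \<and> nontriv v \<longrightarrow> Phi s lam mu beta u \<le> Phi s lam mu beta v)"
proof -
  obtain w where w: "maximiser w" and rad: "\<And>j. j \<in> {1..3} \<Longrightarrow> radial (w j) \<and> (\<forall>x. 0 \<le> w j x)"
    using maximiser_radial by blast
  define c where "c = 1 / sqrt Smax"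
  have c: "c > 0" and c2: "c\<^sup>2 = 1 / Smax" using Smax_pos by (auto simp: c_def power_divide)
  define u where "u = (\<lambda>j x. c * w j x)"
  have uc: "crit s lam mu beta u" unfolding u_def c_def by (rule critical_of_maximiser[OF w])
  have n: "nrm u = 1 / Smax" using w by (simp add: u_def nrm_cmult c2 maximiser_def)
  have pos: "0 < nrm v" "1 / Smax \<le> nrm v" if v: "crit s lam mu beta v" "nontriv v" for v :: "nat \<Rightarrow> 'a \<Rightarrow> real"
  proof -
    note vH = crit_nrm_eq_quart(1)[OF v(1)]
    show p: "0 < nrm v"
      using nrm_eq_0_imp[OF vH] v(2) nrm_nonneg[of v] by (auto simp: nontriv_def less_le)
    have "nrm v * 1 \<le> nrm v * (Smax * nrm v)"
      using quart_le_Smax[OF vH] crit_nrm_eq_quart(2)[OF v(1)] by (simp add: power2_eq_square mult_ac)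
    then have "1 \<le> Smax * nrm v" using p by (simp only: mult_le_cancel_left_pos)
    then show "1 / Smax \<le> nrm v" using Smax_pos by (simp add: field_simps)
  qed
  have Phi_crit: "Phi s lam mu beta v = nrm v / 4" if "crit s lam mu beta v" for v :: "nat \<Rightarrow> 'a \<Rightarrow> real"
    using crit_nrm_eq_quart(2)[OF that] by (simp add: Phi_eq)
  have "nontriv u"
    unfolding nontriv_def
  proof
    assume z: "\<forall>j\<in>{1..3}. AE x in lborel. u j x = 0"
    have "(LINT x|lborel. (u j x)^4) \<le> 0" if "j \<in> {1..3}" for j
    proof -
      have "(LINT x|lborel. (u j x)^4) = 0"
        using z that by (intro integral_eq_zero_AE) (auto elim: eventually_mono)
      then show ?thesis by simp
    qed
    then have "quart u \<le> 0" using quart_le_L4[OF crit_nrm_eq_quart(1)[OF uc], of 0] by simp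
    moreover have "0 < 1 / Smax" using Smax_pos by simp
    ultimately show False using crit_nrm_eq_quart(2)[OF uc] n by linarith
  qed
  moreover have "radial (u j) \<and> (\<forall>x. u j x \<ge> 0)" if j: "j \<in> {1..3}" for j
  proof (intro conjI allI)
    show "radial (u j)"
      unfolding radial_def
    proof (intro allI impI)
      fix x y :: 'a assume "norm x = norm y"
      then have "w j x = w j y" using rad[OF j] unfolding radial_def by blast
      then show "u j x = u j y" by (simp only: u_def)
    qed
    show "0 \<le> u j x" for x using rad[OF j] c by (simp add: u_def)
  qed
  moreover have "Phi s lam mu beta u \<le> Phi s lam mu beta v" if "crit s lam mu beta v \<and> nontriv v" for v :: "nat \<Rightarrow> 'a \<Rightarrow> real"
    using that pos(2)[of v] Phi_crit[OF uc] Phi_crit[of v] n by simp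
  ultimately show ?thesis
    by (intro exI[of _ u] conjI uc ballI allI impI) simp_all
qed

end

theorem theorem5p1:
  fixes s :: real and lam mu :: "nat \<Rightarrow> real" and beta :: "nat \<Rightarrow> nat \<Rightarrow> real"
  assumes "DIM('a::euclidean_space) \<le> 3"
    and "real DIM('a) / 4 < s" and "s < 1"
    and "\<forall>j\<in>{1..3}. lam j > 0 \<and> mu j > 0"
    and "\<forall>i\<in>{1..3}. \<forall>j\<in>{1..3}. i \<noteq> j \<longrightarrow> beta i j = beta j i"
    and "\<forall>i\<in>{1..3}. \<exists>j\<in>{1..3}. j \<noteq> i \<and>
           beta i j > gamma2 s (lam j) (Ugs s (lam i) (mu i) :: 'a \<Rightarrow> real)"
  shows "\<exists>u :: nat \<Rightarrow> 'a \<Rightarrow> real.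
           crit s lam mu beta u \<and> nontriv u \<and>
           (\<forall>j\<in>{1..3}. radial (u j) \<and> (\<forall>x. u j x \<ge> 0)) \<and>
           (\<forall>v :: nat \<Rightarrow> 'a \<Rightarrow> real. crit s lam mu beta v \<and> nontriv v \<longrightarrow>
              Phi s lam mu beta u \<le> Phi s lam mu beta v)"
proof -
  interpret coupled_system "TYPE('a)" s lam mu beta
    by unfold_locales (use assms in auto)
  show ?thesis by (rule ground_state_exists)
qed

end
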